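(* Let $T,T_1,T_2\in\mathcal{B}(\mathcal{H})$ be contractions. Then: (i) if $T_1T_2=T_2T_1$, then $A_{T_1T_2}\le A_{T_1}$ and $A_{T_1T_2}\le A_{T_2}$; (ii) if $T$ is completely non-unitary and $u\in H^\infty$ is a non-constant inner function, then $A_T=A_{u(T)}$; (iii) if $A_{T_1}=A_{T_2}=A$, then $A\le A_{T_1T_2}$; (iv) if $T_1T_2=T_2T_1$ and $A_{T_1}=A_{T_2}$, then $A_{T_1T_2}=A_{T_1}=A_{T_2}$.
   Context: For a contraction $T$, $A_T$ denotes the strong-operator limit of $T^{*n}T^n$. A contraction is completely non-unitary (c.n.u.) if it has no nonzero reducing subspace on which it is unitary. $H^\infty$ is the algebra of bounded analytic functions on the open unit disc; an inner function is $u\in H^\infty$ with $|u|=1$ a.e. on the unit circle. For a c.n.u. contraction $T$, $u(T)$ is defined via the Sz.-Nagy–Foias $H^\infty$-functional calculus (the contractive, weak-* continuous algebra homomorphism $H^\infty\to\mathcal{B}(\mathcal{H})$ sending $1\mapsto I$ and $z\mapsto T$). *)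

theory Defs
  imports "HOL-Analysis.Analysis"
begin

text \<open>A complex Hilbert space is encoded as a real Hilbert space (type class
  real_inner + complete_space) together with a complex structure J (multiplication
  by the imaginary unit), an orthogonal real-linear map with J (J x) = - x.
  The real inner product is the real part of the complex inner product.\<close>

definition cplx_structure :: "('a::real_inner \<Rightarrow> 'a) \<Rightarrow> bool" where
  "cplx_structure J \<longleftrightarrow> linear J \<and> (\<forall>x. J (J x) = - x) \<and> (\<forall>x y. inner (J x) (J y) = inner x y)"

definition scaleJ :: "('a::real_vector \<Rightarrow> 'a) \<Rightarrow> complex \<Rightarrow> 'a \<Rightarrow> 'a" where
  "scaleJ J c x = Re c *\<^sub>R x + Im c *\<^sub>R J x"

definition bop :: "('a::real_normed_vector \<Rightarrow> 'a) \<Rightarrow> ('a \<Rightarrow> 'a) \<Rightarrow> bool" where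
  "bop J T \<longleftrightarrow> bounded_linear T \<and> (\<forall>x. T (J x) = J (T x))"

definition contraction :: "('a::real_normed_vector \<Rightarrow> 'a) \<Rightarrow> ('a \<Rightarrow> 'a) \<Rightarrow> bool" where
  "contraction J T \<longleftrightarrow> bop J T \<and> (\<forall>x. norm (T x) \<le> norm x)"

text \<open>Hilbert space adjoint (for complex-linear T it coincides with the complex adjoint).\<close>
definition adj :: "('a::real_inner \<Rightarrow> 'a) \<Rightarrow> 'a \<Rightarrow> 'a" where
  "adj T = (THE S. \<forall>x y. inner (T x) y = inner x (S y))"

definition A_op :: "('a::real_inner \<Rightarrow> 'a) \<Rightarrow> 'a \<Rightarrow> 'a" where
  "A_op T = (\<lambda>x. lim (\<lambda>n. (adj T ^^ n) ((T ^^ n) x)))"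

definition op_le :: "('a::real_inner \<Rightarrow> 'a) \<Rightarrow> ('a \<Rightarrow> 'a) \<Rightarrow> bool" where
  "op_le A B \<longleftrightarrow> (\<forall>x. inner (A x) x \<le> inner (B x) x)"

definition reducing :: "('a::real_inner \<Rightarrow> 'a) \<Rightarrow> ('a \<Rightarrow> 'a) \<Rightarrow> 'a set \<Rightarrow> bool" where
  "reducing J T M \<longleftrightarrow> closed M \<and> subspace M \<and> (\<forall>x\<in>M. J x \<in> M) \<and>
     T ` M \<subseteq> M \<and> adj T ` M \<subseteq> M"

definition cnu :: "('a::real_inner \<Rightarrow> 'a) \<Rightarrow> ('a \<Rightarrow> 'a) \<Rightarrow> bool" where
  "cnu J T \<longleftrightarrow> (\<forall>M. reducing J T M \<and> (\<forall>x\<in>M. adj T (T x) = x \<and> T (adj T x) = x)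
                     \<longrightarrow> M = {0})"

definition Hinf :: "(complex \<Rightarrow> complex) \<Rightarrow> bool" where
  "Hinf u \<longleftrightarrow> u holomorphic_on ball 0 1 \<and> bounded (u ` ball 0 1)"

definition inner_function :: "(complex \<Rightarrow> complex) \<Rightarrow> bool" where
  "inner_function u \<longleftrightarrow> Hinf u \<and>
     (AE \<theta> in lebesgue_on {0..2*pi}.
        \<exists>l. ((\<lambda>r::real. u (complex_of_real r * cis \<theta>)) \<longlongrightarrow> l) (at_left 1) \<and> cmod l = 1)"

text \<open>Sz.-Nagy--Foias H^\<infinity> functional calculus for a c.n.u. contraction:
  u(T) = strong limit as r \<rightarrow> 1- of u_r(T) = \<Sum> a_n r^n T^n, where a_n are the
  Taylor coefficients of u at 0.\<close>
definition hinf_calc :: "('a::real_normed_vector \<Rightarrow> 'a) \<Rightarrow> (complex \<Rightarrow> complex) \<Rightarrow> ('a \<Rightarrow> 'a) \<Rightarrow> 'a \<Rightarrow> 'a" where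
  "hinf_calc J u T = (\<lambda>x. Lim (at_left (1::real))
      (\<lambda>r. \<Sum>n. scaleJ J ((deriv ^^ n) u 0 / of_nat (fact n) * complex_of_real (r ^ n)) ((T ^^ n) x)))"

end

theory Submission
  imports Defs "HOL-Probability.Probability" "HOL-Complex_Analysis.Complex_Analysis"
begin

text \<open>
  Since \<open>\<langle>A\<^sub>T x, x\<rangle>\<close> is the limit of the decreasing sequence \<open>\<parallel>T\<^sup>n x\<parallel>\<^sup>2\<close>, the form of \<open>A\<^sub>T\<close> is dominated by
  the norm and preserved by \<open>T\<close>; this settles (i), (iii) and (iv).

  For (ii), the sequences \<open>\<langle>T\<^sup>n x, x\<rangle>\<close> and \<open>\<langle>A\<^sub>T T\<^sup>n x, x\<rangle>\<close> are Fourier coefficients of positive measures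
  \<open>\<mu>\<close> and \<open>\<nu>\<close> on the circle with \<open>\<parallel>p(T) x\<parallel>\<^sup>2 \<le> \<integral> |p|\<^sup>2 d\<mu>\<close> and \<open>\<langle>A\<^sub>T p(T) x, p(T) x\<rangle> = \<integral> |p|\<^sup>2 d\<nu>\<close> for
  polynomials \<open>p\<close>.  If \<open>T\<close> is completely non-unitary, both are absolutely continuous: were \<open>N\<close> a null
  set carrying the singular part of \<open>\<mu>\<close>, polynomials \<open>p\<^sub>n\<close> bounded by 1 and converging to the indicator
  of \<open>N\<close> almost everywhere for both \<open>\<mu>\<close> and Lebesgue measure would give a vector \<open>z = lim p\<^sub>n(T) x\<close>
  with \<open>p\<^sub>n(T) z \<longlonglongrightarrow> z\<close>, and such vectors span a unitary part of \<open>T\<close>.  Hence dominated convergence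
  yields the strong limit \<open>u(T)\<close> and shows that \<open>u(T)\<close> preserves the form of \<open>A\<^sub>T\<close>, because \<open>|u| = 1\<close>
  almost everywhere on the circle; thus \<open>A\<^sub>T \<le> A\<^sub>u\<^sub>(\<^sub>T\<^sub>)\<close>.  Conversely, the Taylor coefficients of \<open>u\<^sup>m\<close> of
  index less than \<open>k\<close> tend to 0 as \<open>m\<close> grows, so by the von Neumann inequality \<open>\<parallel>u(T)\<^sup>m x\<parallel>\<close> is
  asymptotically at most \<open>\<parallel>T\<^sup>k x\<parallel>\<close>.
\<close>

section \<open>Adjoints and the asymptotic limit\<close>

text \<open>The obstacle in (ii) is that u has boundary values only almost everywhere and that p(T)
  is not a multiplication operator. The substitute is one scalar measure per vector and per form.
  For the norm only an inequality between norm and L2 integral survives; it turns almost everywhere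
  convergence of bounded polynomials into strong convergence, but does not show that anything is
  preserved. The form of \<open>A_op T\<close> is preserved by T exactly, so its measure satisfies
  an equality and can see |u| = 1; hence two measures. Functions are replaced by polynomials bounded
  by 1 on the disc, which von Neumann's inequality turns into contractions. Polynomials peaking on a
  null set come from complex analysis: cover the set by arcs of tiny total length, add Poisson
  kernels that are large on the arcs but have tiny mean, and compress the resulting half-plane
  valued function F into a disc by F/(d + F), which is near 1 on the arcs and still has small
  mean.\<close>

lemma Riesz_representation:
  fixes f :: "'a::{real_inner, complete_space} \<Rightarrow> real"
  assumes "bounded_linear f"
  obtains y where "\<And>x. f x = inner x y"
proof -
  interpret f: bounded_linear f by fact
  obtain K where K: "K \<ge> 0" "\<And>x. norm (f x) \<le> norm x * K"
    using f.nonneg_bounded by blast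
  \<comment> \<open>If f is represented by y, then \<open>\<phi> x\<close> is the squared distance
    from x to y minus the squared norm of y: the representing vector is the minimiser.\<close>
  define \<phi> where "\<phi> x = (norm x)\<^sup>2 - 2 * f x" for x
  have lower: "- K\<^sup>2 \<le> \<phi> x" for x
  proof -
    have "f x \<le> norm x * K" using K(2)[of x] by simp
    moreover have "0 \<le> (norm x - K)\<^sup>2" by simp
    ultimately show ?thesis by (simp add: \<phi>_def power2_diff)
  qed
  define d where "d = (INF x. \<phi> x)"
  have bdd: "bdd_below (range \<phi>)" using lower by (auto intro!: bdd_belowI[where m = "- K\<^sup>2"])
  have d_le: "d \<le> \<phi> x" for x unfolding d_def by (rule cINF_lower[OF bdd]) simp
  have "\<exists>x. \<phi> x < d + 1 / real (Suc n)" for n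
    using cINF_less_iff[OF _ bdd, of "d + 1 / real (Suc n)"] by (auto simp: d_def)
  then obtain X where X: "\<And>n. \<phi> (X n) < d + 1 / real (Suc n)" by metis
  \<comment> \<open>Parallelogram law; the linear parts cancel. It makes the minimising sequence
    Cauchy.\<close>
  have para: "(norm (x - y))\<^sup>2 = 2 * \<phi> x + 2 * \<phi> y - 4 * \<phi> ((1/2) *\<^sub>R (x + y))" for x y
    by (simp add: \<phi>_def f.scaleR f.add power2_norm_eq_inner inner_simps inner_commute
        algebra_simps)
  have dist: "(norm (X m - X n))\<^sup>2 \<le> 2 / real (Suc m) + 2 / real (Suc n)" for m n
    using para[of "X m" "X n"] X[of m] X[of n] d_le[of "(1/2) *\<^sub>R (X m + X n)"] by linarith
  have "Cauchy X"
  proof (rule metric_CauchyI)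
    fix e :: real assume "e > 0"
    then obtain N where N: "inverse (real (Suc N)) < e\<^sup>2 / 4"
      using reals_Archimedean[of "e\<^sup>2 / 4"] by auto
    have "dist (X m) (X n) < e" if "m \<ge> N" "n \<ge> N" for m n
    proof -
      have "1 / real (Suc m) \<le> inverse (real (Suc N))" "1 / real (Suc n) \<le> inverse (real (Suc N))"
        using that by (auto simp: field_simps)
      then have "(norm (X m - X n))\<^sup>2 < e\<^sup>2"
        using dist[of m n] N by auto
      then show ?thesis using \<open>e > 0\<close> by (simp add: dist_norm power_less_imp_less_base)
    qed
    then show "\<exists>M. \<forall>m\<ge>M. \<forall>n\<ge>M. dist (X m) (X n) < e" by blast
  qed
  then obtain y where y: "X \<longlonglongrightarrow> y" using Cauchy_convergent_iff convergent_def by blast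
  have "(\<lambda>n. \<phi> (X n)) \<longlonglongrightarrow> \<phi> y"
    unfolding \<phi>_def by (intro tendsto_intros y f.tendsto)
  moreover have "(\<lambda>n. d + 1 / real (Suc n)) \<longlonglongrightarrow> d + 0"
    by (intro tendsto_intros) (use LIMSEQ_inverse_real_of_nat in \<open>simp add: inverse_eq_divide\<close>)
  ultimately have "\<phi> y \<le> d"
    using less_imp_le[OF X] by (intro LIMSEQ_le[where y = d]) auto
  have "f x = inner x y" for x
  proof -
    define c where "c = inner x y - f x"
    have *: "0 \<le> 2 * t * c + t\<^sup>2 * (norm x)\<^sup>2" for t
    proof -
      have "\<phi> y \<le> \<phi> (y + t *\<^sub>R x)" using d_le \<open>\<phi> y \<le> d\<close> order_trans by blast
      moreover have "(norm (y + t *\<^sub>R x))\<^sup>2 = (norm y)\<^sup>2 + 2 * t * inner x y + t\<^sup>2 * (norm x)\<^sup>2"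
        unfolding power2_norm_eq_inner
        by (simp add: inner_simps inner_commute algebra_simps power2_eq_square)
      ultimately show ?thesis
        by (simp add: \<phi>_def c_def f.scaleR f.add algebra_simps)
    qed
    have "c = 0"
    proof (cases "x = 0")
      case True then show ?thesis by (simp add: c_def f.zero)
    next
      case False
      define s where "s = (norm x)\<^sup>2"
      have "0 < s" using False by (simp add: s_def)
      \<comment> \<open>t = -c/s minimises the quadratic, and its value there is negative unless c =
        0.\<close>
      then have "2 * (- c / s) * c + (- c / s)\<^sup>2 * s = - (c\<^sup>2 / s)"
        by (simp add: power2_eq_square)
      then have "c\<^sup>2 / s \<le> 0" using *[of "- c / s"] by (simp flip: s_def)
      then show ?thesis using \<open>0 < s\<close> by (simp add: divide_le_0_iff)
    qed
    then show ?thesis by (simp add: c_def)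
  qed
  then show ?thesis by (rule that)
qed

text \<open>\<open>adj\<close> is a definite description, so its characteristic equation has to be
  earned: existence comes from Riesz representation, uniqueness from testing against all
  vectors.\<close>

lemma adj_works:
  fixes T :: "'a::{real_inner, complete_space} \<Rightarrow> 'a"
  assumes "bounded_linear T"
  shows "inner (T x) y = inner x (adj T y)"
proof -
  interpret bounded_linear T by fact
  have "\<exists>s. \<forall>x. inner (T x) y = inner x s" for y
  proof -
    have "bounded_linear (\<lambda>x. inner (T x) y)"
      by (rule bounded_linear_compose[OF bounded_linear_inner_left assms])
    then obtain s where "\<And>x. inner (T x) y = inner x s" by (rule Riesz_representation) blast
    then show ?thesis by blast
  qed
  then obtain S where S: "\<And>x y. inner (T x) y = inner x (S y)" by metis
  have "\<forall>x y. inner (T x) y = inner x (adj T y)"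
    unfolding adj_def
  proof (rule theI[where a = S])
    show "\<forall>x y. inner (T x) y = inner x (S y)" using S by blast
    fix S' assume "\<forall>x y. inner (T x) y = inner x (S' y)"
    then have "inner x (S' y) = inner x (S y)" for x y using S by metis
    then have "S' y = S y" for y using vector_eq_ldot[of "S' y" "S y"] by simp
    then show "S' = S" by blast
  qed
  then show ?thesis by blast
qed

text \<open>No complex structure here: \<open>adj\<close>, \<open>A_op\<close> and
  \<open>op_le\<close> refer to the real inner product alone. Complex scalars enter only with
  polynomials of T.\<close>

locale contractive =
  fixes T :: "'a::{real_inner, complete_space} \<Rightarrow> 'a"
  assumes bounded_linear: "bounded_linear T"
    and norm_le: "norm (T x) \<le> norm x"
begin

lemma adj_right: "inner x (adj T y) = inner (T x) y"
  and adj_left: "inner (adj T y) x = inner y (T x)"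
  using adj_works[OF bounded_linear] by (simp_all add: inner_commute)

lemma adj_linear: "linear (adj T)"
  by (rule linearI; rule vector_eq_ldot[THEN iffD1])
    (simp_all add: adj_right inner_simps)

lemma norm_adj_le: "norm (adj T x) \<le> norm x"
proof -
  have "(norm (adj T x))\<^sup>2 = inner (T (adj T x)) x"
    by (simp add: power2_norm_eq_inner adj_right)
  also have "\<dots> \<le> norm (adj T x) * norm x"
    by (meson norm_cauchy_schwarz norm_le order_trans mult_right_mono norm_ge_zero)
  finally show ?thesis
    by (cases "norm (adj T x) = 0") (auto simp: power2_eq_square)
qed

lemma adj_bounded_linear: "bounded_linear (adj T)"
  by (intro linear_linear[THEN iffD2] bounded_linear_intro[where K = 1])
    (use adj_linear norm_adj_le in \<open>auto simp: linear_add linear_scale\<close>)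

lemma adj_contractive: "contractive (adj T)"
  by (intro contractive.intro adj_bounded_linear norm_adj_le)

lemma adj_adj: "adj (adj T) = T"
  by (rule ext, rule vector_eq_ldot[THEN iffD1]) (simp add: contractive.adj_right[OF adj_contractive] adj_left)

text \<open>Expanding the square of the norm of \<open>adj T (T x) - x\<close> and using that
  \<open>adj T\<close> is a contraction leaves at most |x|^2 - |T x|^2 = 0.\<close>

lemma adj_T_if_isometric: "adj T (T x) = x" if "norm (T x) = norm x"
proof -
  have "(norm (adj T (T x) - x))\<^sup>2 = (norm (adj T (T x)))\<^sup>2 - 2 * (norm (T x))\<^sup>2 + (norm x)\<^sup>2"
    using adj_left[of "T x" x] by (simp add: power2_norm_eq_inner inner_simps inner_commute)
  moreover have "(norm (adj T (T x)))\<^sup>2 \<le> (norm (T x))\<^sup>2"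
    by (simp add: norm_adj_le power_mono)
  ultimately have "(norm (adj T (T x) - x))\<^sup>2 \<le> 0" using that by simp
  then show ?thesis by simp
qed

lemma power_linear: "linear (T ^^ n)"
  by (induction n)
    (auto simp: linear_iff bounded_linear.linear[OF bounded_linear, unfolded linear_iff])

lemma norm_power_le: "norm ((T ^^ n) x) \<le> norm x"
  by (induction n) (auto intro: order_trans[OF norm_le])

lemma norm_power_antimono: "m \<le> n \<Longrightarrow> norm ((T ^^ n) x) \<le> norm ((T ^^ m) x)"
  by (induction rule: dec_induct) (auto intro: order_trans[OF norm_le])

lemma adj_power: "inner ((adj T ^^ n) y) x = inner y ((T ^^ n) x)"
proof (induction n arbitrary: x)
  case (Suc n)
  then show ?case by (simp add: adj_left funpow_swap1[of T])
qed simp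

text \<open>Strong convergence of a decreasing sequence of positive contractions; only this gives
  the \<open>lim\<close> in \<open>A_op\<close> its meaning.\<close>

lemma A_op_limit: "(\<lambda>n. (adj T ^^ n) ((T ^^ n) x)) \<longlonglongrightarrow> A_op T x"
proof -
  define B where "B n x = (adj T ^^ n) ((T ^^ n) x)" for n x
  have B: "inner (B n x) y = inner ((T ^^ n) x) ((T ^^ n) y)" for n x y
    by (simp add: B_def adj_power)
  define q where "q n = (norm ((T ^^ n) x))\<^sup>2" for n
  have step: "(norm (B m x - B n x))\<^sup>2 \<le> q m - q n" if "m \<le> n" for m n
  proof -
    \<comment> \<open>The difference H of two members satisfies 0 \<le> H \<le> I. Evaluating its
      form at x - H x gives |H x|^2 \<le> <H x, x>, which is q m - q n.\<close>
    define w where "w = B m x - B n x"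
    define h where "h y z = inner (B m y) z - inner (B n y) z" for y z
    have h_nonneg: "0 \<le> h y y" for y
      using norm_power_antimono[OF that, of y]
      by (simp add: h_def B flip: power2_norm_eq_inner)
    have "h w w \<le> (norm w)\<^sup>2"
      using norm_power_le[of m w] zero_le_power2[of "norm ((T ^^ n) w)"]
      by (smt (verit) B h_def norm_ge_zero power2_norm_eq_inner power_mono)
    moreover have "h (x - w) (x - w) = h x x - 2 * h x w + h w w"
      unfolding h_def B linear_diff[OF power_linear] by (simp add: inner_simps inner_commute)
    moreover have "h x w = (norm w)\<^sup>2"
      by (simp add: h_def w_def power2_norm_eq_inner inner_simps inner_commute)
    moreover have "h x x = q m - q n"
      by (simp add: h_def B q_def power2_norm_eq_inner)
    ultimately show ?thesis using h_nonneg[of "x - w"] by (simp add: w_def)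
  qed
  have "decseq q"
    by (auto simp: decseq_def q_def norm_power_antimono power_mono)
  then have "convergent q"
    using decseq_convergent[of q 0] by (auto simp: q_def convergent_def)
  then have "Cauchy q" by (rule convergent_Cauchy)
  have "Cauchy (\<lambda>n. B n x)"
  proof (rule metric_CauchyI)
    fix e :: real assume "e > 0"
    then obtain N where N: "\<And>m n. m \<ge> N \<Longrightarrow> n \<ge> N \<Longrightarrow> dist (q m) (q n) < e\<^sup>2"
      using \<open>Cauchy q\<close> by (metis metric_CauchyD zero_less_power)
    have *: "dist (B m x) (B n x) < e" if "m \<ge> N" "n \<ge> N" "m \<le> n" for m n
    proof -
      have "(norm (B m x - B n x))\<^sup>2 < e\<^sup>2"
        using step[OF that(3)] N[OF that(1,2)] by (auto simp: dist_real_def)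
      then show ?thesis using \<open>e > 0\<close> by (simp add: dist_norm power_less_imp_less_base)
    qed
    then show "\<exists>M. \<forall>m\<ge>M. \<forall>n\<ge>M. dist (B m x) (B n x) < e"
      by (metis dist_commute nle_le)
  qed
  then show ?thesis
    by (simp add: A_op_def B_def Cauchy_convergent_iff convergent_LIMSEQ_iff)
qed

lemma inner_A_limit: "(\<lambda>n. inner ((T ^^ n) x) ((T ^^ n) y)) \<longlonglongrightarrow> inner (A_op T x) y"
  using tendsto_inner[OF A_op_limit[of x] tendsto_const[of y]] by (simp add: adj_power)

lemma A_form_limit: "(\<lambda>n. (norm ((T ^^ n) x))\<^sup>2) \<longlonglongrightarrow> inner (A_op T x) x"
  using inner_A_limit[of x x] by (simp add: power2_norm_eq_inner)

lemma A_form_le_power: "inner (A_op T x) x \<le> (norm ((T ^^ n) x))\<^sup>2"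
  by (rule LIMSEQ_le_const2[OF A_form_limit])
    (use norm_power_antimono in \<open>auto intro!: exI[of _ n] power_mono\<close>)

lemma A_form_le: "inner (A_op T x) x \<le> (norm x)\<^sup>2"
  using A_form_le_power[of x 0] by simp

lemma A_form_nonneg: "0 \<le> inner (A_op T x) x"
  by (rule LIMSEQ_le_const[OF A_form_limit]) auto

lemma A_sym: "inner (A_op T x) y = inner x (A_op T y)"
  using LIMSEQ_unique[OF inner_A_limit[of x y]] inner_A_limit[of y x] by (simp add: inner_commute)

lemma A_linear: "linear (A_op T)"
  by (rule linearI; rule vector_eq_rdot[THEN iffD1])
    (simp_all add: A_sym inner_simps)

lemma A_bounded_linear: "bounded_linear (A_op T)"
proof (rule bounded_linear_intro[where K = 1])
  fix x
  have "norm ((adj T ^^ n) ((T ^^ n) x)) \<le> norm x" for n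
    by (meson contractive.norm_power_le[OF adj_contractive] norm_power_le order_trans)
  then have "norm (A_op T x) \<le> norm x"
    by (intro LIMSEQ_le_const2[OF tendsto_norm[OF A_op_limit]]) auto
  then show "norm (A_op T x) \<le> norm x * 1" by simp
qed (use A_linear in \<open>auto simp: linear_add linear_scale\<close>)

lemma A_isometric: "inner (A_op T (T x)) (T y) = inner (A_op T x) y"
  using LIMSEQ_unique[OF LIMSEQ_Suc[OF inner_A_limit[of x y]]] inner_A_limit[of "T x" "T y"]
  by (simp add: funpow_swap1)

lemma A_commute: "A_op T (J x) = J (A_op T x)"
  if "cplx_structure J" and "\<And>x. T (J x) = J (T x)" for J
proof (rule vector_eq_rdot[THEN iffD1], intro allI)
  fix y
  have skew: "inner (J u) v = - inner u (J v)" for u v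
  proof -
    have "inner (J (J u)) (J v) = inner (J u) v" "J (J u) = - u"
      using that(1) unfolding cplx_structure_def by blast+
    then show ?thesis by simp
  qed
  have "(T ^^ n) (J x) = J ((T ^^ n) x)" for n x
    by (induction n) (auto simp: that(2))
  then have "(\<lambda>n. - inner ((T ^^ n) x) ((T ^^ n) (J y))) \<longlonglongrightarrow> inner (A_op T (J x)) y"
    using inner_A_limit[of "J x" y] by (simp add: skew)
  from LIMSEQ_unique[OF this tendsto_minus[OF inner_A_limit[of x "J y"]]]
  show "inner (A_op T (J x)) y = inner (J (A_op T x)) y" by (simp add: skew)
qed

end

section \<open>Comparison of asymptotic limits through their quadratic forms\<close>

lemma symmetric_form_eqI:
  fixes A B :: "'a::real_inner \<Rightarrow> 'a"
  assumes "linear A" "linear B"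
    and "\<And>x y. inner (A x) y = inner x (A y)" "\<And>x y. inner (B x) y = inner x (B y)"
    and "\<And>x. inner (A x) x = inner (B x) x"
  shows "A = B"
proof (rule ext, rule vector_eq_rdot[THEN iffD1], intro allI)
  fix x y
  \<comment> \<open>Polarisation. Over the real inner product a form determines only the symmetric
    part of an operator: the form of a skew operator vanishes.\<close>
  have "inner (C (x + y)) (x + y) = inner (C x) x + 2 * inner (C x) y + inner (C y) y"
    if C: "linear C" "\<And>x y. inner (C x) y = inner x (C y)" for C :: "'a \<Rightarrow> 'a"
  proof -
    have "inner (C y) x = inner (C x) y" by (metis C(2) inner_commute)
    then show ?thesis by (simp add: linear_add[OF C(1)] inner_add_left inner_add_right)
  qed
  from this[of A] this[of B] show "inner (A x) y = inner (B x) y"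
    using assms by simp
qed

lemma A_op_eqI:
  assumes "contractive S" "contractive T"
    and "\<And>x. inner (A_op S x) x = inner (A_op T x) x"
  shows "A_op S = A_op T"
  by (intro symmetric_form_eqI contractive.A_linear contractive.A_sym assms)

lemma contractive_comp: "contractive (S \<circ> T)" if "contractive S" "contractive T"
proof -
  interpret S: contractive S by fact
  interpret T: contractive T by fact
  show ?thesis
    unfolding o_def
    by (intro contractive.intro bounded_linear_compose[OF S.bounded_linear T.bounded_linear]
        order_trans[OF S.norm_le T.norm_le])
qed

text \<open>Commutativity splits the n-th power of \<open>S \<circ> T\<close> into
  \<open>T ^^ n\<close> followed by \<open>S ^^ n\<close>, and the outer factor only shrinks
  norms.\<close>

lemma A_op_comp_le:
  assumes "contractive S" "contractive T" "S \<circ> T = T \<circ> S"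
  shows "op_le (A_op (S \<circ> T)) (A_op T)"
proof -
  interpret S: contractive S by fact
  interpret T: contractive T by fact
  interpret ST: contractive "S \<circ> T" by (rule contractive_comp[OF assms(1,2)])
  have swap: "S (T x) = T (S x)" for x using fun_cong[OF assms(3), of x] by simp
  have comm: "T ((S ^^ n) x) = (S ^^ n) (T x)" for n x
    by (induction n) (simp_all flip: swap)
  have pow: "((S \<circ> T) ^^ n) x = (S ^^ n) ((T ^^ n) x)" for n x
    by (induction n) (simp_all add: comm)
  show ?thesis
    unfolding op_le_def
    by (intro allI LIMSEQ_le[OF ST.A_form_limit T.A_form_limit] exI[of _ 0])
      (simp add: pow S.norm_power_le power_mono)
qed

text \<open>Iterating the invariance, and using that the form of \<open>A_op S\<close> is below the
  squared norm, bounds it by |T^n x|^2 for every n. It serves (iii), where the second operator is a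
  product, and (ii), where it is u(T).\<close>

lemma A_op_le_if_isometric:
  assumes "contractive S" "contractive T"
    and "\<And>x. inner (A_op S (T x)) (T x) = inner (A_op S x) x"
  shows "op_le (A_op S) (A_op T)"
proof -
  interpret S: contractive S by fact
  interpret T: contractive T by fact
  have "inner (A_op S ((T ^^ n) x)) ((T ^^ n) x) = inner (A_op S x) x" for n x
    by (induction n) (simp_all add: assms(3))
  then have "inner (A_op S x) x \<le> (norm ((T ^^ n) x))\<^sup>2" for n x
    by (metis S.A_form_le)
  then show ?thesis
    unfolding op_le_def by (intro allI LIMSEQ_le_const[OF T.A_form_limit]) auto
qed

section \<open>Polynomials of a contraction\<close>

locale complex_structure =
  fixes J :: "'a::{real_inner, complete_space} \<Rightarrow> 'a"
  assumes cplx: "cplx_structure J"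
begin

lemma J_linear: "linear J" and J_J [simp]: "J (J x) = - x" and J_inner: "inner (J x) (J y) = inner x y"
  using cplx by (auto simp: cplx_structure_def)

lemma J_add: "J (x + y) = J x + J y" and J_scaleR: "J (r *\<^sub>R x) = r *\<^sub>R J x"
  and J_0 [simp]: "J 0 = 0"
  using J_linear by (auto simp: linear_add linear_scale linear_0)

lemma J_skew: "inner (J x) y = - inner x (J y)"
  using J_inner[of "J x" y] by simp

lemma inner_J_self [simp]: "inner x (J x) = 0"
  using J_skew[of x x] by (simp add: inner_commute)

abbreviation sc :: "complex \<Rightarrow> 'a \<Rightarrow> 'a" where "sc \<equiv> scaleJ J"

lemma sc_add_left: "sc (c + d) x = sc c x + sc d x"
  and sc_add_right: "sc c (x + y) = sc c x + sc c y"
  and sc_scaleR: "sc c (r *\<^sub>R x) = r *\<^sub>R sc c x"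
  and sc_0_left [simp]: "sc 0 x = 0" and sc_1 [simp]: "sc 1 x = x"
  and sc_0_right [simp]: "sc c 0 = 0"
  and sc_J: "sc c (J x) = J (sc c x)"
  and sc_sc [simp]: "sc c (sc d x) = sc (c * d) x"
  by (simp_all add: scaleJ_def algebra_simps J_add J_scaleR scaleR_conv_of_real[symmetric])

lemma norm_sc: "norm (sc c x) = cmod c * norm x"
proof -
  have "(norm (sc c x))\<^sup>2 = (Re c)\<^sup>2 * (norm x)\<^sup>2 + (Im c)\<^sup>2 * (norm x)\<^sup>2"
    unfolding power2_norm_eq_inner scaleJ_def
    by (simp add: inner_add_left inner_add_right J_inner inner_commute power2_eq_square)
  also have "\<dots> = (cmod c * norm x)\<^sup>2"
    by (simp add: power_mult_distrib cmod_power2 algebra_simps)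
  finally show ?thesis by (simp add: power2_eq_iff_nonneg)
qed

lemma sc_bounded_linear: "bounded_linear (sc c)"
  by (rule bounded_linear_intro[where K = "cmod c"])
    (auto simp: sc_add_right sc_scaleR norm_sc mult.commute)

text \<open>The complex inner product, linear in the first argument.\<close>

definition hip :: "'a \<Rightarrow> 'a \<Rightarrow> complex" where
  "hip x y = Complex (inner x y) (inner x (J y))"

lemma hip_add: "hip (x + y) z = hip x z + hip y z"
  and hip_sc: "hip (sc c x) z = c * hip x z"
  and hip_0 [simp]: "hip 0 z = 0"
  and Re_hip [simp]: "Re (hip x y) = inner x y"
  by (simp_all add: hip_def complex_eq_iff scaleJ_def inner_simps J_skew)

lemma hip_self: "hip x x = of_real ((norm x)\<^sup>2)"
  by (simp add: hip_def complex_eq_iff power2_norm_eq_inner)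

lemma tendsto_hip: "(f \<longlongrightarrow> a) F \<Longrightarrow> ((\<lambda>n. hip (f n) y) \<longlongrightarrow> hip a y) F"
  by (auto simp: hip_def tendsto_complex_iff intro!: tendsto_intros)

end

locale operator = complex_structure J + contractive T
  for J :: "'a::{real_inner, complete_space} \<Rightarrow> 'a" and T +
  assumes T_J: "T (J x) = J (T x)"
begin

lemma T_add: "T (x + y) = T x + T y"
  and T_scaleR: "T (r *\<^sub>R x) = r *\<^sub>R T x"
  and T_0 [simp]: "T 0 = 0"
  using bounded_linear.linear[OF bounded_linear]
  by (auto simp: linear_add linear_scale linear_0 linear_diff)

lemma T_sc: "T (sc c x) = sc c (T x)"
  by (simp add: scaleJ_def T_add T_scaleR T_J)

lemma power_sc: "(T ^^ n) (sc c x) = sc c ((T ^^ n) x)"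
  by (induction n) (simp_all add: T_sc)

lemma adj_J: "adj T (J x) = J (adj T x)"
proof (rule vector_eq_ldot[THEN iffD1], intro allI)
  fix y
  have "inner y (J (adj T x)) = - inner (J y) (adj T x)" by (simp add: J_skew)
  then show "inner y (adj T (J x)) = inner y (J (adj T x))"
    by (simp add: adj_right T_J J_skew)
qed

lemma operator_adj: "operator J (adj T)"
  by (intro operator.intro complex_structure_axioms adj_contractive operator_axioms.intro adj_J)

definition pev :: "complex poly \<Rightarrow> 'a \<Rightarrow> 'a" where
  "pev p x = (\<Sum>i\<le>degree p. sc (coeff p i) ((T ^^ i) x))"

lemma pev_eq_sum: "pev p x = (\<Sum>i\<le>n. sc (coeff p i) ((T ^^ i) x))" if "degree p \<le> n"
  unfolding pev_def using that
  by (intro sum.mono_neutral_left) (auto simp: coeff_eq_0)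

lemma pev_0 [simp]: "pev 0 x = 0"
  by (simp add: pev_def)

lemma T_sum: "T (sum f A) = (\<Sum>i\<in>A. T (f i))"
  using bounded_linear.linear[OF bounded_linear] by (rule linear_sum)

lemma pev_pCons [simp]: "pev (pCons a p) x = sc a x + T (pev p x)"
proof -
  have "pev (pCons a p) x = (\<Sum>i\<le>Suc (degree p). sc (coeff (pCons a p) i) ((T ^^ i) x))"
    by (rule pev_eq_sum) (simp add: degree_pCons_le)
  also have "\<dots> = sc a x + (\<Sum>i\<le>degree p. sc (coeff p i) ((T ^^ Suc i) x))"
    by (subst sum.atMost_Suc_shift) simp
  also have "(\<Sum>i\<le>degree p. sc (coeff p i) ((T ^^ Suc i) x)) = T (pev p x)"
    by (simp add: pev_def T_sum T_sc)
  finally show ?thesis .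
qed

lemma pev_1 [simp]: "pev 1 x = x"
  by (simp add: one_pCons)

lemma pev_add: "pev (p + q) x = pev p x + pev q x"
  by (induction p q rule: poly_induct2) (simp_all add: sc_add_left T_add)

lemma pev_smult: "pev (smult c p) x = sc c (pev p x)"
  by (induction p) (simp_all add: sc_add_right T_sc)

lemma pev_diff: "pev (p - q) x = pev p x - pev q x"
  using pev_add[of "p - q" q x] by (simp add: algebra_simps)

lemma T_pev: "T (pev p x) = pev p (T x)"
  by (induction p) (simp_all add: T_sc T_add)

lemma pev_mult: "pev (p * q) x = pev p (pev q x)"
  by (induction p) (simp_all add: pev_add pev_smult)

lemma pev_add_right: "pev p (x + y) = pev p x + pev p y"
  by (induction p) (simp_all add: sc_add_right T_add)

lemma pev_scaleR: "pev p (r *\<^sub>R x) = r *\<^sub>R pev p x"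
  by (induction p) (simp_all add: sc_scaleR T_scaleR scaleR_add_right)

lemma pev_diff_right: "pev p (x - y) = pev p x - pev p y"
  using pev_add_right[of p "x - y" y] by (simp add: algebra_simps)

lemma pev_J: "pev p (J x) = J (pev p x)"
  by (induction p) (simp_all add: sc_J T_J J_add)

lemma pev_monom: "pev (monom 1 k) x = (T ^^ k) x"
  by (induction k) (simp_all add: monom_Suc monom_0)

end

text \<open>The adjoint of p(T) is again a polynomial of a contraction, with the same bound on the
  disc, so estimates for p(T) transfer to adjoints.\<close>

lemma (in operator) pev_adj:
  "inner (pev p x) y = inner x (operator.pev J (adj T) (map_poly cnj p) y)"
proof -
  interpret S: operator J "adj T" by (rule operator_adj)
  have sc_adj: "inner (sc c u) v = inner u (sc (cnj c) v)" for c u v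
    by (simp add: scaleJ_def inner_simps J_skew)
  show ?thesis
  proof (induction p arbitrary: y)
    case 0
    then show ?case by simp
  next
    case (pCons a p)
    have "inner (pev (pCons a p) x) y = inner (sc a x) y + inner (pev p x) (adj T y)"
      by (simp add: inner_add_left adj_right)
    also have "\<dots> = inner x (sc (cnj a) y) + inner x (S.pev (map_poly cnj p) (adj T y))"
      by (simp only: pCons.IH sc_adj)
    also have "\<dots> = inner x (S.pev (map_poly cnj (pCons a p)) y)"
      by (simp add: map_poly_pCons inner_add_right S.T_pev)
    finally show ?case .
  qed
qed

text \<open>Two instances matter: the identity, whose form is the squared norm and can only decrease
  under T, and \<open>A_op T\<close>, whose form T preserves. One moment argument produces both
  measures.\<close>

locale invariant_form = operator J T
  for J :: "'a::{real_inner, complete_space} \<Rightarrow> 'a" and T +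
  fixes B :: "'a \<Rightarrow> 'a"
  assumes B_linear: "linear B"
    and B_sym: "inner (B x) y = inner x (B y)"
    and B_nonneg: "0 \<le> inner (B x) x"
    and B_J: "B (J x) = J (B x)"
    and B_contractive: "inner (B (T x)) (T x) \<le> inner (B x) x"
begin

lemma B_add: "B (x + y) = B x + B y" and B_scaleR: "B (r *\<^sub>R x) = r *\<^sub>R B x" and B_0 [simp]: "B 0 = 0"
  using B_linear by (auto simp: linear_add linear_scale linear_0)

lemma B_sc: "B (sc c x) = sc c (B x)"
  by (simp add: scaleJ_def B_add B_scaleR B_J)

lemma B_form_add:
  "inner (B (x + y)) (x + y) = inner (B x) x + 2 * inner (B y) x + inner (B y) y"
proof -
  have "inner (B x) y = inner (B y) x" by (metis B_sym inner_commute)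
  then show ?thesis by (simp add: B_add inner_add_left inner_add_right)
qed

lemma B_J_self: "inner (B x) (J x) = 0"
  using B_sym[of x "J x"] B_J[of x] J_skew[of x "B x"] by (simp add: inner_commute)

lemma B_form_sc: "inner (B (sc c x)) (sc c x) = (cmod c)\<^sup>2 * inner (B x) x"
proof -
  have "inner (J (B x)) x = 0" by (simp add: J_skew B_J_self)
  then show ?thesis
    unfolding B_sc unfolding scaleJ_def cmod_power2
    by (simp add: inner_add_left inner_add_right J_inner B_J_self power2_eq_square algebra_simps)
qed

text \<open>With \<open>y\<^sub>m = x + R x + \<dots> + R\<^sup>m x\<close> the summand of index \<open>m + 1\<close> is
  \<open>\<langle>B y\<^sub>m\<^sub>+\<^sub>1, y\<^sub>m\<^sub>+\<^sub>1\<rangle> - \<langle>B R y\<^sub>m, R y\<^sub>m\<rangle>\<close>, so that the sum telescopes.\<close>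

lemma Fejer_sum_nonneg:
  "0 \<le> (\<Sum>m<N. 2 * Re (\<Sum>n\<le>m. hip (B ((T ^^ n) x)) x * cis (- (real n * \<theta>)))
          - Re (hip (B x) x))"
proof -
  define \<zeta> where "\<zeta> = cis (- \<theta>)"
  define R where "R v = sc \<zeta> (T v)" for v
  define y where "y m = (\<Sum>n\<le>m. (R ^^ n) x)" for m
  define s where "s m = 2 * inner (B (y m)) x - inner (B x) x" for m
  have R_lin: "linear R"
    by (rule linearI) (simp_all add: R_def T_add T_scaleR sc_add_right sc_scaleR)
  have R_pow: "(R ^^ n) x = sc (\<zeta> ^ n) ((T ^^ n) x)" for n
    by (induction n) (simp_all add: R_def T_sc)
  have R_contr: "inner (B (R v)) (R v) \<le> inner (B v) v" for v
    using B_contractive[of v] by (simp add: R_def B_form_sc \<zeta>_def)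
  have y_Suc: "y (Suc m) = x + R (y m)" for m
    unfolding y_def by (subst sum.atMost_Suc_shift) (simp add: linear_sum[OF R_lin])
  have "inner (B (y m)) (y m) \<le> (\<Sum>k\<le>m. s k)" for m
  proof (induction m)
    case 0
    then show ?case by (simp add: y_def s_def)
  next
    case (Suc m)
    have "inner (B (y (Suc m))) (y (Suc m)) = s (Suc m) + inner (B (R (y m))) (R (y m))"
      unfolding y_Suc s_def B_form_add by (simp add: B_add inner_add_left)
    then show ?case using Suc R_contr[of "y m"] by simp
  qed
  then have "0 \<le> (\<Sum>k\<le>m. s k)" for m using B_nonneg order_trans by blast
  then have "0 \<le> (\<Sum>k<N. s k)" by (cases N) (simp_all add: lessThan_Suc_atMost)
  moreover have "s m = 2 * Re (\<Sum>n\<le>m. hip (B ((T ^^ n) x)) x * cis (- (real n * \<theta>)))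
      - Re (hip (B x) x)" for m
  proof -
    have "inner (B ((R ^^ n) x)) x = Re (hip (B ((T ^^ n) x)) x * cis (- (real n * \<theta>)))" for n
    proof -
      have "inner (B ((R ^^ n) x)) x = Re (hip (B ((R ^^ n) x)) x)" by simp
      also have "\<dots> = Re (hip (B ((T ^^ n) x)) x * cis (- (real n * \<theta>)))"
        by (simp add: R_pow B_sc hip_sc \<zeta>_def Complex.DeMoivre)
      finally show ?thesis .
    qed
    then have "inner (B (y m)) x = (\<Sum>n\<le>m. Re (hip (B ((T ^^ n) x)) x * cis (- (real n * \<theta>))))"
      by (simp add: y_def linear_sum[OF B_linear] inner_sum_left)
    then show ?thesis by (simp add: s_def)
  qed
  ultimately show ?thesis by simp
qed

end

section \<open>Measures on the circle\<close>

text \<open>Arc length on the circle in the angle parametrisation, of mass 2 pi, extended by zero to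
  the Borel sets of the line so that it shares its sigma-algebra with weak limits of distributions
  on the reals.\<close>

definition circ :: "real measure" where
  "circ = density lborel (\<lambda>\<theta>. ennreal (indicator {0..2 * pi} \<theta>))"

lemma sets_circ [simp, measurable_cong]: "sets circ = sets borel"
  and space_circ [simp]: "space circ = UNIV"
  by (simp_all add: circ_def)

lemma emeasure_circ: "A \<in> sets borel \<Longrightarrow> emeasure circ A = emeasure lborel ({0..2*pi} \<inter> A)"
  by (simp add: circ_def emeasure_density ennreal_indicator nn_integral_set_ennreal
      flip: indicator_inter_arith) 

lemma borel_measurable_cis [measurable]: "cis \<in> borel_measurable borel"
  by (intro borel_measurable_continuous_onI continuous_intros)

interpretation circ: finite_measure circ
  by (rule finite_measureI) (simp add: emeasure_circ)

lemma AE_circ_iff: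
  "(AE \<theta> in circ. P \<theta>) \<longleftrightarrow> (AE \<theta> in lborel. \<theta> \<in> {0..2*pi} \<longrightarrow> P \<theta>)"
  unfolding circ_def by (subst AE_density) (auto simp: indicator_def)

lemma integral_circ:
  fixes f :: "real \<Rightarrow> 'b::{banach, second_countable_topology}"
  assumes "f \<in> borel_measurable borel"
  shows "integral\<^sup>L circ f = (\<integral>\<theta>. indicator {0..2 * pi} \<theta> *\<^sub>R f \<theta> \<partial>lborel)"
  unfolding circ_def using assms by (subst integral_density) auto

lemma integral_circ_cis:
  fixes k :: int
  shows "(\<integral>\<theta>. cis (of_int k * \<theta>) \<partial>circ) = (if k = 0 then of_real (2 * pi) else 0)"
proof (cases "k = 0")
  case True
  then show ?thesis
    by (simp add: measure_def emeasure_circ scaleR_conv_of_real)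
next
  case False
  define F where "F \<theta> = cis (of_int k * \<theta>) / (\<i> * of_int k)" for \<theta>
  have "(F has_vector_derivative cis (of_int k * \<theta>)) (at \<theta> within {0..2*pi})" for \<theta>
  proof -
    have "((\<lambda>z. exp (\<i> * of_int k * z) / (\<i> * of_int k)) has_field_derivative exp (\<i> * of_int k * of_real \<theta>))
        (at (of_real \<theta>))"
      using False by (auto intro!: derivative_eq_intros)
    from has_vector_derivative_real_field[OF this] show ?thesis
      by (simp add: F_def[abs_def] cis_conv_exp mult.assoc)
  qed
  then have "(\<integral>\<theta>. indicator {0..2 * pi} \<theta> *\<^sub>R cis (of_int k * \<theta>) \<partial>lborel) = F (2 * pi) - F 0"
    by (intro integral_FTC_Icc) (auto intro!: continuous_intros)
  also have "\<dots> = 0"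
    using cis_multiple_2pi[of "of_int k"] by (simp add: F_def mult_ac)
  finally show ?thesis using False by (subst integral_circ) auto
qed

lemma integrable_circ_continuous:
  fixes f :: "real \<Rightarrow> 'b::{banach, second_countable_topology}"
  assumes "continuous_on UNIV f"
  shows "integrable circ f"
proof -
  have "compact (f ` {0..2*pi})"
    using assms by (intro compact_continuous_image continuous_on_subset[OF assms]) auto
  then obtain K where K: "\<And>y. y \<in> f ` {0..2*pi} \<Longrightarrow> norm y \<le> K"
    using bounded_iff compact_imp_bounded by metis
  show ?thesis
    by (rule circ.integrable_const_bound[where B = K])
      (use K borel_measurable_continuous_onI[OF assms] in \<open>auto simp: AE_circ_iff cong: measurable_cong_sets\<close>)
qed

text \<open>Trigonometric moment problem. \<open>pos\<close> says that the Fejer means of the formal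
  Fourier series with coefficients c are nonnegative. As densities they have mass c_0 and, for N
  \<ge> k, k-th moment (1 - k/N) c_k, so a weak limit point, supplied by Helly's selection theorem,
  has the moments c_k.\<close>

theorem Herglotz:
  fixes c :: "nat \<Rightarrow> complex"
  assumes c0: "Im (c 0) = 0"
    and pos: "\<And>N \<theta>. 0 \<le> (\<Sum>m<N. 2 * Re (\<Sum>n\<le>m. c n * cis (- (real n * \<theta>))) - Re (c 0))"
  obtains \<mu> :: "real measure" where "finite_measure \<mu>" "sets \<mu> = sets borel"
    "AE \<theta> in \<mu>. \<theta> \<in> {0..2*pi}" "\<And>n. (\<integral>\<theta>. cis (real n * \<theta>) \<partial>\<mu>) = c n"
proof -
  define \<sigma> where
    "\<sigma> N \<theta> = (\<Sum>m<N. 2 * Re (\<Sum>n\<le>m. c n * cis (- (real n * \<theta>))) - Re (c 0)) / (2 * pi * real N)" for N \<theta>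
  have \<sigma>_nonneg: "0 \<le> \<sigma> N \<theta>" for N \<theta> using pos[where N = N and \<theta> = \<theta>] by (simp add: \<sigma>_def)
  have \<sigma>_cont: "continuous_on UNIV (\<sigma> N)" for N
    unfolding \<sigma>_def by (cases "N = 0") (auto intro!: continuous_intros)
  have \<sigma>_meas [measurable]: "\<sigma> N \<in> borel_measurable borel" for N
    by (rule borel_measurable_continuous_onI[OF \<sigma>_cont])
  \<comment> \<open>Orthogonality keeps only frequency k. For k = 0 the index n = 0 contributes c 0
    and its conjugate; these agree by \<open>c0\<close>, and the subtracted term removes one of
    them.\<close>
  have D: "(\<integral>\<theta>. (\<Sum>n\<le>m. c n * cis (of_int (int k - int n) * \<theta>)
              + cnj (c n) * cis (of_int (int k + int n) * \<theta>)) - c 0 * cis (of_int (int k) * \<theta>) \<partial>circ)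
      = (if k \<le> m then of_real (2 * pi) * c k else 0)" (is "?L = _") for m k :: nat
  proof -
    have int: "integrable circ (\<lambda>\<theta>. a * cis (of_int j * \<theta>))" for a :: complex and j :: int
      by (intro integrable_circ_continuous continuous_intros)
    have "?L = (\<Sum>n\<le>m. c n * (if int k - int n = 0 then of_real (2 * pi) else 0)
        + cnj (c n) * (if int k + int n = 0 then of_real (2 * pi) else 0))
        - c 0 * (if int k = 0 then of_real (2 * pi) else 0)"
      by (simp only: Bochner_Integration.integral_sum Bochner_Integration.integral_add
          Bochner_Integration.integral_diff Bochner_Integration.integrable_sum
          Bochner_Integration.integrable_add int integral_mult_right_zero integral_circ_cis)
    also have "\<dots> = (\<Sum>n\<le>m. (if n = k then of_real (2 * pi) * c k else 0)
        + (if n = 0 then (if k = 0 then cnj (c 0) * of_real (2 * pi) else 0) else 0))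
        - c 0 * (if int k = 0 then of_real (2 * pi) else 0)"
      by (intro arg_cong2[where f = minus] sum.cong refl) (auto simp: mult.commute)
    also have "\<dots> = (if k \<le> m then of_real (2 * pi) * c k else 0)"
      using c0 by (auto simp: sum.distrib sum.delta complex_eq_iff)
    finally show ?thesis .
  qed
  have moment: "(\<integral>\<theta>. of_real (\<sigma> N \<theta>) * cis (real k * \<theta>) \<partial>circ) = of_real (real (N - k) / real N) * c k"
    if "N > 0" for N k
  proof -
    have eq: "of_real (\<sigma> N \<theta>) * cis (real k * \<theta>) = of_real (1 / (2 * pi * real N)) *
       (\<Sum>m<N. (\<Sum>n\<le>m. c n * cis (of_int (int k - int n) * \<theta>)
              + cnj (c n) * cis (of_int (int k + int n) * \<theta>)) - c 0 * cis (of_int (int k) * \<theta>))" for \<theta>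
    proof -
      have Re2: "complex_of_real (2 * Re w) = w + cnj w" for w
        by (simp add: complex_eq_iff)
      have "complex_of_real (2 * Re (\<Sum>n\<le>m. c n * cis (- (real n * \<theta>))) - Re (c 0)) * cis (real k * \<theta>)
        = (\<Sum>n\<le>m. c n * cis (of_int (int k - int n) * \<theta>)
              + cnj (c n) * cis (of_int (int k + int n) * \<theta>)) - c 0 * cis (of_int (int k) * \<theta>)" for m
      proof -
        have "c 0 = of_real (Re (c 0))" using c0 by (simp add: complex_eq_iff)
        then have "complex_of_real (2 * Re (\<Sum>n\<le>m. c n * cis (- (real n * \<theta>))) - Re (c 0)) * cis (real k * \<theta>)
          = (\<Sum>n\<le>m. (c n * cis (- (real n * \<theta>)) + cnj (c n) * cis (real n * \<theta>)) * cis (real k * \<theta>))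
            - c 0 * cis (real k * \<theta>)"
          by (simp only: of_real_diff Re2 cnj_sum complex_cnj_mult cis_cnj minus_minus
              left_diff_distrib sum.distrib[symmetric] sum_distrib_right)
        also have "(\<lambda>n. (c n * cis (- (real n * \<theta>)) + cnj (c n) * cis (real n * \<theta>)) * cis (real k * \<theta>))
          = (\<lambda>n. c n * cis (of_int (int k - int n) * \<theta>) + cnj (c n) * cis (of_int (int k + int n) * \<theta>))"
          by (simp add: fun_eq_iff distrib_right mult.assoc cis_mult left_diff_distrib add.commute)
        finally show ?thesis by simp
      qed
      moreover have "of_real (\<sigma> N \<theta>) = of_real (1 / (2 * pi * real N)) *
          (\<Sum>m<N. complex_of_real (2 * Re (\<Sum>n\<le>m. c n * cis (- (real n * \<theta>))) - Re (c 0)))"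
        by (simp add: \<sigma>_def)
      ultimately show ?thesis by (simp only: mult.assoc sum_distrib_right)
    qed
    have int: "integrable circ (\<lambda>\<theta>. (\<Sum>n\<le>m. c n * cis (of_int (int k - int n) * \<theta>)
              + cnj (c n) * cis (of_int (int k + int n) * \<theta>)) - c 0 * cis (of_int (int k) * \<theta>))" for m
      by (intro integrable_circ_continuous continuous_intros)
    have "(\<integral>\<theta>. of_real (\<sigma> N \<theta>) * cis (real k * \<theta>) \<partial>circ)
      = of_real (1 / (2 * pi * real N)) * (\<Sum>m<N. if k \<le> m then of_real (2 * pi) * c k else 0)"
      unfolding eq
      by (simp only: integral_mult_right_zero Bochner_Integration.integral_sum[OF int] D)
    also have "(\<Sum>m<N. if k \<le> m then of_real (2 * pi) * c k else 0)
       = (\<Sum>m\<in>{k..<N}. of_real (2 * pi) * c k)"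
      by (rule sum.mono_neutral_cong_right) auto
    also have "of_real (1 / (2 * pi * real N)) * \<dots> = of_real (real (N - k) / real N) * c k"
      by (simp add: field_simps)
    finally show ?thesis .
  qed
  have lim_fac: "(\<lambda>N. of_real (real (Suc N - k) / real (Suc N)) * c k) \<longlonglongrightarrow> c k" for k
  proof -
    have "(\<lambda>N. real (Suc N - k) / real (Suc N)) \<longlonglongrightarrow> 1"
    proof (rule Lim_transform_eventually)
      show "(\<lambda>N. 1 - real k / real (Suc N)) \<longlonglongrightarrow> 1"
        using tendsto_diff[OF tendsto_const[of 1] LIMSEQ_Suc[OF lim_const_over_n[of "real k"]]] by simp
      show "\<forall>\<^sub>F N in sequentially. 1 - real k / real (Suc N) = real (Suc N - k) / real (Suc N)"
        using eventually_ge_at_top[of k] by eventually_elim (simp add: of_nat_diff field_simps)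
    qed
    from tendsto_mult[OF tendsto_of_real[OF this] tendsto_const[of "c k"]] show ?thesis by simp
  qed
  have "Re (c 0) \<ge> 0" using pos[where N = 1 and \<theta> = 0] by simp
  have total: "(\<integral>\<theta>. \<sigma> (Suc N) \<theta> \<partial>circ) = Re (c 0)" for N
  proof -
    have "of_real (\<integral>\<theta>. \<sigma> (Suc N) \<theta> \<partial>circ) = c 0"
      using moment[of "Suc N" 0] by simp
    then show ?thesis by (metis Re_complex_of_real)
  qed
  show ?thesis
  proof (cases "Re (c 0) = 0")
    case True
    have "c k = 0" for k
    proof -
      have "of_real (real (Suc N - k) / real (Suc N)) * c k = 0" for N
      proof -
        have "AE \<theta> in circ. \<sigma> (Suc N) \<theta> = 0"
          using total[of N] True \<sigma>_nonneg
          by (subst integral_nonneg_eq_0_iff_AE[symmetric])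
            (auto intro: integrable_circ_continuous \<sigma>_cont)
        then have "(\<integral>\<theta>. of_real (\<sigma> (Suc N) \<theta>) * cis (real k * \<theta>) \<partial>circ) = 0"
          by (intro integral_eq_zero_AE) auto
        then show ?thesis using moment[of "Suc N" k] by simp
      qed
      \<comment> \<open>N = k gives the nonzero factor 1 / (k + 1); for smaller N truncated
        subtraction gives 0.\<close>
      from this[of k] show ?thesis by (simp del: of_nat_Suc)
    qed
    then show ?thesis
    proof (intro that[of "null_measure borel"])
      show "AE \<theta> in null_measure borel. \<theta> \<in> {0..2*pi}"
        by (rule AE_I'[of UNIV]) (auto simp: null_sets_def)
    qed (auto intro!: finite_measureI)
  next
    case False
    define c0' where "c0' = Re (c 0)"
    have "c0' > 0" using False \<open>Re (c 0) \<ge> 0\<close> by (simp add: c0'_def)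
    \<comment> \<open>Helly's theorem concerns probability measures, hence the division by the mass,
      which the final \<open>\<mu>\<close> undoes. \<open>Suc N\<close> avoids the degenerate
      density at index 0.\<close>
    define \<nu> where "\<nu> N = density circ (\<lambda>\<theta>. ennreal (\<sigma> (Suc N) \<theta> / c0'))" for N
    have int_\<nu>: "integral\<^sup>L (\<nu> N) f = (\<integral>\<theta>. (\<sigma> (Suc N) \<theta> / c0') *\<^sub>R f \<theta> \<partial>circ)"
      if [measurable]: "f \<in> borel_measurable borel"
      for N and f :: "real \<Rightarrow> 'b::{banach, second_countable_topology}"
      unfolding \<nu>_def by (subst integral_density) (use \<sigma>_nonneg \<open>c0' > 0\<close> in auto)
    have AE_\<nu>: "AE \<theta> in \<nu> N. \<theta> \<in> {0..2*pi}" for N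
      unfolding \<nu>_def by (subst AE_density) (auto simp: AE_circ_iff)
    have em: "emeasure (\<nu> N) (space (\<nu> N)) = 1" for N
    proof -
      have "emeasure (\<nu> N) (space (\<nu> N)) = (\<integral>\<^sup>+\<theta>. ennreal (\<sigma> (Suc N) \<theta> / c0') \<partial>circ)"
        unfolding \<nu>_def by (subst emeasure_density) auto
      also have "\<dots> = ennreal (\<integral>\<theta>. \<sigma> (Suc N) \<theta> / c0' \<partial>circ)"
        by (rule nn_integral_eq_integral)
          (use \<sigma>_nonneg \<open>c0' > 0\<close> integrable_circ_continuous[OF \<sigma>_cont] in auto)
      also have "(\<integral>\<theta>. \<sigma> (Suc N) \<theta> / c0' \<partial>circ) = 1"
        using total[of N] \<open>c0' > 0\<close> by (simp add: c0'_def)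
      finally show ?thesis by simp
    qed
    have rd: "real_distribution (\<nu> N)" for N
      by (intro real_distribution.intro real_distribution_axioms.intro prob_spaceI em) (simp add: \<nu>_def)
    have "tight \<nu>"
      unfolding tight_def
    proof (intro conjI allI impI rd)
      fix \<epsilon> :: real assume "\<epsilon> > 0"
      \<comment> \<open>Tightness is phrased with intervals open on the left; -1 keeps the endpoint
        0 inside.\<close>
      have "measure (\<nu> n) {-1<..2*pi} = 1" for n
      proof -
        interpret real_distribution "\<nu> n" by (rule rd)
        show ?thesis by (subst prob_eq_1) (use AE_\<nu>[of n] in auto)
      qed
      then show "\<exists>a b. a < b \<and> (\<forall>n. 1 - \<epsilon> < measure (\<nu> n) {a<..b})"
        using \<open>\<epsilon> > 0\<close> pi_gt_zero by (intro exI[of _ "-1"] exI[of _ "2 * pi"]) (auto simp: less_trans[of "-1" 0])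
    qed
    then obtain r M where r: "strict_mono r" and M: "real_distribution M" "weak_conv_m (\<nu> \<circ> r) M"
      using tight_imp_convergent_subsubsequence[of \<nu> id] by (auto simp: strict_mono_id)
    interpret M: real_distribution M by (rule M(1))
    have conv: "(\<lambda>n. integral\<^sup>L (\<nu> (r n)) f) \<longlonglongrightarrow> integral\<^sup>L M f"
      if "\<And>x. isCont f x" "\<And>x. norm (f x) \<le> K" for f :: "real \<Rightarrow> 'b::{banach, second_countable_topology}" and K
      using weak_conv_imp_integral_bdd_continuous_conv[of "\<nu> \<circ> r" M f K] rd M that by auto
    have mom: "(\<integral>\<theta>. cis (real k * \<theta>) \<partial>M) = c k / of_real c0'" for k
    proof (rule LIMSEQ_unique)
      show "(\<lambda>n. integral\<^sup>L (\<nu> (r n)) (\<lambda>\<theta>. cis (real k * \<theta>))) \<longlonglongrightarrow> (\<integral>\<theta>. cis (real k * \<theta>) \<partial>M)"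
        by (rule conv[of "\<lambda>\<theta>. cis (real k * \<theta>)" 1])
          (auto simp: cis_conv_exp intro!: continuous_intros)
      have "integral\<^sup>L (\<nu> N) (\<lambda>\<theta>. cis (real k * \<theta>))
          = of_real (real (Suc N - k) / real (Suc N)) * c k / of_real c0'" for N
      proof -
        have "integral\<^sup>L (\<nu> N) (\<lambda>\<theta>. cis (real k * \<theta>))
          = (\<integral>\<theta>. of_real (\<sigma> (Suc N) \<theta>) * cis (real k * \<theta>) / of_real c0' \<partial>circ)"
          by (subst int_\<nu>) (auto simp: scaleR_conv_of_real)
        then show ?thesis using moment[of "Suc N" k] by simp
      qed
      moreover have "(\<lambda>n. of_real (real (Suc (r n) - k) / real (Suc (r n))) * c k / of_real c0')
          \<longlonglongrightarrow> c k / of_real c0'"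
        using LIMSEQ_subseq_LIMSEQ[OF tendsto_divide[OF lim_fac[of k] tendsto_const[of "of_real c0'"]] r]
          \<open>c0' > 0\<close> by (simp add: o_def)
      ultimately show "(\<lambda>n. integral\<^sup>L (\<nu> (r n)) (\<lambda>\<theta>. cis (real k * \<theta>))) \<longlonglongrightarrow> c k / of_real c0'"
        by simp
    qed
    have AE_M: "AE \<theta> in M. \<theta> \<in> {0..2*pi}"
    proof -
      \<comment> \<open>The distance to the interval, capped at 1: continuous, bounded and zero
        exactly on the interval, so weak convergence transfers the support.\<close>
      define g where "g \<theta> = min 1 (max 0 (max (- \<theta>) (\<theta> - 2 * pi)))" for \<theta> :: real
      have [measurable]: "g \<in> borel_measurable borel" unfolding g_def by measurable
      have g: "isCont g x" "norm (g x) \<le> 1" for x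
        unfolding g_def by (auto intro!: continuous_intros)
      have "integral\<^sup>L (\<nu> n) g = 0" for n
      proof (rule integral_eq_zero_AE)
        show "AE \<theta> in \<nu> n. g \<theta> = 0"
          using AE_\<nu>[of n] by eventually_elim (auto simp: g_def)
      qed
      then have "integral\<^sup>L M g = 0"
        using conv[of g 1, OF g] by (simp add: LIMSEQ_const_iff)
      moreover have "integrable M g"
        by (rule M.integrable_const_bound[where B = 1]) (use g in auto)
      ultimately have "AE \<theta> in M. g \<theta> = 0"
        by (subst (asm) integral_nonneg_eq_0_iff_AE) (auto simp: g_def)
      then show ?thesis by eventually_elim (auto simp: g_def min_def max_def split: if_splits)
    qed
    define \<mu> where "\<mu> = density M (\<lambda>_. ennreal c0')"
    show ?thesis
    proof (rule that[of \<mu>])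
      show "finite_measure \<mu>"
        by (rule finite_measureI) (simp add: \<mu>_def emeasure_density M.emeasure_space_1 ennreal_mult_eq_top_iff)
      show "sets \<mu> = sets borel" by (simp add: \<mu>_def)
      show "AE \<theta> in \<mu>. \<theta> \<in> {0..2*pi}"
        unfolding \<mu>_def by (subst AE_density) (use AE_M in auto)
      show "(\<integral>\<theta>. cis (real n * \<theta>) \<partial>\<mu>) = c n" for n
        unfolding \<mu>_def using \<open>c0' > 0\<close> mom[of n]
        by (subst integral_density) (auto simp: scaleR_conv_of_real)
    qed
  qed
qed

lemma cmod_poly_circle_le:
  assumes "cmod z \<le> 1"
  shows "cmod (poly p z) \<le> (\<Sum>i\<le>degree p. cmod (coeff p i))"
proof -
  have "cmod (coeff p i * z ^ i) \<le> cmod (coeff p i)" for i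
    using assms by (simp add: norm_mult norm_power mult_left_le power_le_one)
  then show ?thesis
    unfolding poly_altdef by (intro order_trans[OF norm_sum] sum_mono)
qed

lemma continuous_on_poly_cis: "continuous_on A (\<lambda>\<theta>. poly p (cis \<theta>))"
  by (intro continuous_intros)

lemma borel_measurable_poly_cis [measurable]: "(\<lambda>\<theta>. poly p (cis \<theta>)) \<in> borel_measurable borel"
  by (intro borel_measurable_continuous_onI continuous_on_poly_cis)

lemma integrable_poly_cis:
  assumes "finite_measure \<mu>" "sets \<mu> = sets borel"
  shows "integrable \<mu> (\<lambda>\<theta>. cis (real k * \<theta>) * poly p (cis \<theta>))"
    and "integrable \<mu> (\<lambda>\<theta>. poly p (cis \<theta>))"
    and "integrable \<mu> (\<lambda>\<theta>. (cmod (poly p (cis \<theta>)))\<^sup>2)"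
proof -
  interpret finite_measure \<mu> by fact
  note [measurable_cong] = assms(2)
  let ?K = "\<Sum>i\<le>degree p. cmod (coeff p i)"
  show "integrable \<mu> (\<lambda>\<theta>. cis (real k * \<theta>) * poly p (cis \<theta>))"
    and "integrable \<mu> (\<lambda>\<theta>. poly p (cis \<theta>))"
    by (rule integrable_const_bound[where B = ?K]; simp add: norm_mult cmod_poly_circle_le)+
  show "integrable \<mu> (\<lambda>\<theta>. (cmod (poly p (cis \<theta>)))\<^sup>2)"
    by (rule integrable_const_bound[where B = "?K\<^sup>2"]; simp add: cmod_poly_circle_le power_mono)
qed

section \<open>Scalar measures attached to a vector and an invariant form\<close>

context invariant_form
begin

text \<open>Peel off the constant coefficient of p. In the form at a x + T p(T) x and in the
  integral of |a + z p|^2 the constant and mixed terms agree by the moments, so the gap between the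
  two sides grows by the defect <B v, v> - <B T v, T v> at v = p(T) x. The defect is nonnegative and
  vanishes in the isometric case.\<close>

lemma spectral_measure:
  obtains \<mu> :: "real measure" where "finite_measure \<mu>" "sets \<mu> = sets borel"
    "AE \<theta> in \<mu>. \<theta> \<in> {0..2*pi}"
    "\<And>p. (\<integral>\<theta>. poly p (cis \<theta>) \<partial>\<mu>) = hip (B (pev p x)) x"
    "\<And>p. inner (B (pev p x)) (pev p x) \<le> (\<integral>\<theta>. (cmod (poly p (cis \<theta>)))\<^sup>2 \<partial>\<mu>)"
    "(\<And>v. inner (B (T v)) (T v) = inner (B v) v) \<Longrightarrow>
      (\<And>p. inner (B (pev p x)) (pev p x) = (\<integral>\<theta>. (cmod (poly p (cis \<theta>)))\<^sup>2 \<partial>\<mu>))"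
proof -
  have "Im (hip (B ((T ^^ 0) x)) x) = 0" by (simp add: hip_def B_J_self)
  moreover have "0 \<le> (\<Sum>m<N. 2 * Re (\<Sum>n\<le>m. hip (B ((T ^^ n) x)) x * cis (- (real n * \<theta>)))
          - Re (hip (B ((T ^^ 0) x)) x))" for N \<theta>
    using Fejer_sum_nonneg by simp
  ultimately obtain \<mu> :: "real measure" where \<mu>: "finite_measure \<mu>" "sets \<mu> = sets borel"
    "AE \<theta> in \<mu>. \<theta> \<in> {0..2*pi}" and mom: "\<And>n. (\<integral>\<theta>. cis (real n * \<theta>) \<partial>\<mu>) = hip (B ((T ^^ n) x)) x"
    by (rule Herglotz) blast
  interpret finite_measure \<mu> by fact
  note [measurable_cong] = \<mu>(2)
  note int = integrable_poly_cis[OF \<mu>(1,2)]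
  have int_cis: "integrable \<mu> (\<lambda>\<theta>. cis (real k * \<theta>))" for k
    using int(1)[of k 1] by simp
  \<comment> \<open>The factor z^k makes the induction close: passing from p to
    \<open>pCons a p\<close> multiplies by z, which is absorbed into k.\<close>
  have shifted: "(\<integral>\<theta>. cis (real k * \<theta>) * poly p (cis \<theta>) \<partial>\<mu>) = hip (B ((T ^^ k) (pev p x))) x" for k p
  proof (induction p arbitrary: k)
    case 0
    then show ?case using linear_0[OF power_linear[of k]] by simp
  next
    case (pCons a p)
    have "(\<integral>\<theta>. cis (real k * \<theta>) * poly (pCons a p) (cis \<theta>) \<partial>\<mu>)
      = (\<integral>\<theta>. a * cis (real k * \<theta>) + cis (real (Suc k) * \<theta>) * poly p (cis \<theta>) \<partial>\<mu>)"
      by (intro Bochner_Integration.integral_cong refl)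
        (simp add: algebra_simps flip: cis_mult)
    also have "\<dots> = a * hip (B ((T ^^ k) x)) x + hip (B ((T ^^ Suc k) (pev p x))) x"
      by (subst Bochner_Integration.integral_add)
        (use int(1)[of "Suc k" p] int_cis[of k] pCons.IH[of "Suc k"] mom[of k] in auto)
    also have "\<dots> = hip (B ((T ^^ k) (pev (pCons a p) x))) x"
      by (simp add: linear_add[OF power_linear] power_sc B_add B_sc hip_add hip_sc funpow_swap1)
    finally show ?case .
  qed
  have total: "measure \<mu> (space \<mu>) = inner (B x) x"
    using arg_cong[OF mom[of 0], of Re] by (simp add: hip_def)
  have expand: "(\<integral>\<theta>. (cmod (poly (pCons a p) (cis \<theta>)))\<^sup>2 \<partial>\<mu>) =
      inner (B (pev (pCons a p) x)) (pev (pCons a p) x)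
      - inner (B (T (pev p x))) (T (pev p x)) + (\<integral>\<theta>. (cmod (poly p (cis \<theta>)))\<^sup>2 \<partial>\<mu>)" for a p
  proof -
    have eq: "(cmod (poly (pCons a p) (cis \<theta>)))\<^sup>2 = (cmod a)\<^sup>2
      + 2 * Re (cnj a * (cis (real 1 * \<theta>) * poly p (cis \<theta>))) + (cmod (poly p (cis \<theta>)))\<^sup>2" for \<theta>
    proof -
      have "(cmod (a + w))\<^sup>2 = (cmod a)\<^sup>2 + 2 * Re (cnj a * w) + (cmod w)\<^sup>2" for w
        unfolding cmod_power2 by (simp add: power2_eq_square algebra_simps)
      from this[of "cis \<theta> * poly p (cis \<theta>)"] show ?thesis by (simp add: norm_mult)
    qed
    have int': "integrable \<mu> (\<lambda>\<theta>. cnj a * (cis (real 1 * \<theta>) * poly p (cis \<theta>)))"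
      by (intro integrable_mult_right int)
    have split: "(\<integral>\<theta>. k + 2 * g \<theta> + h \<theta> \<partial>\<mu>) = k * inner (B x) x + 2 * (\<integral>\<theta>. g \<theta> \<partial>\<mu>) + (\<integral>\<theta>. h \<theta> \<partial>\<mu>)"
      if "integrable \<mu> g" "integrable \<mu> h" for g h :: "real \<Rightarrow> real" and k
      using that by (simp add: total)
    have "(\<integral>\<theta>. Re (cnj a * (cis (real 1 * \<theta>) * poly p (cis \<theta>))) \<partial>\<mu>)
        = Re (cnj a * hip (B ((T ^^ 1) (pev p x))) x)"
      unfolding integral_Re[OF int'] integral_mult_right_zero shifted ..
    then have "(\<integral>\<theta>. (cmod (poly (pCons a p) (cis \<theta>)))\<^sup>2 \<partial>\<mu>) = (cmod a)\<^sup>2 * inner (B x) x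
      + 2 * Re (cnj a * hip (B ((T ^^ 1) (pev p x))) x) + (\<integral>\<theta>. (cmod (poly p (cis \<theta>)))\<^sup>2 \<partial>\<mu>)"
      unfolding eq by (simp only: split[OF integrable_Re[OF int'] int(3)])
    also have "Re (cnj a * hip (B ((T ^^ 1) (pev p x))) x) = inner (B (T (pev p x))) (sc a x)"
      by (simp add: hip_def scaleJ_def inner_simps)
    finally show ?thesis by (simp add: B_form_add B_form_sc)
  qed
  show ?thesis
  proof (rule that[OF \<mu>])
    show "(\<integral>\<theta>. poly p (cis \<theta>) \<partial>\<mu>) = hip (B (pev p x)) x" for p
      using shifted[of 0 p] by simp
    show "inner (B (pev p x)) (pev p x) \<le> (\<integral>\<theta>. (cmod (poly p (cis \<theta>)))\<^sup>2 \<partial>\<mu>)" for p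
    proof (induction p)
      case (pCons a p)
      then show ?case using B_contractive[of "pev p x"] expand[of a p] by linarith
    qed simp
    show "inner (B (pev p x)) (pev p x) = (\<integral>\<theta>. (cmod (poly p (cis \<theta>)))\<^sup>2 \<partial>\<mu>)"
      if "\<And>v. inner (B (T v)) (T v) = inner (B v) v" for p
    proof (induction p)
      case (pCons a p)
      then show ?case using that[of "pev p x"] expand[of a p] by linarith
    qed simp
  qed
qed

end

section \<open>Peak polynomials\<close>

lemma poly_approx_of_summable:
  fixes a :: "nat \<Rightarrow> complex"
  assumes "summable (\<lambda>n. cmod (a n))"
    and z: "cmod z \<le> 1"
  shows "cmod (poly (\<Sum>n<N. monom (a n) n) z - (\<Sum>n. a n * z ^ n)) \<le> (\<Sum>n. cmod (a (n + N)))"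
proof -
  have le: "cmod (a n * z ^ n) \<le> cmod (a n)" for n
    using z by (simp add: norm_mult norm_power mult_left_le power_le_one)
  have sm: "summable (\<lambda>n. cmod (a n * z ^ n))"
    by (rule summable_comparison_test'[OF assms(1)]) (use le in auto)
  have "(\<Sum>n. a n * z ^ n) = (\<Sum>n. a (n + N) * z ^ (n + N)) + (\<Sum>n<N. a n * z ^ n)"
    by (rule suminf_split_initial_segment[OF summable_norm_cancel[OF sm]])
  then have "cmod (poly (\<Sum>n<N. monom (a n) n) z - (\<Sum>n. a n * z ^ n))
      = cmod (\<Sum>n. a (n + N) * z ^ (n + N))"
    by (simp add: poly_sum poly_monom norm_minus_cancel)
  also have "\<dots> \<le> (\<Sum>n. cmod (a (n + N) * z ^ (n + N)))"
    by (rule summable_norm) (use sm in \<open>subst summable_iff_shift[of "\<lambda>n. cmod (a n * z ^ n)"]\<close>)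
  also have "\<dots> \<le> (\<Sum>n. cmod (a (n + N)))"
    by (intro suminf_le le summable_ignore_initial_segment[OF assms(1)]
        summable_ignore_initial_segment[OF sm])
  finally show ?thesis .
qed

lemma summable_Taylor:
  assumes "f holomorphic_on ball 0 R" "0 \<le> r" "r < R"
  shows "summable (\<lambda>n. cmod ((deriv ^^ n) f 0 / fact n * of_real (r ^ n)))"
proof -
  define x where "x = complex_of_real ((r + R) / 2)"
  have "cmod x = (r + R) / 2" unfolding x_def norm_of_real using assms by simp
  then have "x \<in> ball 0 R" using assms by (auto simp: dist_norm)
  then have "summable (\<lambda>n. (deriv ^^ n) f 0 / fact n * x ^ n)"
    using holomorphic_power_series[OF assms(1), of x] by (simp add: sums_iff)
  from powser_insidea[OF this, of "of_real r"] show ?thesis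
    using assms \<open>cmod x = _\<close> by simp
qed

lemma holomorphic_poly_approx:
  assumes "f holomorphic_on ball 0 R" "R > 1" "\<epsilon> > 0"
  obtains p where "\<And>z. cmod z \<le> 1 \<Longrightarrow> cmod (poly p z - f z) < \<epsilon>"
proof -
  let ?a = "\<lambda>n. (deriv ^^ n) f 0 / fact n"
  have sm: "summable (\<lambda>n. cmod (?a n))"
    using summable_Taylor[OF assms(1), of 1] assms(2) by simp
  obtain N where "(\<Sum>n. cmod (?a (n + N))) < \<epsilon>"
    using order_tendstoD(2)[OF suminf_exist_split2[OF sm] assms(3)]
    by (auto simp: eventually_sequentially)
  moreover have "(\<Sum>n. ?a n * z ^ n) = f z" if "cmod z \<le> 1" for z
    using holomorphic_power_series[OF assms(1), of z] that assms(2) by (simp add: sums_iff)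
  ultimately have "cmod (poly (\<Sum>n<N. monom (?a n) n) z - f z) < \<epsilon>" if "cmod z \<le> 1" for z
    using poly_approx_of_summable[OF sm that, of N] that by simp
  then show ?thesis by (rule that)
qed

lemma integral_circ_coeff:
  "(\<integral>\<theta>. cis (- (real k * \<theta>)) * poly p (cis \<theta>) \<partial>circ) = of_real (2 * pi) * coeff p k"
proof -
  have "cis (- (real k * \<theta>)) * poly p (cis \<theta>)
      = (\<Sum>i\<le>degree p. coeff p i * cis (of_int (int i - int k) * \<theta>))" for \<theta>
    by (simp add: poly_altdef sum_distrib_left Complex.DeMoivre mult.left_commute cis_mult
        left_diff_distrib)
  then have "(\<integral>\<theta>. cis (- (real k * \<theta>)) * poly p (cis \<theta>) \<partial>circ)
      = (\<Sum>i\<le>degree p. \<integral>\<theta>. coeff p i * cis (of_int (int i - int k) * \<theta>) \<partial>circ)"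
    by (simp only:) (intro Bochner_Integration.integral_sum integrable_circ_continuous continuous_intros)
  also have "\<dots> = (\<Sum>i\<le>degree p. if i = k then of_real (2 * pi) * coeff p k else 0)"
    by (intro sum.cong refl) (auto simp: integral_circ_cis simp del: of_int_diff of_int_of_nat_eq)
  also have "\<dots> = of_real (2 * pi) * coeff p k"
    by (simp add: coeff_eq_0)
  finally show ?thesis .
qed

section \<open>Analytic functions that are large on short arcs\<close>

lemma Re_Cayley:
  fixes w :: complex
  assumes "w \<noteq> 1"
  shows "Re ((1 + w) / (1 - w)) = (1 - (cmod w)\<^sup>2) / (cmod (1 - w))\<^sup>2"
  unfolding Re_divide cmod_power2 by (simp add: power2_eq_square algebra_simps)

lemma cmod_1_minus_cis_le: "cmod (1 - cis t) \<le> \<bar>t\<bar>"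
proof -
  have "(cmod (1 - cis t))\<^sup>2 = 2 - 2 * cos t"
    by (simp add: cmod_power2 power2_diff algebra_simps flip: add.assoc)
  also have "\<dots> = (2 * sin (t / 2))\<^sup>2"
    using cos_double_sin[of "t / 2"] by (simp add: power_mult_distrib)
  finally have "(cmod (1 - cis t))\<^sup>2 = (2 * \<bar>sin (t / 2)\<bar>)\<^sup>2"
    by (simp add: power_mult_distrib)
  then have "cmod (1 - cis t) = 2 * \<bar>sin (t / 2)\<bar>"
    by (rule power2_eq_imp_eq) auto
  then show ?thesis using abs_sin_x_le_abs_x[of "t / 2"] by simp
qed

text \<open>A multiple of the Poisson kernel at distance \<open>\<delta>\<close> from the boundary is at least 1 on an
  arc of length \<open>2 \<delta>\<close>, although its mean is only \<open>4 \<delta>\<close>.\<close>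

lemma arc_kernel:
  assumes "0 < \<delta>" "\<delta> < 1"
  obtains F R where "R > 1" "F holomorphic_on ball 0 R" "\<And>z. cmod z < R \<Longrightarrow> 0 \<le> Re (F z)"
    "F 0 = of_real (4 * \<delta>)" "\<And>\<theta>. \<bar>\<theta> - \<phi>\<bar> \<le> \<delta> \<Longrightarrow> 1 \<le> Re (F (cis \<theta>))"
proof -
  define w where "w z = of_real (1 - \<delta>) * cis (- \<phi>) * z" for z
  define F where "F z = of_real (4 * \<delta>) * ((1 + w z) / (1 - w z))" for z
  have cw: "cmod (w z) = (1 - \<delta>) * cmod z" for z
    using assms by (simp add: w_def norm_mult del: of_real_diff)
  have w_lt: "cmod (w z) < 1" if "cmod z < 1 / (1 - \<delta>)" for z
    using that assms by (simp add: cw field_simps)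
  have w_ne: "w z \<noteq> 1" if "cmod z < 1 / (1 - \<delta>)" for z
    using w_lt[OF that] by auto
  have F_Re: "Re (F z) = 4 * \<delta> * ((1 - (cmod (w z))\<^sup>2) / (cmod (1 - w z))\<^sup>2)"
    if "cmod z < 1 / (1 - \<delta>)" for z
  proof -
    have "Re (of_real r * v) = r * Re v" for r v by simp
    then show ?thesis unfolding F_def Re_Cayley[OF w_ne[OF that], symmetric] by blast
  qed
  show ?thesis
  proof (rule that[of "1 / (1 - \<delta>)" F])
    show "1 / (1 - \<delta>) > 1" using assms by simp
    show "F holomorphic_on ball 0 (1 / (1 - \<delta>))"
      unfolding F_def w_def
      by (intro holomorphic_intros) (use w_ne in \<open>auto simp: w_def\<close>)
    show "0 \<le> Re (F z)" if "cmod z < 1 / (1 - \<delta>)" for z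
      using w_lt[OF that] assms unfolding F_Re[OF that]
      by (intro mult_nonneg_nonneg divide_nonneg_nonneg) (auto simp: power_le_one)
    show "F 0 = of_real (4 * \<delta>)" by (simp add: F_def w_def)
    show "1 \<le> Re (F (cis \<theta>))" if "\<bar>\<theta> - \<phi>\<bar> \<le> \<delta>" for \<theta>
    proof -
      have *: "cmod (cis \<theta>) < 1 / (1 - \<delta>)" using assms by simp
      \<comment> \<open>On the arc w is within 2 \<delta> of 1, whereas 1 - |w|^2 is at least
        \<delta>; the factor 4 \<delta> in F then makes the quotient at least 1.\<close>
      have "1 - w (cis \<theta>) = of_real \<delta> + of_real (1 - \<delta>) * (1 - cis (\<theta> - \<phi>))"
        by (simp add: w_def cis_mult algebra_simps)
      also have "cmod \<dots> \<le> \<delta> + (1 - \<delta>) * cmod (1 - cis (\<theta> - \<phi>))"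
        using assms by (intro order_trans[OF norm_triangle_ineq]) (simp add: norm_mult del: of_real_diff)
      also have "(1 - \<delta>) * cmod (1 - cis (\<theta> - \<phi>)) \<le> 1 * \<delta>"
        using assms cmod_1_minus_cis_le[of "\<theta> - \<phi>"] that by (intro mult_mono) auto
      finally have le: "cmod (1 - w (cis \<theta>)) \<le> 2 * \<delta>" by simp
      have pos: "0 < cmod (1 - w (cis \<theta>))" using w_ne[OF *] by auto
      have "(cmod (1 - w (cis \<theta>)))\<^sup>2 \<le> (2 * \<delta>)\<^sup>2"
        using le by (intro power_mono) auto
      also have "(2 * \<delta>)\<^sup>2 \<le> 4 * \<delta> * (1 - (1 - \<delta>)\<^sup>2)"
        using assms by (simp add: power2_eq_square algebra_simps mult_le_cancel_left1)
      finally have "1 \<le> 4 * \<delta> * (1 - (1 - \<delta>)\<^sup>2) / (cmod (1 - w (cis \<theta>)))\<^sup>2"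
        using pos by (simp add: le_divide_eq)
      then show ?thesis unfolding F_Re[OF *] by (simp add: cw)
    qed
  qed
qed

text \<open>Nonnegative real parts cannot cancel, so the bound 1 on each arc survives summation,
  while the values at 0 add up. Finiteness of I keeps the common radius above 1.\<close>

lemma arcs_kernel:
  fixes \<delta> \<phi> :: "'i \<Rightarrow> real"
  assumes "finite I" "\<And>i. i \<in> I \<Longrightarrow> 0 < \<delta> i \<and> \<delta> i < 1"
  obtains F R where "R > 1" "F holomorphic_on ball 0 R" "\<And>z. cmod z < R \<Longrightarrow> 0 \<le> Re (F z)"
    "F 0 = of_real (4 * (\<Sum>i\<in>I. \<delta> i))"
    "\<And>\<theta> i. i \<in> I \<Longrightarrow> \<bar>\<theta> - \<phi> i\<bar> \<le> \<delta> i \<Longrightarrow> 1 \<le> Re (F (cis \<theta>))"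
proof -
  have "\<exists>F R. R > 1 \<and> F holomorphic_on ball 0 R \<and> (\<forall>z. cmod z < R \<longrightarrow> 0 \<le> Re (F z)) \<and>
    F 0 = of_real (4 * (\<Sum>i\<in>I. \<delta> i)) \<and>
    (\<forall>\<theta>. \<forall>i\<in>I. \<bar>\<theta> - \<phi> i\<bar> \<le> \<delta> i \<longrightarrow> 1 \<le> Re (F (cis \<theta>)))"
    using assms
  proof (induction I rule: finite_induct)
    case empty
    show ?case by (intro exI[of _ "\<lambda>_. 0"] exI[of _ 2]) auto
  next
    case (insert j I)
    obtain F R where F: "R > 1" "F holomorphic_on ball 0 R" "\<And>z. cmod z < R \<Longrightarrow> 0 \<le> Re (F z)"
      "F 0 = of_real (4 * (\<Sum>i\<in>I. \<delta> i))" "\<And>\<theta> i. i \<in> I \<Longrightarrow> \<bar>\<theta> - \<phi> i\<bar> \<le> \<delta> i \<Longrightarrow> 1 \<le> Re (F (cis \<theta>))"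
      using insert by (metis insert_iff)
    obtain G S where G: "S > 1" "G holomorphic_on ball 0 S" "\<And>z. cmod z < S \<Longrightarrow> 0 \<le> Re (G z)"
      "G 0 = of_real (4 * \<delta> j)" "\<And>\<theta>. \<bar>\<theta> - \<phi> j\<bar> \<le> \<delta> j \<Longrightarrow> 1 \<le> Re (G (cis \<theta>))"
      by (rule arc_kernel[of "\<delta> j" "\<phi> j"]) (use insert.prems[of j] in blast)+
    have "F holomorphic_on ball 0 (min R S)" "G holomorphic_on ball 0 (min R S)"
      using F(2) G(2) by (auto elim!: holomorphic_on_subset)
    moreover have "1 \<le> Re (F (cis \<theta>) + G (cis \<theta>))"
      if "i \<in> insert j I" "\<bar>\<theta> - \<phi> i\<bar> \<le> \<delta> i" for \<theta> i
    proof -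
      have "0 \<le> Re (F (cis \<theta>))" "0 \<le> Re (G (cis \<theta>))"
        using F(1,3) G(1,3) by auto
      moreover have "1 \<le> Re (F (cis \<theta>)) \<or> 1 \<le> Re (G (cis \<theta>))"
        using that F(5) G(5) by blast
      ultimately show ?thesis by auto
    qed
    moreover have "0 \<le> Re (F z + G z)" if "cmod z < min R S" for z
      using F(3)[of z] G(3)[of z] that by simp
    ultimately show ?case
      using F(1,4) G(1,4) insert.hyps
      by (intro exI[of _ "\<lambda>z. F z + G z"] exI[of _ "min R S"] conjI)
        (auto intro!: holomorphic_intros simp del: plus_complex.sel simp: distrib_left)
  qed
  then show ?thesis using that by metis
qed

text \<open>w / (1 + w) maps the right half-plane into the disc with diameter [0, 1]; membership in
  that disc is |f|^2 \<le> Re f. This bound reduces an L2 integral over the circle to the mean of Re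
  f, that is, to the value at 0. The last bound puts f near 1 where Re w is large.\<close>

lemma half_plane_to_disc:
  fixes w :: complex
  assumes "0 \<le> Re w"
  shows "(cmod (w / (1 + w)))\<^sup>2 \<le> Re (w / (1 + w))"
    and "cmod (w / (1 + w)) \<le> 1"
    and "cmod (1 - w / (1 + w)) \<le> 1 / (1 + Re w)"
proof -
  have "Re (1 + w) \<noteq> 0" using assms by simp
  then have ne: "1 + w \<noteq> 0" by force
  then have pos: "0 < (cmod (1 + w))\<^sup>2" by simp
  have "Re (w / (1 + w)) = ((cmod w)\<^sup>2 + Re w) / (cmod (1 + w))\<^sup>2"
    unfolding Re_divide cmod_power2 by (simp add: power2_eq_square algebra_simps)
  moreover have "(cmod (w / (1 + w)))\<^sup>2 = (cmod w)\<^sup>2 / (cmod (1 + w))\<^sup>2"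
    by (simp add: norm_divide power_divide)
  ultimately show *: "(cmod (w / (1 + w)))\<^sup>2 \<le> Re (w / (1 + w))"
    using pos assms by (simp add: divide_right_mono)
  have "(cmod (w / (1 + w)))\<^sup>2 \<le> cmod (w / (1 + w))"
    using * complex_Re_le_cmod[of "w / (1 + w)"] by linarith
  then show "cmod (w / (1 + w)) \<le> 1"
    by (cases "cmod (w / (1 + w)) = 0") (auto simp: power2_eq_square)
  have "1 - w / (1 + w) = 1 / (1 + w)" using ne by (simp add: field_simps)
  moreover have "1 + Re w \<le> cmod (1 + w)" using complex_Re_le_cmod[of "1 + w"] by simp
  ultimately show "cmod (1 - w / (1 + w)) \<le> 1 / (1 + Re w)"
    using assms by (simp add: norm_divide frac_le)
qed

text \<open>A Lebesgue null set has a countable cover by intervals of total length at most e. A sum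
  of kernels needs finitely many of them, and continuity of \<open>\<nu>\<close> along increasing
  sets allows the rest to be discarded at cost \<open>\<eta>\<close>.\<close>

lemma null_set_interval_cover:
  fixes \<nu> :: "real measure"
  assumes "S \<in> null_sets lborel" "S \<subseteq> {0..2*pi}" "finite_measure \<nu>" "sets \<nu> = sets borel" "0 < e" "0 < \<eta>"
  obtains \<F> l h where "finite \<F>" "\<And>K. K \<in> \<F> \<Longrightarrow> {l K..h K} = K \<and> l K < (h K :: real)"
    "(\<Sum>K\<in>\<F>. h K - l K) \<le> e" "measure \<nu> (S - \<Union>\<F>) \<le> \<eta>"
proof -
  interpret \<nu>: finite_measure \<nu> by fact
  have S_null: "S \<in> null_sets lebesgue" using assms(1) by (rule null_sets_completionI)
  then have S_meas: "S \<in> lmeasurable" "measure lebesgue S = 0"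
    by (auto simp: fmeasurable_def null_sets_def measure_def)
  obtain \<D> where \<D>: "countable \<D>"
    "\<And>K. K \<in> \<D> \<Longrightarrow> K \<subseteq> cbox 0 (2*pi) \<and> K \<noteq> {} \<and> (\<exists>c d. K = cbox c d)"
    "pairwise (\<lambda>A B. interior A \<inter> interior B = {}) \<D>"
    "\<And>K. \<lbrakk>K \<in> \<D>; box 0 (2*pi) \<noteq> {}\<rbrakk> \<Longrightarrow> interior K \<noteq> {}"
    "S \<subseteq> \<Union>\<D>" "\<Union>\<D> \<in> lmeasurable" "measure lebesgue (\<Union>\<D>) \<le> measure lebesgue S + e"
  proof (rule measurable_outer_intervals_bounded[OF S_meas(1) _ assms(5)])
    show "S \<subseteq> cbox 0 (2*pi)" using assms(2) by simp
  qed (rule that)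
  have "\<forall>K\<in>\<D>. \<exists>l h. K = {l..h} \<and> l < h"
  proof
    fix K assume K: "K \<in> \<D>"
    then obtain l h where "K = {l..h :: real}" using \<D>(2) cbox_interval by metis
    moreover have "interior K \<noteq> {}" using \<D>(4)[OF K] pi_gt_zero by (auto simp: box_real)
    ultimately have "l < h" by (simp add: interior_atLeastAtMost_real)
    then show "\<exists>l h. K = {l..h} \<and> l < h" using \<open>K = {l..h}\<close> by blast
  qed
  then have "\<forall>K\<in>\<D>. \<exists>l h. {l..h} = K \<and> l < h" by metis
  then obtain l h where lh: "\<And>K. K \<in> \<D> \<Longrightarrow> {l K..h K} = K \<and> l K < h K" by metis
  have \<D>_sets: "\<D> \<subseteq> sets borel"
  proof
    fix K assume "K \<in> \<D>"
    then show "K \<in> sets borel" using lh[of K] by (metis atLeastAtMost_borel)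
  qed
  have len: "(\<Sum>K\<in>\<F>. h K - l K) \<le> e" if "finite \<F>" "\<F> \<subseteq> \<D>" for \<F>
  proof -
    have int: "interior K = {l K<..<h K}" if "K \<in> \<F>" for K
    proof -
      have "K \<in> \<D>" using that \<open>\<F> \<subseteq> \<D>\<close> by blast
      then have "{l K..h K} = K" using lh by blast
      then have "interior K = interior {l K..h K}" by (simp only:)
      then show ?thesis by (simp only: interior_atLeastAtMost_real)
    qed
    \<comment> \<open>Only the interiors are known to be pairwise disjoint; they carry the full
      lengths.\<close>
    have "(\<Sum>K\<in>\<F>. h K - l K) = (\<Sum>K\<in>\<F>. measure lebesgue (interior K))"
      using lh that int by (intro sum.cong refl) (auto simp: less_imp_le subset_iff)
    also have "\<dots> = measure lebesgue (\<Union>K\<in>\<F>. interior K)"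
    proof (rule measure_UNION'[symmetric, OF that(1)])
      show "pairwise (\<lambda>A B. disjnt (interior A) (interior B)) \<F>"
        using \<D>(3) that(2) by (auto simp: pairwise_def disjnt_def)
    qed (simp add: int)
    also have "\<dots> \<le> measure lebesgue (\<Union>\<D>)"
    proof (rule measure_mono_fmeasurable)
      show "(\<Union>K\<in>\<F>. interior K) \<subseteq> \<Union>\<D>"
        using that interior_subset by blast
      have "open (\<Union>K\<in>\<F>. interior K)" by auto
      then show "(\<Union>K\<in>\<F>. interior K) \<in> sets lebesgue" by (simp add: borel_open)
    qed (rule \<D>(6))
    finally show ?thesis using \<D>(7) S_meas(2) by simp
  qed
  have "\<exists>\<F>. finite \<F> \<and> \<F> \<subseteq> \<D> \<and> measure \<nu> (S - \<Union>\<F>) \<le> \<eta>"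
  proof (cases "\<D> = {}")
    case True
    then show ?thesis using \<D>(5) assms(6) by (intro exI[of _ "{}"]) auto
  next
    case False
    define D where "D = from_nat_into \<D>"
    have range_D: "range D = \<D>" unfolding D_def using False \<D>(1) by (rule range_from_nat_into)
    define A where "A n = S \<inter> \<Union> (D ` {..<n})" for n :: nat
    have S_borel: "S \<in> sets borel" using assms(1) by auto
    have A_sets: "range A \<subseteq> sets \<nu>"
    proof -
      have "\<Union> (D ` {..<n}) \<in> sets borel" for n
        using range_D \<D>_sets by (intro sets.finite_UN) auto
      then show ?thesis using S_borel assms(4) by (auto simp: A_def)
    qed
    have "incseq A" by (fastforce simp: incseq_def A_def)
    have "(\<Union>n. A n) = S"
    proof
      show "S \<subseteq> (\<Union>n. A n)"
      proof
        fix x assume "x \<in> S"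
        then obtain i where "x \<in> D i" using \<D>(5) range_D by (metis UnionE imageE subsetD)
        then show "x \<in> (\<Union>n. A n)" using \<open>x \<in> S\<close> by (auto simp: A_def intro!: exI[of _ "Suc i"])
      qed
    qed (auto simp: A_def)
    then have "(\<lambda>n. measure \<nu> (A n)) \<longlonglongrightarrow> measure \<nu> S"
      using \<nu>.finite_Lim_measure_incseq[OF A_sets \<open>incseq A\<close>] by simp
    then have "\<forall>\<^sub>F n in sequentially. measure \<nu> S - \<eta> < measure \<nu> (A n)"
      using assms(6) by (intro order_tendstoD(1)) auto
    then obtain n where n: "measure \<nu> S - \<eta> < measure \<nu> (A n)"
      by (auto simp: eventually_sequentially)
    have "S - \<Union> (D ` {..<n}) = S - A n" by (auto simp: A_def)
    moreover have "measure \<nu> (S - A n) = measure \<nu> S - measure \<nu> (A n)"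
      using A_sets S_borel assms(4) by (intro \<nu>.finite_measure_Diff) (auto simp: A_def)
    ultimately have "measure \<nu> (S - \<Union> (D ` {..<n})) \<le> \<eta>" using n by simp
    then show ?thesis using range_D by (intro exI[of _ "D ` {..<n}"]) auto
  qed
  then obtain \<F> where "finite \<F>" "\<F> \<subseteq> \<D>" "measure \<nu> (S - \<Union>\<F>) \<le> \<eta>" by blast
  then show ?thesis using lh len by (intro that[of \<F> l h]) auto
qed

lemma peak_polynomial:
  fixes \<nu> :: "real measure"
  assumes N: "N \<in> null_sets circ" and \<nu>: "finite_measure \<nu>" "sets \<nu> = sets borel"
    and \<epsilon>: "0 < \<epsilon>" "\<epsilon> \<le> 1"
  obtains p where "\<And>z. cmod z \<le> 1 \<Longrightarrow> cmod (poly p z) \<le> 1"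
    "(\<integral>\<theta>. (cmod (poly p (cis \<theta>)))\<^sup>2 \<partial>circ) \<le> \<epsilon>"
    "(\<integral>\<theta>. indicator (N \<inter> {0..2*pi}) \<theta> * cmod (poly p (cis \<theta>) - 1) \<partial>\<nu>) \<le> \<epsilon>"
proof -
  interpret \<nu>: finite_measure \<nu> by fact
  note [measurable_cong] = \<nu>(2)
  define S where "S = N \<inter> {0..2*pi}"
  have N_borel: "N \<in> sets borel" using N by auto
  then have S_borel [measurable]: "S \<in> sets borel" by (simp add: S_def)
  have "S \<in> null_sets lborel"
    using N N_borel by (auto simp: null_sets_def S_def emeasure_circ Int_commute)
  \<comment> \<open>All errors are multiples of d: on the circle 6 pi d from Re p(0) \<le> 3 d and
    12 pi d from the pointwise error 6 d; for \<open>\<nu>\<close>, 3 d times its mass plus 2 d from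
    the uncovered part of S.\<close>
  define k where "k = 18 * pi + 3 * measure \<nu> (space \<nu>) + 2"
  have k: "k > 1" unfolding k_def using pi_gt_zero measure_nonneg[of \<nu> "space \<nu>"] by linarith
  define d where "d = \<epsilon> / k"
  have d: "0 < d" "d < 1" using \<epsilon> k by (auto simp: d_def)
  \<comment> \<open>Chosen so that G(0), four times the total length divided by d, is at most
    d.\<close>
  define e where "e = d\<^sup>2 / 4"
  have e: "0 < e" "e < 1" using d abs_square_less_1[of d] by (auto simp: e_def)
  obtain \<F> l h where \<F>: "finite \<F>" and lh: "\<And>K. K \<in> \<F> \<Longrightarrow> {l K..h K} = K \<and> l K < (h K :: real)"
    and len: "(\<Sum>K\<in>\<F>. h K - l K) \<le> e" and rest: "measure \<nu> (S - \<Union>\<F>) \<le> d"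
    using null_set_interval_cover[OF \<open>S \<in> null_sets lborel\<close> _ \<nu> e(1) d(1)]
    by (auto simp: S_def)
  have small: "0 < h K - l K \<and> h K - l K < 1" if "K \<in> \<F>" for K
  proof -
    have "h K - l K \<le> (\<Sum>K\<in>\<F>. h K - l K)"
      using that lh \<F> by (intro member_le_sum) (auto simp: less_imp_le)
    then show ?thesis using lh[OF that] len e by auto
  qed
  obtain F R where F: "R > 1" "F holomorphic_on ball 0 R" "\<And>z. cmod z < R \<Longrightarrow> 0 \<le> Re (F z)"
    "F 0 = of_real (4 * (\<Sum>K\<in>\<F>. h K - l K))"
    "\<And>\<theta> K. K \<in> \<F> \<Longrightarrow> \<bar>\<theta> - (l K + h K) / 2\<bar> \<le> h K - l K \<Longrightarrow> 1 \<le> Re (F (cis \<theta>))"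
    by (rule arcs_kernel[OF \<F>, of "\<lambda>K. h K - l K" "\<lambda>K. (l K + h K) / 2"]) (use small in blast)+
  define G where "G z = of_real (1 / d) * F z" for z
  have Re_G: "Re (G z) = Re (F z) / d" for z
    by (simp add: G_def)
  have G_nonneg: "0 \<le> Re (G z)" if "cmod z < R" for z
    using F(3)[OF that] d by (simp add: Re_G)
  define f where "f z = G z / (1 + G z)" for z
  have f_hol: "f holomorphic_on ball 0 R"
  proof -
    have "1 + G z \<noteq> 0" if "z \<in> ball 0 R" for z
      using G_nonneg[of z] that by (auto simp: complex_eq_iff)
    moreover have "G holomorphic_on ball 0 R"
      unfolding G_def by (intro holomorphic_intros F(2))
    ultimately show ?thesis
      unfolding f_def by (intro holomorphic_intros) auto
  qed
  have f_le: "cmod (f z) \<le> 1" and f_sq: "(cmod (f z))\<^sup>2 \<le> Re (f z)"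
    and f_1: "cmod (1 - f z) \<le> 1 / (1 + Re (G z))" if "cmod z \<le> 1" for z
    using half_plane_to_disc[of "G z"] G_nonneg[of z] that F(1) by (auto simp: f_def)
  have f_0: "Re (f 0) \<le> d"
  proof -
    define g where "g = 1 / d * (4 * (\<Sum>K\<in>\<F>. h K - l K))"
    have "0 \<le> g" unfolding g_def using small d
      by (intro mult_nonneg_nonneg sum_nonneg) (auto intro: less_imp_le)
    have "g \<le> d" using len d by (simp add: g_def e_def field_simps power2_eq_square)
    have "f 0 = of_real (g / (1 + g))" by (simp add: f_def G_def F(4) g_def)
    then have "Re (f 0) = g / (1 + g)" by simp
    also have "\<dots> \<le> g / 1" using \<open>0 \<le> g\<close> by (intro frac_le) auto
    finally show ?thesis using \<open>g \<le> d\<close> by simp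
  qed
  obtain q where q: "\<And>z. cmod z \<le> 1 \<Longrightarrow> cmod (poly q z - f z) < d"
    using holomorphic_poly_approx[OF f_hol F(1) d(1)] by blast
  \<comment> \<open>Approximating f within d may push q above 1 on the disc; the rescaling repairs
    this and costs another d.\<close>
  define p where "p = smult (of_real (1 / (1 + d))) q"
  have poly_p: "poly p z = of_real (1 / (1 + d)) * poly q z" for z by (simp add: p_def)
  have p_le: "cmod (poly p z) \<le> 1" if "cmod z \<le> 1" for z
  proof -
    have "cmod (poly q z) \<le> cmod (poly q z - f z) + cmod (f z)"
      using norm_triangle_ineq[of "poly q z - f z" "f z"] by simp
    then have "cmod (poly q z) \<le> 1 + d" using q[OF that] f_le[OF that] by linarith
    then show ?thesis unfolding poly_p norm_mult norm_of_real using d by (simp add: field_simps)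
  qed
  have p_f: "cmod (poly p z - f z) \<le> 2 * d" if "cmod z \<le> 1" for z
  proof -
    have "poly p z - f z = of_real (1 / (1 + d)) * ((poly q z - f z) - of_real d * f z)"
    proof -
      have "complex_of_real (1 + d) \<noteq> 0" using d by (simp only: of_real_eq_0_iff)
      then show ?thesis unfolding poly_p of_real_divide by (simp add: field_simps)
    qed
    also have "cmod \<dots> \<le> 1 * (cmod (poly q z - f z) + d * cmod (f z))"
      unfolding norm_mult norm_of_real
      by (intro mult_mono order_trans[OF norm_triangle_ineq4]) (use d in \<open>auto simp: norm_mult\<close>)
    also have "\<dots> \<le> 1 * (d + d * 1)"
      using q[OF that] f_le[OF that] d by (intro mult_left_mono add_mono) auto
    finally show ?thesis by simp
  qed
  show ?thesis
  proof (rule that[of p])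
    show "cmod (poly p z) \<le> 1" if "cmod z \<le> 1" for z by (rule p_le[OF that])
    \<comment> \<open>|p|^2 \<le> |f|^2 + 4 d \<le> Re f + 4 d \<le> Re p + 6 d. The last expression
      is harmonic, so its integral is read off at 0.\<close>
    have pw: "(cmod (poly p (cis \<theta>)))\<^sup>2 \<le> Re (poly p (cis \<theta>)) + 6 * d" for \<theta>
    proof -
      let ?a = "cmod (poly p (cis \<theta>))" and ?b = "cmod (f (cis \<theta>))"
      have ab: "?a \<le> ?b + 2 * d" "?a \<le> 1" "?b \<le> 1"
        using p_f[of "cis \<theta>"] p_le[of "cis \<theta>"] f_le[of "cis \<theta>"]
          norm_triangle_ineq2[of "poly p (cis \<theta>)" "f (cis \<theta>)"] by auto
      have "?a\<^sup>2 - ?b\<^sup>2 = (?a + ?b) * (?a - ?b)" by (simp add: power2_eq_square algebra_simps)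
      also have "\<dots> \<le> 2 * (2 * d)"
      proof (cases "?a \<le> ?b")
        case True
        then have "(?a + ?b) * (?a - ?b) \<le> 0" by (intro mult_nonneg_nonpos) auto
        then show ?thesis using d by simp
      next
        case False
        then show ?thesis using ab by (intro mult_mono) auto
      qed
      finally have "?a\<^sup>2 \<le> ?b\<^sup>2 + 4 * d" by simp
      moreover have "\<bar>Re (poly p (cis \<theta>) - f (cis \<theta>))\<bar> \<le> 2 * d"
        using abs_Re_le_cmod p_f[of "cis \<theta>"] order_trans by fastforce
      ultimately show ?thesis using f_sq[of "cis \<theta>"] by simp
    qed
    have circ_total: "measure circ UNIV = 2 * pi" by (simp add: measure_def emeasure_circ)
    have "(\<integral>\<theta>. (cmod (poly p (cis \<theta>)))\<^sup>2 \<partial>circ) \<le> (\<integral>\<theta>. Re (poly p (cis \<theta>)) + 6 * d \<partial>circ)"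
      by (intro integral_mono pw integrable_circ_continuous continuous_intros)
    also have "\<dots> = Re (\<integral>\<theta>. poly p (cis \<theta>) \<partial>circ) + 12 * pi * d"
    proof -
      have i: "integrable circ (\<lambda>\<theta>. poly p (cis \<theta>))"
        by (intro integrable_circ_continuous continuous_intros)
      show ?thesis
        by (subst Bochner_Integration.integral_add) (use i in \<open>auto simp: circ_total\<close>)
    qed
    also have "(\<integral>\<theta>. poly p (cis \<theta>) \<partial>circ) = of_real (2 * pi) * poly p 0"
      using integral_circ_coeff[of 0 p] by (simp add: poly_0_coeff_0)
    also have "Re (of_real (2 * pi) * poly p 0) \<le> 2 * pi * (3 * d)"
    proof -
      have "\<bar>Re (poly p 0 - f 0)\<bar> \<le> 2 * d"
        using abs_Re_le_cmod p_f[of 0] order_trans by fastforce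
      then have "Re (poly p 0) \<le> 3 * d" using f_0 by simp
      then show ?thesis by simp
    qed
    also have "2 * pi * (3 * d) + 12 * pi * d = (18 * pi) * d" by simp
    also have "\<dots> \<le> k * d" using d by (intro mult_right_mono) (auto simp: k_def)
    also have "k * d = \<epsilon>" using k by (simp add: d_def)
    finally show "(\<integral>\<theta>. (cmod (poly p (cis \<theta>)))\<^sup>2 \<partial>circ) \<le> \<epsilon>" by simp
    have Un_sets [measurable]: "\<Union>\<F> \<in> sets borel"
    proof (rule sets.finite_Union[OF \<F>])
      show "\<F> \<subseteq> sets borel"
      proof
        fix K assume "K \<in> \<F>"
        then show "K \<in> sets borel" using lh[of K] by (metis atLeastAtMost_borel)
      qed
    qed
    have p1_le2: "cmod (poly p (cis \<theta>) - 1) \<le> 2" for \<theta>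
      using norm_triangle_ineq4[of "poly p (cis \<theta>)" 1] p_le[of "cis \<theta>"] by simp
    have pw2: "indicator S \<theta> * cmod (poly p (cis \<theta>) - 1) \<le> 3 * d + 2 * indicator (S - \<Union>\<F>) \<theta>" for \<theta>
    proof (cases "\<theta> \<in> S \<inter> \<Union>\<F>")
      case True
      then obtain K where K: "K \<in> \<F>" "\<theta> \<in> K" by blast
      then have "\<theta> \<in> {l K..h K}" using lh[OF K(1)] by simp
      then have "\<bar>\<theta> - (l K + h K) / 2\<bar> \<le> h K - l K"
        by (auto simp: abs_le_iff field_simps)
      then have "1 / d \<le> Re (G (cis \<theta>))" using F(5)[OF K(1)] d by (simp add: Re_G divide_right_mono)
      then have "1 / (1 + Re (G (cis \<theta>))) \<le> 1 / (1 / d)" using d by (intro frac_le) auto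
      then have "cmod (1 - f (cis \<theta>)) \<le> d" using f_1[of "cis \<theta>"] by simp
      moreover have "cmod (poly p (cis \<theta>) - 1) \<le> cmod (poly p (cis \<theta>) - f (cis \<theta>)) + cmod (1 - f (cis \<theta>))"
        using norm_triangle_ineq4[of "poly p (cis \<theta>) - f (cis \<theta>)" "1 - f (cis \<theta>)"] by simp
      ultimately show ?thesis using p_f[of "cis \<theta>"] True by simp
    next
      case False
      then show ?thesis using p1_le2[of \<theta>] d by (auto simp: indicator_def)
    qed
    have "(\<integral>\<theta>. indicator S \<theta> * cmod (poly p (cis \<theta>) - 1) \<partial>\<nu>)
        \<le> (\<integral>\<theta>. 3 * d + 2 * indicator (S - \<Union>\<F>) \<theta> \<partial>\<nu>)"
    proof (rule integral_mono[OF _ _ pw2])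
      show "integrable \<nu> (\<lambda>\<theta>. indicator S \<theta> * cmod (poly p (cis \<theta>) - 1))"
        by (rule \<nu>.integrable_const_bound[where B = 2])
          (use p1_le2 in \<open>auto simp: abs_mult indicator_def\<close>)
      show "integrable \<nu> (\<lambda>\<theta>. 3 * d + 2 * indicator (S - \<Union>\<F>) \<theta>)"
      proof (rule \<nu>.integrable_const_bound[where B = "3 * d + 2"])
        show "AE \<theta> in \<nu>. norm (3 * d + 2 * indicator (S - \<Union>\<F>) \<theta> :: real) \<le> 3 * d + 2"
          using d by (auto simp: indicator_def)
        show "(\<lambda>\<theta>. 3 * d + 2 * indicator (S - \<Union>\<F>) \<theta> :: real) \<in> borel_measurable \<nu>"
          by measurable
      qed
    qed
    also have "\<dots> = 3 * d * measure \<nu> (space \<nu>) + 2 * measure \<nu> (S - \<Union>\<F>)"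
    proof -
      have sp: "space \<nu> = UNIV" using \<nu>(2) sets_eq_imp_space_eq by fastforce
      show ?thesis
        by (subst Bochner_Integration.integral_add) (auto simp: sp \<nu>.emeasure_eq_measure \<nu>(2))
    qed
    also have "\<dots> \<le> (3 * measure \<nu> (space \<nu>) + 2) * d" using rest by (simp add: algebra_simps)
    also have "\<dots> \<le> k * d" using d by (intro mult_right_mono) (auto simp: k_def)
    also have "k * d = \<epsilon>" using k by (simp add: d_def)
    finally show "(\<integral>\<theta>. indicator (N \<inter> {0..2*pi}) \<theta> * cmod (poly p (cis \<theta>) - 1) \<partial>\<nu>) \<le> \<epsilon>"
      by (simp add: S_def)
  qed
qed

text \<open>L1 convergence yields pointwise convergence along a subsequence, extracted once for
  \<open>circ\<close> and again for \<open>\<nu>\<close>. The coefficients tend to 0 because they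
  are Fourier coefficients of bounded functions tending to 0 almost everywhere on the
  circle.\<close>

lemma peak_sequence:
  fixes \<nu> :: "real measure"
  assumes N: "N \<in> null_sets circ" and \<nu>: "finite_measure \<nu>" "sets \<nu> = sets borel"
  obtains p where "\<And>n z. cmod z \<le> 1 \<Longrightarrow> cmod (poly (p n) z) \<le> 1"
    "AE \<theta> in circ. (\<lambda>n. poly (p n) (cis \<theta>)) \<longlonglongrightarrow> 0"
    "AE \<theta> in \<nu>. \<theta> \<in> N \<inter> {0..2*pi} \<longrightarrow> (\<lambda>n. poly (p n) (cis \<theta>)) \<longlonglongrightarrow> 1"
    "\<And>k. (\<lambda>n. coeff (p n) k) \<longlonglongrightarrow> (0::complex)"
proof -
  interpret \<nu>: finite_measure \<nu> by fact
  note [measurable_cong] = \<nu>(2)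
  define S where "S = N \<inter> {0..2*pi}"
  have [measurable]: "S \<in> sets borel" using N by (auto simp: S_def)
  define good where "good n p \<longleftrightarrow> (\<forall>z. cmod z \<le> 1 \<longrightarrow> cmod (poly p z) \<le> 1) \<and>
      (\<integral>\<theta>. (cmod (poly p (cis \<theta>)))\<^sup>2 \<partial>circ) \<le> 1 / real (Suc n) \<and>
      (\<integral>\<theta>. indicator S \<theta> * cmod (poly p (cis \<theta>) - 1) \<partial>\<nu>) \<le> 1 / real (Suc n)" for n p
  have "\<exists>p. good n p" for n
  proof -
    have "0 < 1 / real (Suc n)" "1 / real (Suc n) \<le> 1" by auto
    from peak_polynomial[OF N \<nu> this, folded S_def] show ?thesis unfolding good_def by blast
  qed
  then obtain q where good: "\<And>n. good n (q n)" by metis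
  have q: "\<And>n z. cmod z \<le> 1 \<Longrightarrow> cmod (poly (q n) z) \<le> 1"
    "\<And>n. (\<integral>\<theta>. (cmod (poly (q n) (cis \<theta>)))\<^sup>2 \<partial>circ) \<le> 1 / real (Suc n)"
    "\<And>n. (\<integral>\<theta>. indicator S \<theta> * cmod (poly (q n) (cis \<theta>) - 1) \<partial>\<nu>) \<le> 1 / real (Suc n)"
    using good unfolding good_def by blast+
  have inv0: "(\<lambda>n. 1 / real (Suc n)) \<longlonglongrightarrow> 0"
    using LIMSEQ_inverse_real_of_nat by (simp add: inverse_eq_divide)
  have "\<exists>r. strict_mono (r :: nat \<Rightarrow> nat) \<and> (AE \<theta> in circ. (\<lambda>n. (cmod (poly (q (r n)) (cis \<theta>)))\<^sup>2) \<longlonglongrightarrow> 0)"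
  proof (rule tendsto_L1_AE_subseq)
    show "integrable circ (\<lambda>\<theta>. (cmod (poly (q n) (cis \<theta>)))\<^sup>2)" for n
      by (intro integrable_circ_continuous continuous_intros)
    show "(\<lambda>n. \<integral>\<theta>. norm ((cmod (poly (q n) (cis \<theta>)))\<^sup>2) \<partial>circ) \<longlonglongrightarrow> 0"
      by (rule tendsto_sandwich[OF _ _ tendsto_const inv0]) (use q(2) in auto)
  qed
  then obtain r where r: "strict_mono (r :: nat \<Rightarrow> nat)"
    "AE \<theta> in circ. (\<lambda>n. (cmod (poly (q (r n)) (cis \<theta>)))\<^sup>2) \<longlonglongrightarrow> 0" by blast
  have "\<exists>s. strict_mono (s :: nat \<Rightarrow> nat) \<and>
      (AE \<theta> in \<nu>. (\<lambda>n. indicator S \<theta> * cmod (poly (q (r (s n))) (cis \<theta>) - 1)) \<longlonglongrightarrow> 0)"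
  proof (rule tendsto_L1_AE_subseq)
    show "integrable \<nu> (\<lambda>\<theta>. indicator S \<theta> * cmod (poly (q (r n)) (cis \<theta>) - 1))" for n
    proof (rule \<nu>.integrable_const_bound[where B = 2])
      have "cmod (poly (q (r n)) (cis \<theta>) - 1) \<le> 2" for \<theta>
        using norm_triangle_ineq4[of "poly (q (r n)) (cis \<theta>)" 1] q(1)[of "cis \<theta>" "r n"] by simp
      then show "AE \<theta> in \<nu>. norm (indicator S \<theta> * cmod (poly (q (r n)) (cis \<theta>) - 1)) \<le> 2"
        by (auto simp: abs_mult indicator_def)
    qed auto
    have inv0': "(\<lambda>n. 1 / real (Suc (r n))) \<longlonglongrightarrow> 0"
      using LIMSEQ_subseq_LIMSEQ[OF inv0 r(1)] by (simp add: o_def)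
    show "(\<lambda>n. \<integral>\<theta>. norm (indicator S \<theta> * cmod (poly (q (r n)) (cis \<theta>) - 1)) \<partial>\<nu>) \<longlonglongrightarrow> 0"
      by (rule tendsto_sandwich[OF _ _ tendsto_const inv0']) (use q(3) in \<open>auto simp: abs_mult\<close>)
  qed
  then obtain s where s: "strict_mono (s :: nat \<Rightarrow> nat)"
      "AE \<theta> in \<nu>. (\<lambda>n. indicator S \<theta> * cmod (poly (q (r (s n))) (cis \<theta>) - 1)) \<longlonglongrightarrow> 0" by blast
  define p where "p n = q (r (s n))" for n
  have p_le: "cmod (poly (p n) z) \<le> 1" if "cmod z \<le> 1" for n z using q(1)[OF that] by (simp add: p_def)
  have p_circ: "AE \<theta> in circ. (\<lambda>n. poly (p n) (cis \<theta>)) \<longlonglongrightarrow> 0"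
    using r(2)
  proof eventually_elim
    case (elim \<theta>)
    then have "(\<lambda>n. sqrt ((cmod (poly (q (r n)) (cis \<theta>)))\<^sup>2)) \<longlonglongrightarrow> sqrt 0"
      by (intro tendsto_real_sqrt)
    then have "(\<lambda>n. poly (q (r n)) (cis \<theta>)) \<longlonglongrightarrow> 0" by (simp add: tendsto_norm_zero_iff)
    then show ?case using LIMSEQ_subseq_LIMSEQ[OF _ s(1)] by (fastforce simp: p_def o_def)
  qed
  show ?thesis
  proof (rule that[OF p_le p_circ])
    show "AE \<theta> in \<nu>. \<theta> \<in> N \<inter> {0..2*pi} \<longrightarrow> (\<lambda>n. poly (p n) (cis \<theta>)) \<longlonglongrightarrow> 1"
      using s(2) unfolding S_def[symmetric]
    proof eventually_elim
      case (elim \<theta>)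
      show ?case
      proof
        assume "\<theta> \<in> S"
        then have "(\<lambda>n. poly (p n) (cis \<theta>) - 1) \<longlonglongrightarrow> 0"
          using elim by (simp add: tendsto_norm_zero_iff p_def)
        then show "(\<lambda>n. poly (p n) (cis \<theta>)) \<longlonglongrightarrow> 1" by (simp add: LIM_zero_iff)
      qed
    qed
    fix k
    have "(\<lambda>n. \<integral>\<theta>. cis (- (real k * \<theta>)) * poly (p n) (cis \<theta>) \<partial>circ) \<longlonglongrightarrow> (\<integral>\<theta>. 0 \<partial>circ)"
    proof (rule integral_dominated_convergence[where w = "\<lambda>_. 1"])
      show "AE \<theta> in circ. (\<lambda>n. cis (- (real k * \<theta>)) * poly (p n) (cis \<theta>)) \<longlonglongrightarrow> 0"
        using p_circ by eventually_elim (rule tendsto_mult_right_zero)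
    qed (auto simp: norm_mult p_le)
    then have "(\<lambda>n. of_real (2 * pi) * coeff (p n) k / of_real (2 * pi)) \<longlonglongrightarrow> 0 / of_real (2 * pi)"
      unfolding integral_circ_coeff by (intro tendsto_divide) auto
    then show "(\<lambda>n. coeff (p n) k) \<longlonglongrightarrow> 0" by simp
  qed
qed

section \<open>Spectral measures of completely non-unitary contractions\<close>

lemma poly_cutoff_shift: "p = poly_cutoff k p + monom 1 k * poly_shift k p"
  for p :: "'a::comm_semiring_1 poly"
  by (rule poly_eqI) (auto simp: coeff_poly_cutoff coeff_poly_shift coeff_monom_mult)

lemma LIMSEQ_null_le:
  fixes f g :: "nat \<Rightarrow> real"
  assumes "g \<longlonglongrightarrow> 0" "\<And>n. f n \<le> g n" "\<And>n. 0 \<le> f n"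
  shows "f \<longlonglongrightarrow> 0"
  by (rule tendsto_sandwich[OF _ _ tendsto_const assms(1)]) (simp_all add: assms)

section \<open>Von Neumann's inequality and its consequences\<close>

context operator
begin

definition spectral :: "'a \<Rightarrow> real measure \<Rightarrow> bool" where
  "spectral x \<mu> \<longleftrightarrow> finite_measure \<mu> \<and> sets \<mu> = sets borel \<and> (AE \<theta> in \<mu>. \<theta> \<in> {0..2*pi}) \<and>
    (\<forall>p. (\<integral>\<theta>. poly p (cis \<theta>) \<partial>\<mu>) = hip (pev p x) x) \<and>
    (\<forall>p. (norm (pev p x))\<^sup>2 \<le> (\<integral>\<theta>. (cmod (poly p (cis \<theta>)))\<^sup>2 \<partial>\<mu>))"

lemma spectralD:
  assumes "spectral x \<mu>"
  shows "finite_measure \<mu>" "sets \<mu> = sets borel" "AE \<theta> in \<mu>. \<theta> \<in> {0..2*pi}"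
    "(\<integral>\<theta>. poly p (cis \<theta>) \<partial>\<mu>) = hip (pev p x) x"
    "(norm (pev p x))\<^sup>2 \<le> (\<integral>\<theta>. (cmod (poly p (cis \<theta>)))\<^sup>2 \<partial>\<mu>)"
  using assms unfolding spectral_def by blast+

lemma invariant_form_id: "invariant_form J T (\<lambda>x. x)"
  by unfold_locales (auto simp: linear_iff norm_le simp flip: power2_norm_eq_inner)

lemma invariant_form_A: "invariant_form J T (A_op T)"
  by (intro invariant_form.intro operator_axioms invariant_form_axioms.intro A_linear A_sym
      A_form_nonneg A_commute[OF cplx T_J] eq_refl[OF A_isometric])

lemma spectral_exists: obtains \<mu> where "spectral x \<mu>"
proof -
  interpret id: invariant_form J T "\<lambda>x. x" by (rule invariant_form_id)
  obtain \<mu> :: "real measure" where "finite_measure \<mu>" "sets \<mu> = sets borel"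
    "AE \<theta> in \<mu>. \<theta> \<in> {0..2*pi}"
    "\<And>p. (\<integral>\<theta>. poly p (cis \<theta>) \<partial>\<mu>) = hip (pev p x) x"
    "\<And>p. inner (pev p x) (pev p x) \<le> (\<integral>\<theta>. (cmod (poly p (cis \<theta>)))\<^sup>2 \<partial>\<mu>)"
    by (rule id.spectral_measure) blast
  then show ?thesis using that by (auto simp: spectral_def power2_norm_eq_inner)
qed

text \<open>Integrate the bound K^2 against a spectral measure of x, whose mass is |x|^2 by the
  moment formula for p = 1.\<close>

theorem von_Neumann:
  assumes "\<And>z. cmod z = 1 \<Longrightarrow> cmod (poly p z) \<le> K"
  shows "norm (pev p x) \<le> K * norm x"
proof -
  obtain \<mu> where \<mu>: "spectral x \<mu>" using spectral_exists by blast
  interpret finite_measure \<mu> by (rule spectralD[OF \<mu>])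
  have sp: "space \<mu> = UNIV" using sets_eq_imp_space_eq[OF spectralD(2)[OF \<mu>]] by simp
  have "cmod (poly p 1) \<le> K" by (rule assms) simp
  then have K: "0 \<le> K" by (rule order_trans[OF norm_ge_zero])
  have "hip (pev 1 x) x = (\<integral>\<theta>. poly 1 (cis \<theta>) \<partial>\<mu>)" by (rule spectralD(4)[OF \<mu>, symmetric])
  then have total: "measure \<mu> UNIV = (norm x)\<^sup>2"
    by (simp add: hip_self sp scaleR_conv_of_real flip: of_real_power)
  have "(norm (pev p x))\<^sup>2 \<le> (\<integral>\<theta>. (cmod (poly p (cis \<theta>)))\<^sup>2 \<partial>\<mu>)"
    by (rule spectralD(5)[OF \<mu>])
  also have "\<dots> \<le> (\<integral>\<theta>. K\<^sup>2 \<partial>\<mu>)"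
    by (intro integral_mono integrable_poly_cis[OF spectralD(1,2)[OF \<mu>]] power_mono assms) auto
  also have "\<dots> = (K * norm x)\<^sup>2" by (simp add: total sp power_mult_distrib)
  finally show ?thesis by (rule power2_le_imp_le) (simp add: K)
qed

lemma norm_pev_le: "norm (pev p x) \<le> norm x" if "\<And>z. cmod z \<le> 1 \<Longrightarrow> cmod (poly p z) \<le> 1"
  using von_Neumann[of p 1 x] that by simp

text \<open>Split p = q + z^k g with q of degree below k. Then |q| \<le> s on the disc, and |g|
  \<le> 1 + s on the circle, where |z^k| = 1; von Neumann's inequality asks for bounds on the circle
  only. So p(T) x is controlled by T^k x once the first k coefficients are small.\<close>

lemma norm_pev_le_shift:
  fixes k :: nat
  assumes p: "\<And>z. cmod z \<le> 1 \<Longrightarrow> cmod (poly p z) \<le> 1"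
  defines "s \<equiv> \<Sum>i<k. cmod (coeff p i)"
  shows "norm (pev p x) \<le> s * norm x + (1 + s) * norm ((T ^^ k) x)"
proof -
  let ?q = "poly_cutoff k p" and ?g = "poly_shift k p"
  have deg: "degree ?q \<le> k" by (rule degree_le) (simp add: coeff_poly_cutoff)
  have poly_q: "cmod (poly ?q z) \<le> s" if "cmod z \<le> 1" for z
  proof -
    have "poly ?q z = (\<Sum>i\<le>k. coeff ?q i * z ^ i)"
      unfolding poly_altdef using deg
      by (intro sum.mono_neutral_left) (auto simp: coeff_eq_0)
    also have "\<dots> = (\<Sum>i<k. coeff p i * z ^ i)"
      by (simp add: coeff_poly_cutoff lessThan_Suc_atMost[symmetric])
    also have "cmod \<dots> \<le> s"
      unfolding s_def using that
      by (intro order_trans[OF norm_sum] sum_mono)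
        (simp add: norm_mult norm_power mult_left_le power_le_one)
    finally show ?thesis .
  qed
  have "norm (pev ?q x) \<le> s * norm x"
    using poly_q by (intro von_Neumann) simp
  moreover have "norm (pev ?g ((T ^^ k) x)) \<le> (1 + s) * norm ((T ^^ k) x)"
  proof (rule von_Neumann)
    fix z :: complex assume z: "cmod z = 1"
    have "poly p z = poly ?q z + z ^ k * poly ?g z"
      using arg_cong[OF poly_cutoff_shift[of p k], of "\<lambda>p. poly p z"] by (simp add: poly_monom)
    then have "cmod (z ^ k * poly ?g z) = cmod (poly p z - poly ?q z)" by simp
    also have "\<dots> \<le> 1 + s"
      using z p[of z] poly_q[of z] by (intro order_trans[OF norm_triangle_ineq4] add_mono) auto
    finally show "cmod (poly ?g z) \<le> 1 + s" using z by (simp add: norm_mult norm_power)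
  qed
  moreover have "pev p x = pev ?q x + pev ?g ((T ^^ k) x)"
    using arg_cong[OF poly_cutoff_shift[of p k], of "\<lambda>p. pev p x"]
    by (simp add: pev_add pev_mult pev_monom mult.commute[of "monom 1 k"])
  ultimately show ?thesis
    using norm_triangle_ineq[of "pev ?q x" "pev ?g ((T ^^ k) x)"] by simp
qed

text \<open>The case k = 1 of \<open>norm_pev_le_shift\<close>: as the constant terms vanish in the
  limit, the norm of p_n(T) z is asymptotically at most that of T z.\<close>

lemma norm_T_eq_if_pev_tendsto:
  assumes p: "\<And>n z. cmod z \<le> 1 \<Longrightarrow> cmod (poly (p n) z) \<le> 1"
    and coeff: "\<And>k. (\<lambda>n. coeff (p n) k) \<longlonglongrightarrow> 0"
    and lim: "(\<lambda>n. pev (p n) z) \<longlonglongrightarrow> z"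
  shows "norm (T z) = norm z"
proof -
  have s: "(\<lambda>n. \<Sum>i<1. cmod (coeff (p n) i)) \<longlonglongrightarrow> 0"
    using tendsto_norm_zero[OF coeff[of 0]] by simp
  have "(\<lambda>n. (\<Sum>i<1. cmod (coeff (p n) i)) * norm z + (1 + (\<Sum>i<1. cmod (coeff (p n) i))) * norm ((T ^^ 1) z))
      \<longlonglongrightarrow> 0 * norm z + (1 + 0) * norm ((T ^^ 1) z)"
    by (intro tendsto_intros s)
  then have "norm z \<le> 0 * norm z + (1 + 0) * norm ((T ^^ 1) z)"
    by (intro LIMSEQ_le[OF tendsto_norm[OF lim]]) (use norm_pev_le_shift[OF p] in blast)+
  then show ?thesis using norm_le[of z] by simp
qed

end

text \<open>Equality case of Cauchy-Schwarz. For c n = C_n z with contractions C_n the hypothesis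
  involves only <C_n z, z>, which does not change when C_n is replaced by its adjoint.\<close>

lemma tendsto_of_inner_tendsto:
  fixes c :: "nat \<Rightarrow> 'a::real_inner"
  assumes "\<And>n. norm (c n) \<le> norm z" "(\<lambda>n. inner (c n) z) \<longlonglongrightarrow> (norm z)\<^sup>2"
  shows "c \<longlonglongrightarrow> z"
proof -
  have le: "(norm (c n - z))\<^sup>2 \<le> 2 * (norm z)\<^sup>2 - 2 * inner (c n) z" for n
  proof -
    have "(norm (c n - z))\<^sup>2 = (norm (c n))\<^sup>2 - 2 * inner (c n) z + (norm z)\<^sup>2"
      by (simp add: power2_norm_eq_inner inner_diff_left inner_diff_right inner_commute)
    then show ?thesis using power_mono[OF assms(1)[of n], of 2] by simp
  qed
  have "(\<lambda>n. 2 * (norm z)\<^sup>2 - 2 * inner (c n) z) \<longlonglongrightarrow> 2 * (norm z)\<^sup>2 - 2 * (norm z)\<^sup>2"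
    by (intro tendsto_intros assms(2))
  then have "(\<lambda>n. 2 * (norm z)\<^sup>2 - 2 * inner (c n) z) \<longlonglongrightarrow> 0" by simp
  from LIMSEQ_null_le[OF this le] have "(\<lambda>n. (norm (c n - z))\<^sup>2) \<longlonglongrightarrow> 0" by simp
  from tendsto_real_sqrt[OF this] have "(\<lambda>n. norm (c n - z)) \<longlonglongrightarrow> 0" by simp
  then show ?thesis by (simp add: tendsto_norm_zero_iff LIM_zero_iff)
qed

context operator
begin

text \<open>The vectors \<open>z\<close> with \<open>p\<^sub>n(T) z \<longlonglongrightarrow> z\<close> form a reducing subspace on which \<open>T\<close> is unitary: since
  the \<open>p\<^sub>n(T)\<close> are contractions the condition is equivalent to \<open>p\<^sub>n(T)\<^sup>* z \<longlonglongrightarrow> z\<close>.\<close>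

lemma cnu_pev_fixed_vector:
  assumes cnu: "cnu J T"
    and p: "\<And>n z. cmod z \<le> 1 \<Longrightarrow> cmod (poly (p n) z) \<le> 1"
    and coeff: "\<And>k. (\<lambda>n. coeff (p n) k) \<longlonglongrightarrow> 0"
    and lim: "(\<lambda>n. pev (p n) z) \<longlonglongrightarrow> z"
  shows "z = 0"
proof -
  interpret S: operator J "adj T" by (rule operator_adj)
  define q where "q n = map_poly cnj (p n)" for n
  have q: "cmod (poly (q n) z) \<le> 1" if "cmod z \<le> 1" for n z
  proof -
    have "poly (q n) z = cnj (poly (p n) (cnj z))" by (simp add: q_def)
    then show ?thesis using p[of "cnj z" n] that by simp
  qed
  have q_coeff: "(\<lambda>n. coeff (q n) k) \<longlonglongrightarrow> 0" for k
    using tendsto_cnj[OF coeff[of k]] by (simp add: q_def coeff_map_poly)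
  have adj_eq: "inner (pev (p n) u) v = inner u (S.pev (q n) v)" for n u v
    by (simp add: q_def pev_adj)
  define M where "M = {z. (\<lambda>n. pev (p n) z) \<longlonglongrightarrow> z}"
  have M_iff: "z \<in> M \<longleftrightarrow> (\<lambda>n. S.pev (q n) z) \<longlonglongrightarrow> z" for z
  proof
    assume "z \<in> M"
    then have "(\<lambda>n. inner (pev (p n) z) z) \<longlonglongrightarrow> inner z z"
      unfolding M_def by (intro tendsto_inner) auto
    moreover have "inner (pev (p n) z) z = inner (S.pev (q n) z) z" for n
      unfolding adj_eq by (rule inner_commute)
    ultimately have "(\<lambda>n. inner (S.pev (q n) z) z) \<longlonglongrightarrow> (norm z)\<^sup>2"
      by (simp only: power2_norm_eq_inner)
    then show "(\<lambda>n. S.pev (q n) z) \<longlonglongrightarrow> z"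
      by (rule tendsto_of_inner_tendsto[rotated]) (intro S.norm_pev_le q)
  next
    assume "(\<lambda>n. S.pev (q n) z) \<longlonglongrightarrow> z"
    then have "(\<lambda>n. inner z (S.pev (q n) z)) \<longlonglongrightarrow> inner z z"
      by (intro tendsto_inner) auto
    then have "(\<lambda>n. inner (pev (p n) z) z) \<longlonglongrightarrow> (norm z)\<^sup>2"
      by (simp only: adj_eq power2_norm_eq_inner)
    then have "(\<lambda>n. pev (p n) z) \<longlonglongrightarrow> z"
      by (rule tendsto_of_inner_tendsto[rotated]) (intro norm_pev_le p)
    then show "z \<in> M" by (simp add: M_def)
  qed
  have "closed M"
    unfolding closed_sequential_limits
  proof (intro allI impI, elim conjE)
    fix y and l assume y: "\<forall>k. y k \<in> M" and l: "y \<longlonglongrightarrow> l"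
    show "l \<in> M"
      unfolding M_def
    proof (intro CollectI metric_LIMSEQ_I)
      fix r :: real assume "r > 0"
      then obtain k where k: "norm (y k - l) < r / 3"
        using LIMSEQ_D[OF l, of "r / 3"] by auto
      obtain n0 where n0: "\<And>n. n \<ge> n0 \<Longrightarrow> norm (pev (p n) (y k) - y k) < r / 3"
        using LIMSEQ_D[of "\<lambda>n. pev (p n) (y k)" "y k" "r / 3"] y \<open>r > 0\<close> by (auto simp: M_def)
      have "dist (pev (p n) l) l < r" if "n \<ge> n0" for n
      proof -
        have eq: "pev (p n) l - l = (pev (p n) (y k) - y k) + ((y k - l) - pev (p n) (y k - l))"
          by (simp add: pev_diff_right)
        have "norm ((y k - l) - pev (p n) (y k - l)) \<le> norm (y k - l) + norm (y k - l)"
          by (intro order_trans[OF norm_triangle_ineq4] add_mono order_refl norm_pev_le p)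
        then show ?thesis
          unfolding dist_norm eq using n0[OF that] k
            norm_triangle_ineq[of "pev (p n) (y k) - y k" "(y k - l) - pev (p n) (y k - l)"]
          by linarith
      qed
      then show "\<exists>no. \<forall>n\<ge>no. dist (pev (p n) l) l < r" by blast
    qed
  qed
  moreover have "subspace M"
  proof -
    have "pev (p n) 0 = 0" for n using pev_scaleR[of "p n" 0 0] by simp
    then show ?thesis
      unfolding subspace_def M_def by (auto simp: pev_add_right pev_scaleR intro!: tendsto_intros)
  qed
  moreover have "J z \<in> M" if "z \<in> M" for z
    using that bounded_linear.tendsto[OF sc_bounded_linear[of \<i>], of "\<lambda>n. pev (p n) z" z]
    by (simp add: M_def pev_J scaleJ_def)
  moreover have "T z \<in> M" if "z \<in> M" for z
    using bounded_linear.tendsto[OF bounded_linear, of "\<lambda>n. pev (p n) z" z] that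
    by (simp add: M_def T_pev)
  \<comment> \<open>By \<open>M_iff\<close> the set M is described in the same way by
    \<open>adj T\<close> and the conjugated polynomials, so the argument for T applies to the
    adjoint.\<close>
  moreover have "adj T z \<in> M" if "z \<in> M" for z
    using bounded_linear.tendsto[OF adj_bounded_linear, of "\<lambda>n. S.pev (q n) z" z] that
    by (simp add: M_iff S.T_pev)
  ultimately have "reducing J T M" by (auto simp: reducing_def)
  moreover have "adj T (T z) = z" if "z \<in> M" for z
    using that unfolding M_def by (intro adj_T_if_isometric norm_T_eq_if_pev_tendsto[of p] p coeff) auto
  moreover have "T (adj T z) = z" if "z \<in> M" for z
  proof -
    have "norm (adj T z) = norm z"
      using that unfolding M_iff by (intro S.norm_T_eq_if_pev_tendsto[of q] q q_coeff) auto
    from S.adj_T_if_isometric[OF this] show ?thesis by (simp add: adj_adj)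
  qed
  ultimately have "M = {0}" using cnu unfolding cnu_def by blast
  moreover have "z \<in> M" using lim by (simp add: M_def)
  ultimately show ?thesis by simp
qed

lemma spectral_L2_null:
  assumes \<mu>: "spectral x \<mu>"
    and bound: "\<And>n z. cmod z \<le> 1 \<Longrightarrow> cmod (poly (p n) z) \<le> K"
    and ae: "AE \<theta> in \<mu>. (\<lambda>n. poly (p n) (cis \<theta>)) \<longlonglongrightarrow> 0"
  shows "(\<lambda>n. pev (p n) x) \<longlonglongrightarrow> 0"
proof -
  interpret finite_measure \<mu> by (rule spectralD[OF \<mu>])
  have [measurable_cong]: "sets \<mu> = sets borel" by (rule spectralD[OF \<mu>])
  have "(\<lambda>n. \<integral>\<theta>. (cmod (poly (p n) (cis \<theta>)))\<^sup>2 \<partial>\<mu>) \<longlonglongrightarrow> (\<integral>\<theta>. 0 \<partial>\<mu>)"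
  proof (rule integral_dominated_convergence[where w = "\<lambda>_. K\<^sup>2"])
    show "AE \<theta> in \<mu>. (\<lambda>n. (cmod (poly (p n) (cis \<theta>)))\<^sup>2) \<longlonglongrightarrow> 0"
      using ae
    proof eventually_elim
      case (elim \<theta>)
      from tendsto_power[OF tendsto_norm[OF elim], of 2] show ?case by simp
    qed
  qed (use bound in \<open>auto intro!: power_mono\<close>)
  moreover have "(norm (pev (p n) x))\<^sup>2 \<le> (\<integral>\<theta>. (cmod (poly (p n) (cis \<theta>)))\<^sup>2 \<partial>\<mu>)" for n
    by (rule spectralD(5)[OF \<mu>])
  ultimately have "(\<lambda>n. (norm (pev (p n) x))\<^sup>2) \<longlonglongrightarrow> 0"
    using LIMSEQ_null_le[of "\<lambda>n. \<integral>\<theta>. (cmod (poly (p n) (cis \<theta>)))\<^sup>2 \<partial>\<mu>" "\<lambda>n. (norm (pev (p n) x))\<^sup>2"]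
    by simp
  from tendsto_real_sqrt[OF this] show ?thesis by (simp add: tendsto_norm_zero_iff)
qed

lemma spectral_L2_convergent:
  assumes \<mu>: "spectral x \<mu>"
    and bound: "\<And>n z. cmod z \<le> 1 \<Longrightarrow> cmod (poly (p n) z) \<le> K"
    and ae: "AE \<theta> in \<mu>. convergent (\<lambda>n. poly (p n) (cis \<theta>))"
  shows "convergent (\<lambda>n. pev (p n) x)"
proof -
  have "Cauchy (\<lambda>n. pev (p n) x)"
  \<comment> \<open>\<open>spectral_L2_null\<close> handles single sequences. Failure of the Cauchy
    property yields index pairs tending to infinity with distance at least e, and the differences of
    the corresponding polynomials form one sequence tending to 0 almost everywhere.\<close>
  proof (rule ccontr)
    assume "\<not> Cauchy (\<lambda>n. pev (p n) x)"
    then obtain e where e: "e > 0" "\<And>k. \<exists>m n. m \<ge> k \<and> n \<ge> k \<and> \<not> dist (pev (p m) x) (pev (p n) x) < e"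
      unfolding Cauchy_def by blast
    define good where "good k i \<longleftrightarrow> fst i \<ge> k \<and> snd i \<ge> k \<and> \<not> dist (pev (p (fst i)) x) (pev (p (snd i)) x) < e"
      for k and i :: "nat \<times> nat"
    have "\<exists>i. good k i" for k using e(2)[of k] by (auto simp: good_def)
    then obtain i where i: "\<And>k. good k (i k)" by metis
    define a where "a k = fst (i k)" for k
    define b where "b k = snd (i k)" for k
    have ab: "a k \<ge> k" "b k \<ge> k" "e \<le> norm (pev (p (a k) - p (b k)) x)" for k
      using i[of k] by (auto simp: good_def a_def b_def dist_norm pev_diff)
    have ab_lim: "filterlim a at_top sequentially" "filterlim b at_top sequentially"
      using ab(1,2) by (auto simp: filterlim_at_top eventually_sequentially intro: order_trans)
    have "(\<lambda>k. pev (p (a k) - p (b k)) x) \<longlonglongrightarrow> 0"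
    proof (rule spectral_L2_null[OF \<mu>, where K = "K + K"])
      show "cmod (poly (p (a n) - p (b n)) z) \<le> K + K" if "cmod z \<le> 1" for n z
        using norm_triangle_ineq4[of "poly (p (a n)) z" "poly (p (b n)) z"]
          bound[OF that, of "a n"] bound[OF that, of "b n"] by simp
      show "AE \<theta> in \<mu>. (\<lambda>n. poly (p (a n) - p (b n)) (cis \<theta>)) \<longlonglongrightarrow> 0"
        using ae
      proof eventually_elim
        case (elim \<theta>)
        then obtain l where l: "(\<lambda>n. poly (p n) (cis \<theta>)) \<longlonglongrightarrow> l" by (auto simp: convergent_def)
        from tendsto_diff[OF filterlim_compose[OF l ab_lim(1)] filterlim_compose[OF l ab_lim(2)]]
        show ?case by simp
      qed
    qed
    then have "(\<lambda>k. norm (pev (p (a k) - p (b k)) x)) \<longlonglongrightarrow> 0" by (rule tendsto_norm_zero)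
    then have "e \<le> 0" using ab(3) by (intro LIMSEQ_le_const) auto
    then show False using e(1) by simp
  qed
  then show ?thesis by (simp add: Cauchy_convergent_iff)
qed

end

text \<open>Maximise the mass of \<open>\<mu>\<close> over the null sets of \<open>\<nu>\<close>.
  The supremum is attained because countable unions of null sets are null, and a null set charged
  outside N would beat it. Thus N carries the singular part of \<open>\<mu>\<close>.\<close>

lemma exists_maximal_null_set:
  fixes \<mu> \<nu> :: "real measure"
  assumes "finite_measure \<mu>" "sets \<mu> = sets \<nu>"
  obtains N where "N \<in> null_sets \<nu>" "\<And>Z. Z \<in> null_sets \<nu> \<Longrightarrow> Z - N \<in> null_sets \<mu>"
proof -
  interpret finite_measure \<mu> by fact
  define s where "s = (SUP N\<in>null_sets \<nu>. measure \<mu> N)"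
  have bdd: "bdd_above (measure \<mu> ` null_sets \<nu>)"
    by (rule bdd_aboveI[where M = "measure \<mu> (space \<mu>)"]) (auto simp: bounded_measure)
  have ne: "null_sets \<nu> \<noteq> {}" by auto
  have le_s: "measure \<mu> N \<le> s" if "N \<in> null_sets \<nu>" for N
    unfolding s_def by (rule cSUP_upper[OF that bdd])
  have "\<exists>N. N \<in> null_sets \<nu> \<and> s - 1 / real (Suc k) < measure \<mu> N" for k
  proof -
    have "s - 1 / real (Suc k) < s" by simp
    then show ?thesis unfolding s_def less_cSUP_iff[OF ne bdd] by blast
  qed
  then obtain N where N: "\<And>k. N k \<in> null_sets \<nu>" "\<And>k. s - 1 / real (Suc k) < measure \<mu> (N k)" by metis
  define M where "M = (\<Union>k. N k)"
  have M: "M \<in> null_sets \<nu>" unfolding M_def using N(1) by (intro null_sets_UN) auto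
  have sets: "A \<in> sets \<mu>" if "A \<in> null_sets \<nu>" for A using that assms(2) by auto
  have "s \<le> measure \<mu> M"
  proof (rule LIMSEQ_le_const2)
    have "(\<lambda>k. 1 / real (Suc k)) \<longlonglongrightarrow> 0"
      using LIMSEQ_inverse_real_of_nat by (simp add: inverse_eq_divide)
    from tendsto_diff[OF tendsto_const[of s] this]
    show "(\<lambda>k. s - 1 / real (Suc k)) \<longlonglongrightarrow> s" by simp
    have "measure \<mu> (N k) \<le> measure \<mu> M" for k
      using sets[OF M] by (intro finite_measure_mono) (auto simp: M_def)
    then have "s - 1 / real (Suc k) \<le> measure \<mu> M" for k
      using N(2)[of k] by (meson less_imp_le order_trans)
    then show "\<exists>K. \<forall>k\<ge>K. s - 1 / real (Suc k) \<le> measure \<mu> M" by blast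
  qed
  show ?thesis
  proof (rule that[OF M])
    fix Z assume Z: "Z \<in> null_sets \<nu>"
    have "measure \<mu> (M \<union> (Z - M)) = measure \<mu> M + measure \<mu> (Z - M)"
      using sets[OF M] sets[OF Z] by (intro finite_measure_Union) auto
    moreover have "M \<union> (Z - M) \<in> null_sets \<nu>" using M Z by (simp add: null_sets.Un)
    ultimately have "measure \<mu> (Z - M) \<le> 0" using le_s[of "M \<union> (Z - M)"] \<open>s \<le> measure \<mu> M\<close> by linarith
    then have "measure \<mu> (Z - M) = 0" using measure_nonneg[of \<mu> "Z - M"] by linarith
    then show "Z - M \<in> null_sets \<mu>"
      using sets[OF M] sets[OF Z] by (simp add: null_sets_def emeasure_eq_measure)
  qed
qed

context operator
begin

text \<open>The mass of the singular carrier N is the limit of the integrals of p_n, that is, of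
  <p_n(T) x, x>, hence equals <z, x>; it vanishes since complete non-unitarity forces z = 0.\<close>

theorem spectral_absolutely_continuous:
  assumes cnu: "cnu J T" and \<mu>: "spectral x \<mu>"
  shows "null_sets circ \<subseteq> null_sets \<mu>"
proof -
  interpret finite_measure \<mu> by (rule spectralD[OF \<mu>])
  have sets_\<mu> [measurable_cong]: "sets \<mu> = sets borel" by (rule spectralD[OF \<mu>])
  obtain N where N: "N \<in> null_sets circ" "\<And>Z. Z \<in> null_sets circ \<Longrightarrow> Z - N \<in> null_sets \<mu>"
    using exists_maximal_null_set[of \<mu> circ] sets_\<mu> finite_measure_axioms by auto
  have [measurable]: "N \<in> sets borel" using N(1) by auto
  obtain p where p: "\<And>n z. cmod z \<le> 1 \<Longrightarrow> cmod (poly (p n) z) \<le> 1"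
    "AE \<theta> in circ. (\<lambda>n. poly (p n) (cis \<theta>)) \<longlonglongrightarrow> 0"
    "AE \<theta> in \<mu>. \<theta> \<in> N \<inter> {0..2*pi} \<longrightarrow> (\<lambda>n. poly (p n) (cis \<theta>)) \<longlonglongrightarrow> 1"
    "\<And>k. (\<lambda>n. coeff (p n) k) \<longlonglongrightarrow> 0"
    by (rule peak_sequence[OF N(1) finite_measure_axioms sets_\<mu>]) blast
  \<comment> \<open>On N this is the peaking property. Off N, the Lebesgue null set where
    convergence to 0 fails is \<open>\<mu>\<close>-null by maximality of N.\<close>
  have ae: "AE \<theta> in \<mu>. (\<lambda>n. poly (p n) (cis \<theta>)) \<longlonglongrightarrow> indicator N \<theta>"
  proof -
    obtain Z where Z: "Z \<in> null_sets circ" "{\<theta>. \<not> (\<lambda>n. poly (p n) (cis \<theta>)) \<longlonglongrightarrow> 0} \<subseteq> Z"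
      using p(2) by (auto simp: eventually_ae_filter)
    have "AE \<theta> in \<mu>. \<theta> \<notin> Z - N" by (rule AE_not_in[OF N(2)[OF Z(1)]])
    moreover have "AE \<theta> in \<mu>. \<theta> \<in> {0..2*pi}" by (rule spectralD[OF \<mu>])
    ultimately show ?thesis using p(3)
    proof eventually_elim
      case (elim \<theta>)
      then show ?case using Z(2) by (cases "\<theta> \<in> N") auto
    qed
  qed
  have "convergent (\<lambda>n. pev (p n) x)"
    by (rule spectral_L2_convergent[OF \<mu> p(1)], assumption)
      (use ae in \<open>auto simp: convergent_def elim: eventually_mono\<close>)
  then obtain z where z: "(\<lambda>n. pev (p n) x) \<longlonglongrightarrow> z" by (auto simp: convergent_def)
  \<comment> \<open>The limit function is an indicator, hence idempotent, so p_n(T) is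
    asymptotically idempotent at x; this is why it fixes z in the limit.\<close>
  have sq: "(\<lambda>n. pev (p n * p n - p n) x) \<longlonglongrightarrow> 0"
  proof (rule spectral_L2_null[OF \<mu>, where K = 2])
    show "cmod (poly (p n * p n - p n) z) \<le> 2" if "cmod z \<le> 1" for n z
    proof -
      have "cmod (poly (p n) z * poly (p n) z) \<le> 1 * 1"
        unfolding norm_mult using p(1)[OF that] by (intro mult_mono) auto
      then show ?thesis
        using p(1)[OF that, of n] norm_triangle_ineq4[of "poly (p n) z * poly (p n) z" "poly (p n) z"]
        by simp
    qed
    show "AE \<theta> in \<mu>. (\<lambda>n. poly (p n * p n - p n) (cis \<theta>)) \<longlonglongrightarrow> 0"
      using ae
    proof eventually_elim
      case (elim \<theta>)
      from tendsto_diff[OF tendsto_mult[OF elim elim] elim] show ?case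
        by (cases "\<theta> \<in> N") simp_all
    qed
  qed
  have "(\<lambda>n. pev (p n) z) \<longlonglongrightarrow> z"
  proof -
    have "norm (pev (p n) z - z) \<le> 2 * norm (pev (p n) x - z) + norm (pev (p n * p n - p n) x)" for n
    proof -
      have eq: "pev (p n) z - z = pev (p n * p n - p n) x + ((pev (p n) x - z) - pev (p n) (pev (p n) x - z))"
        by (simp add: pev_diff pev_mult pev_diff_right)
      have "norm (pev (p n) (pev (p n) x - z)) \<le> norm (pev (p n) x - z)"
        by (intro norm_pev_le p(1))
      then show ?thesis
        unfolding eq
        using norm_triangle_ineq[of "pev (p n * p n - p n) x" "(pev (p n) x - z) - pev (p n) (pev (p n) x - z)"]
          norm_triangle_ineq4[of "pev (p n) x - z" "pev (p n) (pev (p n) x - z)"] by linarith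
    qed
    moreover have "(\<lambda>n. 2 * norm (pev (p n) x - z) + norm (pev (p n * p n - p n) x)) \<longlonglongrightarrow> 2 * 0 + 0"
      using z sq by (intro tendsto_intros) (auto simp: tendsto_norm_zero_iff LIM_zero_iff)
    ultimately have "(\<lambda>n. norm (pev (p n) z - z)) \<longlonglongrightarrow> 0"
      using LIMSEQ_null_le[of "\<lambda>n. 2 * norm (pev (p n) x - z) + norm (pev (p n * p n - p n) x)"
          "\<lambda>n. norm (pev (p n) z - z)"] by simp
    then show ?thesis by (simp add: tendsto_norm_zero_iff LIM_zero_iff)
  qed
  then have "z = 0" by (intro cnu_pev_fixed_vector[OF cnu, of p] p(1,4)) auto
  have "(\<lambda>n. \<integral>\<theta>. poly (p n) (cis \<theta>) \<partial>\<mu>) \<longlonglongrightarrow> (\<integral>\<theta>. indicator N \<theta> \<partial>\<mu>)"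
    by (rule integral_dominated_convergence[where w = "\<lambda>_. 1"]) (use ae p(1) in auto)
  moreover have "(\<integral>\<theta>. indicator N \<theta> \<partial>\<mu>) = complex_of_real (measure \<mu> N)"
  proof -
    have "(\<integral>\<theta>. indicator N \<theta> \<partial>\<mu>) = (\<integral>\<theta>. complex_of_real (indicator N \<theta>) \<partial>\<mu>)"
      by (intro Bochner_Integration.integral_cong refl) (simp add: indicator_def)
    then show ?thesis using sets_eq_imp_space_eq[OF sets_\<mu>] by simp
  qed
  moreover have "(\<integral>\<theta>. poly (p n) (cis \<theta>) \<partial>\<mu>) = hip (pev (p n) x) x" for n
    by (rule spectralD[OF \<mu>])
  ultimately have "(\<lambda>n. hip (pev (p n) x) x) \<longlonglongrightarrow> complex_of_real (measure \<mu> N)" by simp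
  from LIMSEQ_unique[OF this tendsto_hip[OF z, of x]]
  have "complex_of_real (measure \<mu> N) = 0" using \<open>z = 0\<close> by simp
  then have "N \<in> null_sets \<mu>" using N(1) sets_\<mu> by (auto simp: null_sets_def emeasure_eq_measure)
  show ?thesis
  proof
    fix Z assume "Z \<in> null_sets circ"
    then have "(Z - N) \<union> N \<in> null_sets \<mu>" using N(2) \<open>N \<in> null_sets \<mu>\<close> by (intro null_sets.Un) auto
    moreover have "Z \<in> sets \<mu>"
      using null_setsD2[OF \<open>Z \<in> null_sets circ\<close>] by (simp add: sets_\<mu>)
    ultimately show "Z \<in> null_sets \<mu>" by (rule null_sets_subset) blast
  qed
qed

end

section \<open>Inner functions\<close>

text \<open>Cauchy's estimate, obtained by rescaling to the unit circle and reading the coefficient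
  off as a Fourier coefficient.\<close>

lemma cmod_coeff_le:
  assumes "\<And>z. cmod z \<le> \<rho> \<Longrightarrow> cmod (poly p z) \<le> K" "0 < \<rho>"
  shows "\<rho> ^ k * cmod (coeff p k) \<le> K"
proof -
  define q where "q = pcompose p [:0, of_real \<rho>:]"
  have q: "cmod (poly q (cis \<theta>)) \<le> K" for \<theta>
    using assms by (simp add: q_def poly_pcompose norm_mult)
  have "2 * pi * cmod (coeff q k) = cmod (\<integral>\<theta>. cis (- (real k * \<theta>)) * poly q (cis \<theta>) \<partial>circ)"
    by (simp add: integral_circ_coeff norm_mult)
  also have "\<dots> \<le> (\<integral>\<theta>. K \<partial>circ)"
    by (rule order_trans[OF integral_norm_bound], intro integral_mono integrable_circ_continuous continuous_intros)
      (use q in \<open>auto simp: norm_mult\<close>)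
  also have "\<dots> = 2 * pi * K" by (simp add: measure_def emeasure_circ)
  finally have "cmod (coeff q k) \<le> K" by simp
  then show ?thesis
    using assms(2) by (simp add: q_def coeff_pcompose_linear norm_mult norm_power)
qed

text \<open>\<open>D\<close> is a partial sum of the Cauchy kernel 1 / (1 - z cis(-\<theta>)).
  Truncation at the degree is exact for p, and the geometric bound is uniform in the degree.\<close>

lemma cmod_poly_le_mean:
  assumes "cmod z < 1"
  shows "cmod (poly p z) \<le> (\<integral>\<theta>. cmod (poly p (cis \<theta>)) \<partial>circ) / (2 * pi * (1 - cmod z))"
proof -
  define D where "D \<theta> = (\<Sum>k\<le>degree p. z ^ k * cis (- (real k * \<theta>)))" for \<theta>
  have D: "cmod (D \<theta>) \<le> 1 / (1 - cmod z)" for \<theta>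
  proof -
    have "cmod (D \<theta>) \<le> (\<Sum>k\<le>degree p. cmod z ^ k)"
      unfolding D_def by (rule order_trans[OF norm_sum]) (simp add: norm_mult norm_power)
    also have "\<dots> \<le> (\<Sum>k. cmod z ^ k)"
      using assms by (intro sum_le_suminf summable_geometric) auto
    also have "\<dots> = 1 / (1 - cmod z)" using assms by (intro suminf_geometric) auto
    finally show ?thesis .
  qed
  have "of_real (2 * pi) * poly p z = (\<Sum>k\<le>degree p. z ^ k * (\<integral>\<theta>. cis (- (real k * \<theta>)) * poly p (cis \<theta>) \<partial>circ))"
    unfolding integral_circ_coeff by (simp add: poly_altdef sum_distrib_left mult_ac)
  also have "\<dots> = (\<integral>\<theta>. (\<Sum>k\<le>degree p. z ^ k * (cis (- (real k * \<theta>)) * poly p (cis \<theta>))) \<partial>circ)"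
    by (subst Bochner_Integration.integral_sum)
      (auto intro!: integrable_circ_continuous continuous_intros)
  also have "\<dots> = (\<integral>\<theta>. D \<theta> * poly p (cis \<theta>) \<partial>circ)"
    by (simp add: D_def sum_distrib_right mult.assoc)
  finally have "cmod (of_real (2 * pi) * poly p z) = cmod (\<integral>\<theta>. D \<theta> * poly p (cis \<theta>) \<partial>circ)"
    by (rule arg_cong)
  then have "2 * pi * cmod (poly p z) = cmod (\<integral>\<theta>. D \<theta> * poly p (cis \<theta>) \<partial>circ)"
    by (simp add: norm_mult)
  also have "\<dots> \<le> (\<integral>\<theta>. cmod (D \<theta> * poly p (cis \<theta>)) \<partial>circ)"
    by (rule integral_norm_bound)
  also have "\<dots> \<le> (\<integral>\<theta>. 1 / (1 - cmod z) * cmod (poly p (cis \<theta>)) \<partial>circ)"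
  proof (rule integral_mono)
    show "integrable circ (\<lambda>\<theta>. cmod (D \<theta> * poly p (cis \<theta>)))"
      unfolding D_def by (intro integrable_circ_continuous continuous_intros)
    show "integrable circ (\<lambda>\<theta>. 1 / (1 - cmod z) * cmod (poly p (cis \<theta>)))"
      by (intro integrable_circ_continuous continuous_intros)
    show "cmod (D \<theta> * poly p (cis \<theta>)) \<le> 1 / (1 - cmod z) * cmod (poly p (cis \<theta>))" for \<theta>
      unfolding norm_mult using D by (intro mult_right_mono) auto
  qed
  finally have "2 * pi * cmod (poly p z) \<le> 1 / (1 - cmod z) * (\<integral>\<theta>. cmod (poly p (cis \<theta>)) \<partial>circ)"
    by simp
  then show ?thesis using assms by (simp add: field_simps)
qed

lemma AE_circ_if_AE_lebesgue_on:
  assumes "AE \<theta> in lebesgue_on {0..2*pi}. P \<theta>"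
  shows "AE \<theta> in circ. P \<theta>"
proof -
  have "AE \<theta> in lebesgue. \<theta> \<in> {0..2*pi} \<longrightarrow> P \<theta>"
    using assms by (subst (asm) AE_restrict_space_iff) auto
  then show ?thesis by (simp add: AE_circ_iff AE_completion_iff)
qed

text \<open>A sequence in (0, 1) tending to 1; the shift by 2 makes its first term 1/2, so that
  \<open>u_le_1\<close> can divide by it.\<close>

definition radius :: "nat \<Rightarrow> real" where
  "radius n = 1 - 1 / (real n + 2)"

lemma radius: "0 < radius n" "radius n < 1"
  by (simp_all add: radius_def)

lemma radius_tendsto: "radius \<longlonglongrightarrow> 1"
  unfolding radius_def by real_asymp

lemma filterlim_at_left_1:
  fixes r :: "nat \<Rightarrow> real"
  assumes "\<And>n. r n < 1" "r \<longlonglongrightarrow> 1"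
  shows "filterlim r (at_left 1) sequentially"
proof -
  have "r n \<noteq> 1" for n using assms(1)[of n] by simp
  then show ?thesis using assms by (simp add: filterlim_at)
qed

locale inner_fun =
  fixes u :: "complex \<Rightarrow> complex"
  assumes inner_u: "inner_function u"
begin

lemma holomorphic_u: "u holomorphic_on ball 0 1"
  using inner_u by (simp add: inner_function_def Hinf_def)

lemma isCont_u: "cmod z < 1 \<Longrightarrow> isCont u z"
  using holomorphic_on_imp_continuous_on[OF holomorphic_u]
  by (simp add: continuous_on_eq_continuous_at)

definition radial_limit :: "real \<Rightarrow> complex \<Rightarrow> bool" where
  "radial_limit \<theta> l \<longleftrightarrow> ((\<lambda>r. u (complex_of_real r * cis \<theta>)) \<longlongrightarrow> l) (at_left 1)"

lemma radial_limit_exists: "AE \<theta> in circ. \<exists>l. cmod l = 1 \<and> radial_limit \<theta> l"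
proof -
  have "AE \<theta> in circ. \<exists>l. ((\<lambda>r::real. u (complex_of_real r * cis \<theta>)) \<longlongrightarrow> l) (at_left 1) \<and> cmod l = 1"
    using inner_u by (intro AE_circ_if_AE_lebesgue_on) (simp add: inner_function_def)
  then show ?thesis by eventually_elim (auto simp: radial_limit_def)
qed

lemma poly_tendsto_radial_limit:
  assumes r: "\<And>n. r n < 1" "r \<longlonglongrightarrow> 1"
    and q: "\<And>n z. cmod z \<le> 1 \<Longrightarrow> cmod (poly (q n) z - u (of_real (r n) * z)) \<le> e n" and e: "e \<longlonglongrightarrow> 0"
    and l: "radial_limit \<theta> l"
  shows "(\<lambda>n. poly (q n) (cis \<theta>)) \<longlonglongrightarrow> l"
proof -
  have "(\<lambda>n. poly (q n) (cis \<theta>) - u (of_real (r n) * cis \<theta>)) \<longlonglongrightarrow> 0"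
    by (rule Lim_null_comparison[OF _ e]) (use q in auto)
  from tendsto_add[OF this filterlim_compose[OF l[unfolded radial_limit_def] filterlim_at_left_1[OF r]]]
  show ?thesis by simp
qed

text \<open>Only \<open>|u(z)| \<le> 1 / (1 - |z|)\<close> is immediate from the boundary values; applying this to all
  powers of \<open>u\<close> gives the bound.\<close>

lemma u_le_1:
  assumes z: "cmod z < 1"
  shows "cmod (u z) \<le> 1"
proof -
  define good where
    "good n p \<longleftrightarrow> (\<forall>z. cmod z \<le> 1 \<longrightarrow> cmod (poly p z - u (of_real (radius n) * z)) \<le> 1 / real (Suc n))" for n p
  have "\<exists>p. good n p" for n
  proof -
    let ?r = "radius n"
    have "(\<lambda>z. complex_of_real ?r * z) ` ball 0 (1 / ?r) \<subseteq> ball 0 1"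
      using radius[of n] by (auto simp: norm_mult field_simps)
    then have "u \<circ> (\<lambda>z. of_real ?r * z) holomorphic_on ball 0 (1 / ?r)"
      by (intro holomorphic_on_compose_gen[OF _ holomorphic_u] holomorphic_intros)
    then have "(\<lambda>z. u (of_real ?r * z)) holomorphic_on ball 0 (1 / ?r)" by (simp add: o_def)
    moreover have "1 / ?r > 1" "1 / real (Suc n) > 0" using radius[of n] by auto
    ultimately obtain p where "\<And>z. cmod z \<le> 1 \<Longrightarrow> cmod (poly p z - u (of_real ?r * z)) < 1 / real (Suc n)"
      by (rule holomorphic_poly_approx) blast
    then have "good n p" unfolding good_def by (blast intro: less_imp_le)
    then show ?thesis by blast
  qed
  then obtain q where "\<And>n. good n (q n)" by metis
  then have q: "\<And>n z. cmod z \<le> 1 \<Longrightarrow> cmod (poly (q n) z - u (of_real (radius n) * z)) \<le> 1 / real (Suc n)"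
    unfolding good_def by blast
  have inv0: "(\<lambda>n. 1 / real (Suc n)) \<longlonglongrightarrow> 0"
    using LIMSEQ_inverse_real_of_nat by (simp add: inverse_eq_divide)
  have "bounded (u ` ball 0 1)" using inner_u by (simp add: inner_function_def Hinf_def)
  then obtain C where "\<forall>w\<in>u ` ball 0 1. cmod w \<le> C" by (auto simp: bounded_iff)
  then have C: "cmod (u w) \<le> C" if "cmod w < 1" for w using that by simp
  have q_le: "cmod (poly (q n) (cis \<theta>)) \<le> 1 + C" for n \<theta>
  proof -
    have "cmod (of_real (radius n) * cis \<theta>) < 1" using radius[of n] by (simp add: norm_mult)
    then have "cmod (u (of_real (radius n) * cis \<theta>)) \<le> C" by (rule C)
    moreover have "1 / real (Suc n) \<le> 1" by simp
    moreover have "cmod (poly (q n) (cis \<theta>) - u (of_real (radius n) * cis \<theta>)) \<le> 1 / real (Suc n)"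
      by (rule q) simp
    ultimately show ?thesis
      using norm_triangle_ineq2[of "poly (q n) (cis \<theta>)" "u (of_real (radius n) * cis \<theta>)"]
      by linarith
  qed
  have ae: "AE \<theta> in circ. \<exists>l. cmod l = 1 \<and> (\<lambda>n. poly (q n) (cis \<theta>)) \<longlonglongrightarrow> l"
    using radial_limit_exists
  proof eventually_elim
    case (elim \<theta>)
    then obtain l where l: "cmod l = 1" "radial_limit \<theta> l" by blast
    then show ?case
      using poly_tendsto_radial_limit[OF radius(2) radius_tendsto q inv0 l(2)] by blast
  qed
  have q_z: "(\<lambda>n. poly (q n) z) \<longlonglongrightarrow> u z"
  proof -
    have "(\<lambda>n. of_real (radius n) * z) \<longlonglongrightarrow> of_real 1 * z"
      by (intro tendsto_intros radius_tendsto)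
    then have "(\<lambda>n. u (of_real (radius n) * z)) \<longlonglongrightarrow> u z"
      using isCont_tendsto_compose[OF isCont_u[OF z]] by simp
    moreover have "(\<lambda>n. poly (q n) z - u (of_real (radius n) * z)) \<longlonglongrightarrow> 0"
      by (rule Lim_null_comparison[OF _ inv0]) (use q z in \<open>auto simp: less_imp_le\<close>)
    ultimately show ?thesis using tendsto_add by fastforce
  qed
  \<comment> \<open>The dominating constant (1 + C)^m disappears in the limit, because |q_n|^m tends
    to 1 almost everywhere; so the bound does not depend on m.\<close>
  have pow: "cmod (u z) ^ m \<le> 1 / (1 - cmod z)" for m
  proof (rule LIMSEQ_le)
    show "(\<lambda>n. cmod (poly (q n ^ m) z)) \<longlonglongrightarrow> cmod (u z) ^ m"
      unfolding poly_power norm_power by (intro tendsto_intros q_z)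
    have "(\<lambda>n. \<integral>\<theta>. cmod (poly (q n ^ m) (cis \<theta>)) \<partial>circ) \<longlonglongrightarrow> (\<integral>\<theta>. 1 \<partial>circ)"
    proof (rule integral_dominated_convergence[where w = "\<lambda>_. (1 + C) ^ m"])
      show "AE \<theta> in circ. (\<lambda>n. cmod (poly (q n ^ m) (cis \<theta>))) \<longlonglongrightarrow> 1"
        using ae
      proof eventually_elim
        case (elim \<theta>)
        then obtain l where l: "cmod l = 1" "(\<lambda>n. poly (q n) (cis \<theta>)) \<longlonglongrightarrow> l" by blast
        from tendsto_power[OF tendsto_norm[OF l(2)], of m] l(1) show ?case
          by (simp add: poly_power norm_power)
      qed
    qed (use q_le in \<open>auto simp: poly_power norm_power intro!: power_mono\<close>)
    then have "(\<lambda>n. (\<integral>\<theta>. cmod (poly (q n ^ m) (cis \<theta>)) \<partial>circ) / (2 * pi * (1 - cmod z)))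
        \<longlonglongrightarrow> (\<integral>\<theta>. 1 \<partial>circ) / (2 * pi * (1 - cmod z))"
      using z by (intro tendsto_intros) auto
    then show "(\<lambda>n. (\<integral>\<theta>. cmod (poly (q n ^ m) (cis \<theta>)) \<partial>circ) / (2 * pi * (1 - cmod z)))
        \<longlonglongrightarrow> 1 / (1 - cmod z)"
      by (simp add: measure_def emeasure_circ)
    show "\<exists>N. \<forall>n\<ge>N. cmod (poly (q n ^ m) z) \<le> (\<integral>\<theta>. cmod (poly (q n ^ m) (cis \<theta>)) \<partial>circ) / (2 * pi * (1 - cmod z))"
      using cmod_poly_le_mean[OF z] by blast
  qed
  show ?thesis
  proof (rule ccontr)
    assume "\<not> cmod (u z) \<le> 1"
    then obtain m where "1 / (1 - cmod z) < cmod (u z) ^ m"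
      using real_arch_pow[of "cmod (u z)"] by auto
    then show False using pow[of m] by simp
  qed
qed

lemma u_less_1:
  assumes nonconst: "\<not> (\<exists>c. \<forall>z\<in>ball 0 1. u z = c)" and z: "cmod z < 1"
  shows "cmod (u z) < 1"
proof (rule ccontr)
  assume "\<not> cmod (u z) < 1"
  then have "cmod (u w) \<le> cmod (u z)" if "cmod w < 1" for w
    using u_le_1[OF that] by linarith
  then have "u constant_on ball 0 1"
    using z by (intro maximum_modulus_principle[OF holomorphic_u, of "ball 0 1" z]) auto
  then show False using nonconst by (auto simp: constant_on_def)
qed

end

lemma suminf_tail_bound:
  fixes f :: "nat \<Rightarrow> 'a::{real_normed_vector, complete_space}"
  assumes le: "\<And>n. norm (f n) \<le> g n" and g: "summable g"
  shows "norm ((\<Sum>n<N. f n) - suminf f) \<le> (\<Sum>n. g (n + N))"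
proof -
  define S where "S n = (\<Sum>i<n. f i)" for n
  define t where "t N = (\<Sum>n. g (n + N))" for N
  have g_nonneg: "0 \<le> g n" for n using le[of n] norm_ge_zero order_trans by blast
  have bound: "norm (S M - S N) \<le> t N" if "N \<le> M" for M N
  proof -
    have "S M - S N = sum f {N..<M}"
      using sum_diff_nat_ivl[of 0 N M f] that by (simp add: S_def lessThan_atLeast0)
    also have "norm \<dots> \<le> sum g {N..<M}" by (rule sum_norm_le) (rule le)
    also have "\<dots> = (\<Sum>n<M - N. g (n + N))"
      by (subst sum.atLeastLessThan_shift_0) (simp add: lessThan_atLeast0 add.commute)
    also have "\<dots> \<le> t N"
      unfolding t_def by (rule sum_le_suminf[OF summable_ignore_initial_segment[OF g]]) (auto simp: g_nonneg)
    finally show ?thesis .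
  qed
  have "(\<lambda>N. \<Sum>n. norm (g (n + N))) \<longlonglongrightarrow> 0"
    by (rule suminf_exist_split2) (use g g_nonneg in simp)
  then have t0: "t \<longlonglongrightarrow> 0" using g_nonneg by (simp add: t_def[abs_def])
  have "Cauchy S"
  proof (rule metric_CauchyI)
    fix e :: real assume "e > 0"
    then have "\<forall>\<^sub>F n in sequentially. t n < e / 2" by (intro order_tendstoD(2)[OF t0]) simp
    then obtain N where N: "t N < e / 2" by (auto simp: eventually_sequentially)
    have "dist (S m) (S n) < e" if "m \<ge> N" "n \<ge> N" for m n
    proof -
      have "dist (S m) (S n) \<le> dist (S m) (S N) + dist (S n) (S N)" by (rule dist_triangle2)
      then show ?thesis using bound[OF that(1)] bound[OF that(2)] N by (simp add: dist_norm)
    qed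
    then show "\<exists>M. \<forall>m\<ge>M. \<forall>n\<ge>M. dist (S m) (S n) < e" by blast
  qed
  then obtain s where s: "S \<longlonglongrightarrow> s" by (auto simp: Cauchy_convergent_iff convergent_def)
  then have "suminf f = s" by (simp add: S_def[abs_def] sums_def[symmetric] sums_iff)
  have "(\<lambda>M. norm (S N - S M)) \<longlonglongrightarrow> norm (S N - s)" by (intro tendsto_intros s)
  then have "norm (S N - s) \<le> t N"
    by (rule LIMSEQ_le_const2, intro exI[of _ N] allI impI, subst norm_minus_commute) (rule bound)
  then show ?thesis by (simp add: S_def t_def \<open>suminf f = s\<close>)
qed

section \<open>The H^\<infinity> calculus at an inner function\<close>

locale inner_calculus = operator J T + inner_fun u
  for J :: "'a::{real_inner, complete_space} \<Rightarrow> 'a" and T and u +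
  assumes cnu_T: "cnu J T"
begin

definition tc :: "real \<Rightarrow> nat \<Rightarrow> complex" where
  "tc r n = (deriv ^^ n) u 0 / of_nat (fact n) * complex_of_real (r ^ n)"

text \<open>This is u(rT), the series under the limit in \<open>hinf_calc\<close>. For 0 \<le> r < 1
  the weights r^n make it absolutely convergent.\<close>

definition ur :: "real \<Rightarrow> 'a \<Rightarrow> 'a" where
  "ur r x = (\<Sum>n. sc (tc r n) ((T ^^ n) x))"

lemma pev_tc: "pev (\<Sum>n<N. monom (tc r n) n) x = (\<Sum>n<N. sc (tc r n) ((T ^^ n) x))"
proof (induction N)
  case (Suc N)
  have "monom (tc r N) N = smult (tc r N) (monom 1 N)" by (simp add: smult_monom)
  then show ?case using Suc by (simp add: pev_add pev_smult pev_monom)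
qed simp

text \<open>A Taylor polynomial q of u(rz) serves function and operator alike, since the same
  coefficient tail bounds both errors. As |q| may exceed 1 by up to \<epsilon>, it is divided by 1 +
  \<epsilon>, which accounts for the second \<epsilon>.\<close>

lemma ur_approx:
  assumes r: "0 \<le> r" "r < 1" and \<epsilon>: "0 < \<epsilon>"
  obtains p where "\<And>z. cmod z \<le> 1 \<Longrightarrow> cmod (poly p z) \<le> 1"
    "\<And>z. cmod z \<le> 1 \<Longrightarrow> cmod (poly p z - u (of_real r * z)) \<le> 2 * \<epsilon>"
    "\<And>x. norm (pev p x - ur r x) \<le> 2 * \<epsilon> * norm x"
proof -
  have sm: "summable (\<lambda>n. cmod (tc r n))"
    using summable_Taylor[OF holomorphic_u r] by (simp add: tc_def)
  obtain N where N: "(\<Sum>n. cmod (tc r (n + N))) < \<epsilon>"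
    using order_tendstoD(2)[OF suminf_exist_split2[OF sm] \<epsilon>] by (auto simp: eventually_sequentially)
  define q where "q = (\<Sum>n<N. monom (tc r n) n)"
  have rz: "cmod (of_real r * z) < 1" if "cmod z \<le> 1" for z
    using that r mult_left_le[of "cmod z" r] by (simp add: norm_mult)
  have q_u: "cmod (poly q z - u (of_real r * z)) \<le> \<epsilon>" if "cmod z \<le> 1" for z
  proof -
    have "(\<lambda>n. (deriv ^^ n) u 0 / fact n * (of_real r * z - 0) ^ n) sums u (of_real r * z)"
      by (rule holomorphic_power_series[OF holomorphic_u]) (use rz[OF that] in simp)
    then have "(\<Sum>n. tc r n * z ^ n) = u (of_real r * z)"
      by (simp add: sums_iff tc_def power_mult_distrib mult.assoc)
    then show ?thesis using poly_approx_of_summable[OF sm that, of N] N by (simp add: q_def)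
  qed
  have q_le: "cmod (poly q z) \<le> 1 + \<epsilon>" if "cmod z \<le> 1" for z
    using q_u[OF that] u_le_1[OF rz[OF that]]
      norm_triangle_ineq2[of "poly q z" "u (of_real r * z)"] by linarith
  have q_T: "norm (pev q x - ur r x) \<le> \<epsilon> * norm x" for x
  proof -
    have le: "norm (sc (tc r n) ((T ^^ n) x)) \<le> cmod (tc r n) * norm x" for n
      by (simp add: norm_sc norm_power_le mult_left_mono)
    have "norm (pev q x - ur r x) \<le> (\<Sum>n. cmod (tc r (n + N)) * norm x)"
      unfolding q_def pev_tc ur_def by (rule suminf_tail_bound[OF le summable_mult2[OF sm]])
    also have "\<dots> = (\<Sum>n. cmod (tc r (n + N))) * norm x"
      by (rule suminf_mult2[symmetric, OF summable_ignore_initial_segment[OF sm]])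
    also have "\<dots> \<le> \<epsilon> * norm x" using N by (intro mult_right_mono) auto
    finally show ?thesis .
  qed
  define c where "c = 1 / (1 + \<epsilon>)"
  have c: "0 < c" "c \<le> 1" "1 - c \<le> \<epsilon> * c" "c * (1 + \<epsilon>) = 1" using \<epsilon> by (auto simp: c_def field_simps)
  define p where "p = smult (of_real c) q"
  show ?thesis
  proof (rule that[of p])
    show "cmod (poly p z) \<le> 1" if "cmod z \<le> 1" for z
    proof -
      have "cmod (poly p z) = c * cmod (poly q z)" using c by (simp add: p_def norm_mult)
      also have "\<dots> \<le> c * (1 + \<epsilon>)" using q_le[OF that] c by (intro mult_left_mono) auto
      finally show ?thesis using c by simp
    qed
    show "cmod (poly p z - u (of_real r * z)) \<le> 2 * \<epsilon>" if "cmod z \<le> 1" for z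
    proof -
      have "poly p z - u (of_real r * z) = (poly q z - u (of_real r * z)) - of_real (1 - c) * poly q z"
        by (simp add: p_def algebra_simps)
      also have "cmod \<dots> \<le> cmod (poly q z - u (of_real r * z)) + (1 - c) * cmod (poly q z)"
        using c norm_triangle_ineq4[of "poly q z - u (of_real r * z)" "of_real (1 - c) * poly q z"]
        unfolding norm_mult norm_of_real by simp
      also have "(1 - c) * cmod (poly q z) \<le> (\<epsilon> * c) * (1 + \<epsilon>)"
        using c \<epsilon> q_le[OF that] by (intro mult_mono) auto
      also have "(\<epsilon> * c) * (1 + \<epsilon>) = \<epsilon>" by (simp only: mult.assoc c(4) mult_1_right)
      finally show ?thesis using q_u[OF that] by simp
    qed
    show "norm (pev p x - ur r x) \<le> 2 * \<epsilon> * norm x" for x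
    proof -
      have pev_p: "pev p x = c *\<^sub>R pev q x" by (simp add: p_def pev_smult scaleJ_def)
      have "pev p x - ur r x = (pev q x - ur r x) - (1 - c) *\<^sub>R pev q x"
        unfolding pev_p by (simp add: algebra_simps)
      also have "norm \<dots> \<le> norm (pev q x - ur r x) + (1 - c) * norm (pev q x)"
        using c norm_triangle_ineq4[of "pev q x - ur r x" "(1 - c) *\<^sub>R pev q x"] by simp
      also have "norm (pev q x) \<le> (1 + \<epsilon>) * norm x" using q_le by (intro von_Neumann) simp
      then have "(1 - c) * norm (pev q x) \<le> (\<epsilon> * c) * ((1 + \<epsilon>) * norm x)"
        using c \<epsilon> by (intro mult_mono) auto
      also have "(\<epsilon> * c) * ((1 + \<epsilon>) * norm x) = \<epsilon> * norm x"
      proof -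
        have "(\<epsilon> * c) * ((1 + \<epsilon>) * norm x) = \<epsilon> * (c * (1 + \<epsilon>)) * norm x" by (simp only: mult_ac)
        then show ?thesis by (simp only: c(4) mult_1_right)
      qed
      finally show ?thesis using q_T[of x] by simp
    qed
  qed
qed

text \<open>Spectral estimates speak only about polynomials. This predicate ties one sequence both
  to u(r_n z) on the disc and to u(r_n T) in operator norm, so the boundary behaviour of the former
  decides the convergence of the latter.\<close>

definition approximates :: "(nat \<Rightarrow> real) \<Rightarrow> (nat \<Rightarrow> complex poly) \<Rightarrow> bool" where
  "approximates r q \<longleftrightarrow> (\<forall>n z. cmod z \<le> 1 \<longrightarrow> cmod (poly (q n) z) \<le> 1) \<and>
    (\<forall>n z. cmod z \<le> 1 \<longrightarrow> cmod (poly (q n) z - u (of_real (r n) * z)) \<le> 2 / real (Suc n)) \<and>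
    (\<forall>n x. norm (pev (q n) x - ur (r n) x) \<le> 2 / real (Suc n) * norm x)"

lemma approximatesD:
  assumes "approximates r q"
  shows "cmod z \<le> 1 \<Longrightarrow> cmod (poly (q n) z) \<le> 1"
    "cmod z \<le> 1 \<Longrightarrow> cmod (poly (q n) z - u (of_real (r n) * z)) \<le> 2 / real (Suc n)"
    "norm (pev (q n) x - ur (r n) x) \<le> 2 / real (Suc n) * norm x"
  using assms unfolding approximates_def by blast+

lemma approximates_exists:
  assumes "\<And>n. 0 \<le> r n" "\<And>n. r n < 1"
  obtains q where "approximates r q"
proof -
  define good where "good n p \<longleftrightarrow> (\<forall>z. cmod z \<le> 1 \<longrightarrow> cmod (poly p z) \<le> 1) \<and>
    (\<forall>z. cmod z \<le> 1 \<longrightarrow> cmod (poly p z - u (of_real (r n) * z)) \<le> 2 / real (Suc n)) \<and>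
    (\<forall>x. norm (pev p x - ur (r n) x) \<le> 2 / real (Suc n) * norm x)" for n p
  have "\<exists>p. good n p" for n
  proof -
    have "0 < 1 / real (Suc n)" by simp
    obtain p where p: "\<And>z. cmod z \<le> 1 \<Longrightarrow> cmod (poly p z) \<le> 1"
      "\<And>z. cmod z \<le> 1 \<Longrightarrow> cmod (poly p z - u (of_real (r n) * z)) \<le> 2 * (1 / real (Suc n))"
      "\<And>x. norm (pev p x - ur (r n) x) \<le> 2 * (1 / real (Suc n)) * norm x"
      by (rule ur_approx[OF assms(1)[of n] assms(2)[of n] \<open>0 < 1 / real (Suc n)\<close>]) blast
    have "2 * (1 / real (Suc n)) = 2 / real (Suc n)" by simp
    then have "good n p" unfolding good_def using p by (simp only:) blast
    then show ?thesis by blast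
  qed
  then obtain q where "\<And>n. good n (q n)" by metis
  then have "approximates r q" unfolding good_def approximates_def by blast
  then show ?thesis by (rule that)
qed

lemma two_over_Suc_tendsto: "(\<lambda>n. 2 / real (Suc n)) \<longlonglongrightarrow> 0"
  using LIMSEQ_Suc[OF lim_const_over_n[of "2::real"]] by simp

lemma approximates_radial_limit:
  assumes "approximates r q" "\<And>n. r n < 1" "r \<longlonglongrightarrow> 1"
    and l: "radial_limit \<theta> l"
  shows "(\<lambda>n. poly (q n) (cis \<theta>)) \<longlonglongrightarrow> l"
  by (rule poly_tendsto_radial_limit[OF assms(2,3) approximatesD(2)[OF assms(1)] two_over_Suc_tendsto l])

lemma approximates_tendsto_iff:
  assumes "approximates r q"
  shows "(\<lambda>n. pev (q n) x) \<longlonglongrightarrow> y \<longleftrightarrow> (\<lambda>n. ur (r n) x) \<longlonglongrightarrow> y"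
proof (rule Lim_transform_eq)
  have "(\<lambda>n. 2 / real (Suc n) * norm x) \<longlonglongrightarrow> 0"
    using tendsto_mult_right[OF two_over_Suc_tendsto, of "norm x"] by simp
  then show "(\<lambda>n. pev (q n) x - ur (r n) x) \<longlonglongrightarrow> 0"
    by (rule Lim_null_comparison[rotated]) (use approximatesD(3)[OF assms] in auto)
qed

text \<open>Here complete non-unitarity enters the calculus: radial limits of u, known almost
  everywhere for Lebesgue measure, exist almost everywhere for each spectral measure.\<close>

lemma AE_spectral:
  assumes "spectral x \<mu>" "AE \<theta> in circ. P \<theta>"
  shows "AE \<theta> in \<mu>. P \<theta>"
proof -
  obtain N where N: "N \<in> null_sets circ" "{\<theta>. \<not> P \<theta>} \<subseteq> N"
    using assms(2) by (auto simp: eventually_ae_filter)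
  then have "N \<in> null_sets \<mu>" using spectral_absolutely_continuous[OF cnu_T assms(1)] by blast
  then show ?thesis using N(2) by (intro AE_I'[of N]) auto
qed

lemma ur_convergent: "\<exists>y. ((\<lambda>r. ur r x) \<longlongrightarrow> y) (at_left 1)"
proof -
  obtain \<mu> where \<mu>: "spectral x \<mu>" by (rule spectral_exists)
  note ae = AE_spectral[OF \<mu> radial_limit_exists]
  obtain q where q: "approximates radius q"
    by (rule approximates_exists[of radius, OF less_imp_le[OF radius(1)] radius(2)]) blast
  have "convergent (\<lambda>n. pev (q n) x)"
  proof (rule spectral_L2_convergent[OF \<mu>, where K = 1])
    show "cmod (poly (q n) z) \<le> 1" if "cmod z \<le> 1" for n z by (rule approximatesD(1)[OF q that])
    show "AE \<theta> in \<mu>. convergent (\<lambda>n. poly (q n) (cis \<theta>))"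
      using ae
    proof eventually_elim
      case (elim \<theta>)
      then obtain l where l: "radial_limit \<theta> l"
        by blast
      show ?case
        unfolding convergent_def
        using approximates_radial_limit[OF q radius(2) radius_tendsto l] by blast
    qed
  qed
  then obtain y where y: "(\<lambda>n. pev (q n) x) \<longlonglongrightarrow> y" by (auto simp: convergent_def)
  have "((\<lambda>r. ur r x) \<longlongrightarrow> y) (at_left 1)"
  proof (rule tendsto_at_left_sequentially[of 0])
    fix S :: "nat \<Rightarrow> real" assume S: "\<And>n. S n < 1" "\<And>n. 0 < S n" "S \<longlonglongrightarrow> 1"
    obtain p where p: "approximates S p"
      by (rule approximates_exists[of S, OF less_imp_le[OF S(2)] S(1)]) blast
    \<comment> \<open>A limit along \<open>radius\<close> alone does not give the limit as r tends
      to 1. For an arbitrary S the polynomials p n and q n share their radial limits almost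
      everywhere, so the difference is null and the limit is the same y.\<close>
    have "(\<lambda>n. pev (p n - q n) x) \<longlonglongrightarrow> 0"
    proof (rule spectral_L2_null[OF \<mu>, where K = 2])
      show "cmod (poly (p n - q n) z) \<le> 2" if "cmod z \<le> 1" for n z
        using approximatesD(1)[OF p that, of n] approximatesD(1)[OF q that, of n]
          norm_triangle_ineq4[of "poly (p n) z" "poly (q n) z"] by simp
      show "AE \<theta> in \<mu>. (\<lambda>n. poly (p n - q n) (cis \<theta>)) \<longlonglongrightarrow> 0"
        using ae
      proof eventually_elim
        case (elim \<theta>)
        then obtain l where l: "radial_limit \<theta> l"
          by blast
        from tendsto_diff[OF approximates_radial_limit[OF p S(1,3) l]
            approximates_radial_limit[OF q radius(2) radius_tendsto l]]
        show ?case by simp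
      qed
    qed
    from tendsto_add[OF this y] have "(\<lambda>n. pev (p n) x) \<longlonglongrightarrow> y" by (simp add: pev_diff)
    then show "(\<lambda>n. ur (S n) x) \<longlonglongrightarrow> y" by (simp add: approximates_tendsto_iff[OF p])
  qed simp
  then show ?thesis by blast
qed

lemma ur_tendsto: "((\<lambda>r. ur r x) \<longlongrightarrow> hinf_calc J u T x) (at_left 1)"
proof -
  obtain y where y: "((\<lambda>r. ur r x) \<longlongrightarrow> y) (at_left 1)" using ur_convergent by blast
  have "hinf_calc J u T x = Lim (at_left 1) (\<lambda>r. ur r x)"
    by (simp add: hinf_calc_def ur_def tc_def)
  also have "\<dots> = y" by (rule tendsto_Lim[OF _ y]) simp
  finally show ?thesis using y by simp
qed

text \<open>One sequence q serves all vectors x, so u(T) inherits linearity and contractivity from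
  the q_n(T), and composition with itself can be approximated.\<close>

lemma approximating_sequence:
  obtains q where "approximates radius q" "\<And>x. (\<lambda>n. pev (q n) x) \<longlonglongrightarrow> hinf_calc J u T x"
proof -
  obtain q where q: "approximates radius q"
    by (rule approximates_exists[of radius, OF less_imp_le[OF radius(1)] radius(2)]) blast
  have "(\<lambda>n. ur (radius n) x) \<longlonglongrightarrow> hinf_calc J u T x" for x
    by (intro filterlim_compose[OF ur_tendsto[of x]] filterlim_at_left_1 radius radius_tendsto)
  then show ?thesis using q that by (simp add: approximates_tendsto_iff[OF q])
qed

lemma calc_contractive: "contractive (hinf_calc J u T)"
proof -
  obtain q where q: "approximates radius q" and lim: "\<And>x. (\<lambda>n. pev (q n) x) \<longlonglongrightarrow> hinf_calc J u T x"
    by (rule approximating_sequence) blast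
  have le: "norm (hinf_calc J u T x) \<le> norm x" for x
    by (rule LIMSEQ_le_const2[OF tendsto_norm[OF lim]])
      (use norm_pev_le approximatesD(1)[OF q] in blast)
  show ?thesis
  proof (rule contractive.intro[OF bounded_linear_intro[where K = 1]])
    show "hinf_calc J u T (x + y) = hinf_calc J u T x + hinf_calc J u T y" for x y
      using LIMSEQ_unique[OF lim[of "x + y"]] tendsto_add[OF lim[of x] lim[of y]]
      by (simp add: pev_add_right)
    show "hinf_calc J u T (r *\<^sub>R x) = r *\<^sub>R hinf_calc J u T x" for r x
      using LIMSEQ_unique[OF lim[of "r *\<^sub>R x"]] tendsto_scaleR[OF tendsto_const lim[of x], of r]
      by (simp add: pev_scaleR)
  qed (use le in auto)
qed

lemma calc_A_isometric:
  "inner (A_op T (hinf_calc J u T x)) (hinf_calc J u T x) = inner (A_op T x) x"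
proof -
  interpret A: invariant_form J T "A_op T" by (rule invariant_form_A)
  obtain q where q: "approximates radius q" and lim: "\<And>x. (\<lambda>n. pev (q n) x) \<longlonglongrightarrow> hinf_calc J u T x"
    by (rule approximating_sequence) blast
  obtain \<nu> :: "real measure" where \<nu>: "finite_measure \<nu>" "sets \<nu> = sets borel"
    "AE \<theta> in \<nu>. \<theta> \<in> {0..2*pi}"
    and form: "\<And>p. inner (A_op T (pev p x)) (pev p x) = (\<integral>\<theta>. (cmod (poly p (cis \<theta>)))\<^sup>2 \<partial>\<nu>)"
    by (rule A.spectral_measure) (use A_isometric in blast)
  interpret \<nu>: finite_measure \<nu> by fact
  note [measurable_cong] = \<nu>(2)
  have space: "space \<nu> = UNIV" using sets_eq_imp_space_eq[OF \<nu>(2)] by simp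
  obtain \<mu> where \<mu>: "spectral x \<mu>" by (rule spectral_exists)
  interpret \<mu>: finite_measure \<mu> by (rule spectralD[OF \<mu>])
  have [measurable_cong]: "sets \<mu> = sets borel" by (rule spectralD[OF \<mu>])
  \<comment> \<open>Absolute continuity of \<open>\<nu>\<close> is inherited from
    \<open>\<mu>\<close>: along peak polynomials p_n(T) x tends to 0, and the form of
    \<open>A_op T\<close> there, which bounds the integral of |p_n|^2 over N, is below the squared
    norm of p_n(T) x.\<close>
  have ac: "N \<in> null_sets \<nu>" if N: "N \<in> null_sets circ" for N
  proof -
    have N_sets [measurable]: "N \<in> sets borel" using null_setsD2[OF N] by simp
    obtain p where p: "\<And>n z. cmod z \<le> 1 \<Longrightarrow> cmod (poly (p n) z) \<le> 1"
      "AE \<theta> in circ. (\<lambda>n. poly (p n) (cis \<theta>)) \<longlonglongrightarrow> 0"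
      "AE \<theta> in \<nu>. \<theta> \<in> N \<inter> {0..2*pi} \<longrightarrow> (\<lambda>n. poly (p n) (cis \<theta>)) \<longlonglongrightarrow> 1"
      by (rule peak_sequence[OF N \<nu>(1,2)]) blast
    have "(\<lambda>n. pev (p n) x) \<longlonglongrightarrow> 0"
      by (rule spectral_L2_null[OF \<mu> p(1) AE_spectral[OF \<mu> p(2)]])
    from tendsto_power[OF tendsto_norm[OF this], of 2]
    have "(\<lambda>n. (norm (pev (p n) x))\<^sup>2) \<longlonglongrightarrow> 0" by simp
    moreover have "(\<lambda>n. \<integral>\<theta>. indicator N \<theta> * (cmod (poly (p n) (cis \<theta>)))\<^sup>2 \<partial>\<nu>) \<longlonglongrightarrow> (\<integral>\<theta>. indicator N \<theta> \<partial>\<nu>)"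
    proof (rule integral_dominated_convergence[where w = "\<lambda>_. 1"])
      show "AE \<theta> in \<nu>. (\<lambda>n. indicator N \<theta> * (cmod (poly (p n) (cis \<theta>)))\<^sup>2) \<longlonglongrightarrow> indicator N \<theta>"
        using p(3) \<nu>(3)
      proof eventually_elim
        case (elim \<theta>)
        show ?case
        proof (cases "\<theta> \<in> N")
          case True
          then have "(\<lambda>n. poly (p n) (cis \<theta>)) \<longlonglongrightarrow> 1" using elim by blast
          from tendsto_power[OF tendsto_norm[OF this], of 2] True show ?thesis by simp
        qed simp
      qed
      show "AE \<theta> in \<nu>. norm (indicator N \<theta> * (cmod (poly (p n) (cis \<theta>)))\<^sup>2) \<le> 1" for n
        using p(1) by (intro AE_I2) (simp add: indicator_def power_le_one)
    qed auto
    moreover have "(\<integral>\<theta>. indicator N \<theta> * (cmod (poly (p n) (cis \<theta>)))\<^sup>2 \<partial>\<nu>) \<le> (norm (pev (p n) x))\<^sup>2" for n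
    proof -
      have i: "integrable \<nu> (\<lambda>\<theta>. (cmod (poly (p n) (cis \<theta>)))\<^sup>2)"
        by (rule integrable_poly_cis[OF \<nu>(1,2)])
      have "(\<integral>\<theta>. indicator N \<theta> * (cmod (poly (p n) (cis \<theta>)))\<^sup>2 \<partial>\<nu>) \<le> (\<integral>\<theta>. (cmod (poly (p n) (cis \<theta>)))\<^sup>2 \<partial>\<nu>)"
      proof (rule integral_mono[OF _ i])
        show "integrable \<nu> (\<lambda>\<theta>. indicator N \<theta> * (cmod (poly (p n) (cis \<theta>)))\<^sup>2)"
          using integrable_mult_indicator[OF _ i, of N] N_sets \<nu>(2) by simp
      qed (simp add: indicator_def)
      also have "\<dots> \<le> (norm (pev (p n) x))\<^sup>2"
        unfolding form[symmetric] by (rule A_form_le)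
      finally show ?thesis .
    qed
    ultimately have "(\<integral>\<theta>. indicator N \<theta> \<partial>\<nu>) \<le> (0 :: real)"
      by (intro LIMSEQ_le[of _ _ "\<lambda>n. (norm (pev (p n) x))\<^sup>2" 0]) auto
    then have "measure \<nu> N = 0" using measure_nonneg[of \<nu> N] by (simp add: space)
    then show ?thesis using N_sets \<nu>(2) by (simp add: null_sets_def \<nu>.emeasure_eq_measure)
  qed
  have "AE \<theta> in \<nu>. (\<lambda>n. (cmod (poly (q n) (cis \<theta>)))\<^sup>2) \<longlonglongrightarrow> 1"
  proof -
    obtain N where N: "N \<in> null_sets circ" "{\<theta>. \<not> (\<exists>l. cmod l = 1 \<and> radial_limit \<theta> l)} \<subseteq> N"
      using radial_limit_exists by (auto simp: eventually_ae_filter)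
    have "AE \<theta> in \<nu>. \<theta> \<notin> N" by (rule AE_not_in[OF ac[OF N(1)]])
    then show ?thesis
    proof eventually_elim
      case (elim \<theta>)
      then obtain l where l: "cmod l = 1" "radial_limit \<theta> l"
        using N(2) by blast
      have "(\<lambda>n. poly (q n) (cis \<theta>)) \<longlonglongrightarrow> l"
        by (rule approximates_radial_limit[OF q radius(2) radius_tendsto l(2)])
      from tendsto_power[OF tendsto_norm[OF this], of 2] l(1) show ?case by simp
    qed
  qed
  then have "(\<lambda>n. \<integral>\<theta>. (cmod (poly (q n) (cis \<theta>)))\<^sup>2 \<partial>\<nu>) \<longlonglongrightarrow> (\<integral>\<theta>. 1 \<partial>\<nu>)"
    using approximatesD(1)[OF q]
    by (intro integral_dominated_convergence[where w = "\<lambda>_. 1"]) (auto simp: power_le_one)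
  moreover have "(\<integral>\<theta>. 1 \<partial>\<nu>) = inner (A_op T x) x" using form[of 1] by simp
  ultimately have "(\<lambda>n. inner (A_op T (pev (q n) x)) (pev (q n) x)) \<longlonglongrightarrow> inner (A_op T x) x"
    by (simp add: form)
  moreover have "(\<lambda>n. inner (A_op T (pev (q n) x)) (pev (q n) x))
      \<longlonglongrightarrow> inner (A_op T (hinf_calc J u T x)) (hinf_calc J u T x)"
    by (intro tendsto_inner lim bounded_linear.tendsto[OF A_bounded_linear])
  ultimately show ?thesis by (rule LIMSEQ_unique[symmetric])
qed

text \<open>Let \<beta> be the maximum of |u| on |z| \<le> 1/2, below 1 by the maximum principle.
  Cauchy's estimate at radius 1/2 bounds the i-th coefficient of u^m by 2^i \<beta>^m; summing over
  i < k gives at most k 2^k \<beta>^m, the number s of \<open>norm_pev_le_shift\<close>. For fixed k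
  it tends to 0 as m grows.\<close>

lemma calc_power_le:
  assumes nonconst: "\<not> (\<exists>c. \<forall>z\<in>ball 0 1. u z = c)"
  obtains \<beta> where "0 \<le> \<beta>" "\<beta> < 1"
    "\<And>m k x. norm ((hinf_calc J u T ^^ m) x)
      \<le> real k * 2 ^ k * \<beta> ^ m * norm x + (1 + real k * 2 ^ k * \<beta> ^ m) * norm ((T ^^ k) x)"
proof -
  let ?U = "hinf_calc J u T"
  obtain q where q: "approximates radius q" and lim: "\<And>x. (\<lambda>n. pev (q n) x) \<longlonglongrightarrow> ?U x"
    by (rule approximating_sequence) blast
  have "continuous_on (cball 0 (1/2)) (\<lambda>z. cmod (u z))"
    using isCont_u by (intro continuous_on_norm continuous_at_imp_continuous_on) auto
  then obtain z0 where z0: "cmod z0 \<le> 1/2" "\<And>z. cmod z \<le> 1/2 \<Longrightarrow> cmod (u z) \<le> cmod (u z0)"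
    using continuous_attains_sup[of "cball 0 (1/2::real)" "\<lambda>z. cmod (u z)"] by auto
  define \<beta> where "\<beta> = cmod (u z0)"
  have \<beta>: "0 \<le> \<beta>" "\<beta> < 1" using u_less_1[OF nonconst, of z0] z0(1) by (auto simp: \<beta>_def)
  have q_half: "cmod (poly (q n) z) \<le> \<beta> + 2 / real (Suc n)" if "cmod z \<le> 1/2" for n z
  proof -
    have "cmod (of_real (radius n) * z) \<le> 1/2"
      using that radius[of n] mult_mono[of "radius n" 1 "cmod z" "1/2"] by (simp add: norm_mult)
    then show ?thesis
      using z0(2) approximatesD(2)[OF q, of z n] that
        norm_triangle_ineq2[of "poly (q n) z" "u (of_real (radius n) * z)"]
      by (fastforce simp: \<beta>_def)
  qed
  \<comment> \<open>Products of strongly convergent contractions converge strongly, which identifies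
    the limit of the q_n^m(T) with the m-th power of u(T).\<close>
  have pow_lim: "(\<lambda>n. pev (q n ^ m) x) \<longlonglongrightarrow> (?U ^^ m) x" for m x
  proof (induction m)
    case (Suc m)
    let ?y = "(?U ^^ m) x"
    have le: "norm (pev (q n ^ Suc m) x - ?U ?y) \<le> norm (pev (q n ^ m) x - ?y) + norm (pev (q n) ?y - ?U ?y)" for n
    proof -
      have eq: "pev (q n ^ Suc m) x - ?U ?y = pev (q n) (pev (q n ^ m) x - ?y) + (pev (q n) ?y - ?U ?y)"
        by (simp add: pev_mult pev_diff_right)
      have "norm (pev (q n) (pev (q n ^ m) x - ?y)) \<le> norm (pev (q n ^ m) x - ?y)"
        using approximatesD(1)[OF q] by (intro norm_pev_le)
      then show ?thesis
        unfolding eq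
        using norm_triangle_ineq[of "pev (q n) (pev (q n ^ m) x - ?y)" "pev (q n) ?y - ?U ?y"]
        by linarith
    qed
    have "(\<lambda>n. norm (pev (q n ^ m) x - ?y) + norm (pev (q n) ?y - ?U ?y)) \<longlonglongrightarrow> 0 + 0"
      using Suc lim[of ?y] by (intro tendsto_add) (simp_all add: tendsto_norm_zero_iff LIM_zero_iff)
    then have g0: "(\<lambda>n. norm (pev (q n ^ m) x - ?y) + norm (pev (q n) ?y - ?U ?y)) \<longlonglongrightarrow> 0"
      by (simp only: add_0_right)
    have "(\<lambda>n. pev (q n ^ Suc m) x - ?U ?y) \<longlonglongrightarrow> 0"
      by (rule Lim_null_comparison[OF always_eventually[OF allI[OF le]] g0])
    then show ?case by (simp add: LIM_zero_iff)
  qed simp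
  show ?thesis
  proof (rule that[OF \<beta>])
    fix m k :: nat and x
    define c where "c n = real k * 2 ^ k * (\<beta> + 2 / real (Suc n)) ^ m" for n
    have c_lim: "c \<longlonglongrightarrow> real k * 2 ^ k * (\<beta> + 0) ^ m"
      unfolding c_def by (intro tendsto_intros two_over_Suc_tendsto)
    have le: "norm (pev (q n ^ m) x) \<le> c n * norm x + (1 + c n) * norm ((T ^^ k) x)" for n
    proof -
      define s where "s = (\<Sum>i<k. cmod (coeff (q n ^ m) i))"
      have "cmod (coeff (q n ^ m) i) \<le> 2 ^ k * (\<beta> + 2 / real (Suc n)) ^ m" if "i < k" for i
      proof -
        have "(1/2) ^ i * cmod (coeff (q n ^ m) i) \<le> (\<beta> + 2 / real (Suc n)) ^ m"
          by (rule cmod_coeff_le) (use q_half in \<open>auto simp: poly_power norm_power intro!: power_mono\<close>)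
        then have "cmod (coeff (q n ^ m) i) \<le> 2 ^ i * (\<beta> + 2 / real (Suc n)) ^ m"
          by (simp add: field_simps power_one_over)
        also have "\<dots> \<le> 2 ^ k * (\<beta> + 2 / real (Suc n)) ^ m"
          using that \<beta> by (intro mult_right_mono power_increasing) auto
        finally show ?thesis .
      qed
      then have "s \<le> (\<Sum>i<k. 2 ^ k * (\<beta> + 2 / real (Suc n)) ^ m)" unfolding s_def by (intro sum_mono) auto
      then have "s \<le> c n" by (simp add: c_def)
      have "norm (pev (q n ^ m) x) \<le> s * norm x + (1 + s) * norm ((T ^^ k) x)"
        unfolding s_def
      proof (rule norm_pev_le_shift)
        show "cmod (poly (q n ^ m) z) \<le> 1" if "cmod z \<le> 1" for z
          using approximatesD(1)[OF q that, of n] by (simp add: poly_power norm_power power_le_one)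
      qed
      also have "\<dots> \<le> c n * norm x + (1 + c n) * norm ((T ^^ k) x)"
        using \<open>s \<le> c n\<close> by (intro add_mono mult_right_mono) auto
      finally show ?thesis .
    qed
    have "(\<lambda>n. c n * norm x + (1 + c n) * norm ((T ^^ k) x))
        \<longlonglongrightarrow> (real k * 2 ^ k * (\<beta> + 0) ^ m) * norm x + (1 + (real k * 2 ^ k * (\<beta> + 0) ^ m)) * norm ((T ^^ k) x)"
      by (intro tendsto_intros c_lim)
    from LIMSEQ_le[OF tendsto_norm[OF pow_lim[of m x]] this] le
    show "norm ((?U ^^ m) x)
      \<le> real k * 2 ^ k * \<beta> ^ m * norm x + (1 + real k * 2 ^ k * \<beta> ^ m) * norm ((T ^^ k) x)"
      by simp
  qed
qed

theorem A_op_calc: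
  assumes nonconst: "\<not> (\<exists>c. \<forall>z\<in>ball 0 1. u z = c)"
  shows "A_op T = A_op (hinf_calc J u T)"
proof (rule A_op_eqI[OF contractive_axioms calc_contractive], rule antisym)
  fix x
  let ?U = "hinf_calc J u T"
  interpret U: contractive ?U by (rule calc_contractive)
  show "inner (A_op T x) x \<le> inner (A_op ?U x) x"
    using A_op_le_if_isometric[OF contractive_axioms calc_contractive calc_A_isometric]
    by (simp add: op_le_def)
  obtain \<beta> where \<beta>: "0 \<le> \<beta>" "\<beta> < 1"
    "\<And>m k x. norm ((?U ^^ m) x)
      \<le> real k * 2 ^ k * \<beta> ^ m * norm x + (1 + real k * 2 ^ k * \<beta> ^ m) * norm ((T ^^ k) x)"
    using calc_power_le[OF nonconst] by blast
  \<comment> \<open>The order of limits matters: m goes to infinity with k fixed, which removes the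
    terms with \<beta>^m, and only then k.\<close>
  have "inner (A_op ?U x) x \<le> (norm ((T ^^ k) x))\<^sup>2" for k
  proof (rule LIMSEQ_le[OF U.A_form_limit])
    have "(\<lambda>m. (real k * 2 ^ k * \<beta> ^ m * norm x + (1 + real k * 2 ^ k * \<beta> ^ m) * norm ((T ^^ k) x))\<^sup>2)
        \<longlonglongrightarrow> (real k * 2 ^ k * 0 * norm x + (1 + real k * 2 ^ k * 0) * norm ((T ^^ k) x))\<^sup>2"
      by (intro tendsto_intros LIMSEQ_realpow_zero \<beta>)
    then show "(\<lambda>m. (real k * 2 ^ k * \<beta> ^ m * norm x + (1 + real k * 2 ^ k * \<beta> ^ m) * norm ((T ^^ k) x))\<^sup>2)
        \<longlonglongrightarrow> (norm ((T ^^ k) x))\<^sup>2" by simp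
    show "\<exists>N. \<forall>m\<ge>N. (norm ((?U ^^ m) x))\<^sup>2
      \<le> (real k * 2 ^ k * \<beta> ^ m * norm x + (1 + real k * 2 ^ k * \<beta> ^ m) * norm ((T ^^ k) x))\<^sup>2"
      using \<beta>(3) by (intro exI[of _ 0] allI impI power_mono) auto
  qed
  then show "inner (A_op ?U x) x \<le> inner (A_op T x) x"
    by (intro LIMSEQ_le_const[OF A_form_limit]) auto
qed

end

theorem mainTheorem5:
  fixes J :: "'a::{real_inner, complete_space} \<Rightarrow> 'a"
  assumes "cplx_structure J"
  shows
   "(\<forall>T1 T2. contraction J T1 \<and> contraction J T2 \<and> T1 \<circ> T2 = T2 \<circ> T1 \<longrightarrow>
        op_le (A_op (T1 \<circ> T2)) (A_op T1) \<and> op_le (A_op (T1 \<circ> T2)) (A_op T2))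
  \<and> (\<forall>T u. contraction J T \<and> cnu J T \<and> inner_function u \<and> \<not> (\<exists>c. \<forall>z\<in>ball 0 1. u z = c) \<longrightarrow>
        A_op T = A_op (hinf_calc J u T))
  \<and> (\<forall>T1 T2 A. contraction J T1 \<and> contraction J T2 \<and> A_op T1 = A \<and> A_op T2 = A \<longrightarrow>
        op_le A (A_op (T1 \<circ> T2)))
  \<and> (\<forall>T1 T2. contraction J T1 \<and> contraction J T2 \<and> T1 \<circ> T2 = T2 \<circ> T1 \<and> A_op T1 = A_op T2 \<longrightarrow>
        A_op (T1 \<circ> T2) = A_op T1 \<and> A_op T1 = A_op T2)"
proof -
  have contr: "contractive T" if "contraction J T" for T
    using that by (auto simp: contraction_def bop_def intro: contractive.intro)
  have i: "op_le (A_op (T1 \<circ> T2)) (A_op T1)" "op_le (A_op (T1 \<circ> T2)) (A_op T2)"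
    if "contraction J T1" "contraction J T2" "T1 \<circ> T2 = T2 \<circ> T1" for T1 T2
    using A_op_comp_le[of T2 T1] A_op_comp_le[of T1 T2] contr that by auto
  have ii: "A_op T = A_op (hinf_calc J u T)"
    if "contraction J T" "cnu J T" "inner_function u" "\<not> (\<exists>c. \<forall>z\<in>ball 0 1. u z = c)" for T u
  proof -
    have "operator J T"
      using that(1) assms contr[OF that(1)]
      by (auto simp: contraction_def bop_def intro!: operator.intro complex_structure.intro operator_axioms.intro)
    then interpret inner_calculus J T u
      using that(2,3) by (intro inner_calculus.intro inner_fun.intro inner_calculus_axioms.intro)
    show ?thesis by (rule A_op_calc[OF that(4)])
  qed
  \<comment> \<open>Each factor preserves the form of the common limit A, hence so does the
    product.\<close>
  have iii: "op_le A (A_op (T1 \<circ> T2))"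
    if "contraction J T1" "contraction J T2" "A_op T1 = A" "A_op T2 = A" for T1 T2 A
    unfolding that(3)[symmetric]
  proof (rule A_op_le_if_isometric)
    interpret T1: contractive T1 using contr that by blast
    interpret T2: contractive T2 using contr that by blast
    show "contractive T1" "contractive (T1 \<circ> T2)"
      by (intro T1.contractive_axioms contractive_comp T2.contractive_axioms)+
    show "inner (A_op T1 ((T1 \<circ> T2) x)) ((T1 \<circ> T2) x) = inner (A_op T1 x) x" for x
      using T1.A_isometric[of "T2 x" "T2 x"] T2.A_isometric[of x x] that(3,4) by simp
  qed
  have iv: "A_op (T1 \<circ> T2) = A_op T1"
    if "contraction J T1" "contraction J T2" "T1 \<circ> T2 = T2 \<circ> T1" "A_op T1 = A_op T2" for T1 T2
    using i[OF that(1-3)] iii[OF that(1,2) refl that(4)[symmetric]] contr that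
    by (intro A_op_eqI contractive_comp) (auto simp: op_le_def intro: antisym)
  show ?thesis
    by (intro conjI allI impI; elim conjE) (rule i ii iii iv; assumption | assumption)+
qed

end
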